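(* For every integer $n\ge0$ the rank moments $N_j(n)$ and crank moments $M_j(n)$ satisfy the following five identities. (1) $$N_{4}(n)=\tfrac{2}{3}(-3n-1)M_{2}(n)+\tfrac{8}{3}M_{4}(n)+(-12n+1)N_{2}(n).$$ (2) $$N_{6}(n)=\tfrac{2}{33}(324n^{2}+69n-10)M_{2}(n)+\tfrac{20}{33}(-45n+4)M_{4}(n)+\tfrac{18}{11}M_{6}(n)+(108n^{2}-24n+1)N_{2}(n).$$ (3) $$\begin{aligned}N_{8}(n)&=\tfrac{2}{913}(-72972n^{3}-1728n^{2}+5667n-289)M_{2}(n)+\tfrac{280}{913}(732n^{2}-195n+8)M_{4}(n)\\&\quad+\tfrac{84}{913}(-196n+15)M_6(n)+\tfrac{1248}{913}M_{8}(n)+(-864n^{3}+360n^{2}-36n+1)N_{2}(n).\end{aligned}$$ (4) $$\begin{aligned}N_{10}(n)&=\tfrac{2}{5951847}(3588144480n^{4}-805458600n^{3}-398007108n^{2}+56257647n-1794592)M_{2}(n)\\ &\quad+\tfrac{140}{5951847}(-72270360n^{3}+36826920n^{2}-3625245n+104002)M_{4}(n)\\ &\quad+\tfrac{210}{1983949}(1421544n^{2}-380744n+13519)M_{6}(n)\\ &\quad+\tfrac{120}{1983949}(-282435n+18796)M_{8}(n)+\tfrac{2724}{2173}M_{10}(n)\\ &\quad+(6480n^{4}-4320n^{3}+756n^{2}-48n+1)N_{2}(n).\end{aligned}$$ (5) $$\begin{aligned}N_{14}(n)&=\tfrac{1}{4505033323132497}\bigl(-655918847016750354240\,n^{6}+584104439765983424400\,n^{5}-88193910587689930464\,n^{4}\\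 &\qquad-51255985689606317364\,n^{3}+12889219681488512844\,n^{2}-1033571808069319887\,n+23432656561492057\bigr)M_{2}(n)\\ &\quad+\tfrac{364}{4505033323132497}\bigl(2544016408481081520\,n^{5}-2986029950270749200\,n^{4}+1233083592931144500\,n^{3}\\ &\qquad-185464100558325420\,n^{2}+12124758510318780\,n-229618708346923\bigr)M_{4}(n)\\ &\quad+\tfrac{728}{500559258125833}\bigl(-12932704022040180\,n^{4}+11781511098477120\,n^{3}-3661921161131415\,n^{2}\\ &\qquad+234233352768436\,n-7334109150929\bigr)M_{6}(n)\\ &\quad+\tfrac{364}{500559258125833}\bigl(3327634333443960\,n^{3}-2184561928177200\,n^{2}+464283118670595\,n-12774042869566\bigr)M_{8}(n)\\ &\quad+\tfrac{2002}{6030834435251}\bigl(-758615153688\,n^{2}+404700708960\,n-24122003839\bigr)M_{10}(n)\\ &\quad+\tfrac{25388554464}{2775349487}(n-1)M_{12}(n)+\tfrac{139497552}{120667369}M_{14}(n)\\ &\quad+\tfrac{1}{138}\bigl(-107775360\,n^{6}+143700480\,n^{5}-70752528\,n^{4}+14978304\,n^{3}-1456488\,n^{2}+64320\,n-1045\bigr)N_{2}(n)\\ &\quad+\tfrac{91}{138}(-36n+13)N_{12}(n).\end{aligned}$$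
   Context: The rank of a partition is its largest part minus its number of parts. $N(m,n)$ is the number of partitions of $n$ with rank $m$; $N(0,0)=1$ and $N(m,0)=0$ for $m\ne0$. The crank of a partition is its largest part if the partition contains no ones; otherwise it is (the number of parts larger than the number of ones) minus (the number of ones). For $n\ge2$, $M(m,n)$ is the number of partitions of $n$ with crank $m$. By convention $M(0,0)=1$ and $M(m,0)=0$ for $m\neq0$; and $M(0,1)=-1$, $M(-1,1)=M(1,1)=1$, $M(m,1)=0$ otherwise. With these conventions it is known that $\sum_{n\ge0}\sum_m M(m,n)z^mq^n=\prod_{n\ge1}\frac{1-q^n}{(1-zq^n)(1-z^{-1}q^n)}$. For even $j\ge2$ the rank and crank moments are $N_j(n)=\sum_{k\in\mathbb Z}k^jN(k,n)$ and $M_j(n)=\sum_{k\in\mathbb Z}k^jM(k,n)$. *)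

theory Defs
  imports Complex_Main "HOL-Library.Multiset" "HOL-Library.Groups_Big_Fun"
begin

definition partitions_of :: "nat \<Rightarrow> nat multiset set" where
  "partitions_of n = {p. 0 \<notin># p \<and> sum_mset p = n}"

text \<open>
  The functions \<open>part_rank\<close> and \<open>part_crank\<close> are only used on nonempty partitions, since
  \<open>Max_mset {#}\<close> is unspecified; the values at \<open>n = 0\<close> (and, for the crank, at \<open>n = 1\<close>) are
  fixed by convention in \<open>rank_count\<close> and \<open>crank_count\<close> below.
\<close>

definition part_rank :: "nat multiset \<Rightarrow> int" where
  "part_rank p = int (Max_mset p) - int (size p)"

definition part_crank :: "nat multiset \<Rightarrow> int" where
  "part_crank p =
     (if 1 \<notin># p then int (Max_mset p)
      else int (size {#k \<in># p. k > count p 1#}) - int (count p 1))"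

definition rank_count :: "int \<Rightarrow> nat \<Rightarrow> int" where
  "rank_count m n =
     (if n = 0 then (if m = 0 then 1 else 0)
      else int (card {p \<in> partitions_of n. part_rank p = m}))"

text \<open>
  The convention at \<open>n = 1\<close> makes the generating function of \<open>crank_count\<close> the infinite product
  \<open>\<Prod>n\<ge>1. (1 - q^n) / ((1 - z q^n) (1 - q^n / z))\<close>; it does not count the partition of 1.
\<close>

definition crank_count :: "int \<Rightarrow> nat \<Rightarrow> int" where
  "crank_count m n =
     (if n = 0 then (if m = 0 then 1 else 0)
      else if n = 1 then (if m = 0 then -1 else if \<bar>m\<bar> = 1 then 1 else 0)
      else int (card {p \<in> partitions_of n. part_crank p = m}))"

text \<open>
  \<open>Sum_any\<close> sums a function of finite support over its whole domain, here the integers. The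
  support is finite by \<open>finite_rank_support\<close> and \<open>finite_crank_support\<close> below, so the default
  value 0 for infinite support is never taken. The odd moments are included, but not needed.
\<close>

definition rank_moment :: "nat \<Rightarrow> nat \<Rightarrow> int" where
  "rank_moment j n = Sum_any (\<lambda>k. k ^ j * rank_count k n)"

definition crank_moment :: "nat \<Rightarrow> nat \<Rightarrow> int" where
  "crank_moment j n = Sum_any (\<lambda>k. k ^ j * crank_count k n)"

lemma finite_partitions_of: "finite (partitions_of n)"
proof (induction n rule: less_induct)
  case (less n)
  have "partitions_of n \<subseteq> insert {#} (\<Union>k\<in>{1..n}. add_mset k ` partitions_of (n - k))"
  proof
    fix p assume p: "p \<in> partitions_of n"
    show "p \<in> insert {#} (\<Union>k\<in>{1..n}. add_mset k ` partitions_of (n - k))"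
    proof (cases p)
      case (add k q)
      with p have "k \<in> {1..n}" "q \<in> partitions_of (n - k)"
        by (auto simp: partitions_of_def)
      with add show ?thesis by blast
    qed simp
  qed
  moreover have "finite (\<Union>k\<in>{1..n}. add_mset k ` partitions_of (n - k))"
    using less.IH by auto
  ultimately show ?case
    by (meson finite.insertI finite_subset)
qed

lemma finite_card_support:
  "finite {k. int (card {p \<in> partitions_of n. f p = k}) \<noteq> 0}"
proof (rule finite_subset)
  show "{k. int (card {p \<in> partitions_of n. f p = k}) \<noteq> 0} \<subseteq> f ` partitions_of n"
    by (auto simp: card_eq_0_iff)
qed (simp add: finite_partitions_of)

lemma finite_rank_support: "finite {k. rank_count k n \<noteq> 0}"
  using finite_card_support[of n part_rank]
  by (cases "n = 0") (simp_all add: rank_count_def)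

lemma finite_crank_support: "finite {k. crank_count k n \<noteq> 0}"
proof (cases "n \<le> 1")
  case True
  then have "{k. crank_count k n \<noteq> 0} \<subseteq> {-1, 0, 1}"
    by (auto simp: crank_count_def split: if_splits)
  then show ?thesis
    by (rule finite_subset) simp
next
  case False
  then show ?thesis
    using finite_card_support[of n part_crank] by (simp add: crank_count_def)
qed

end

theory Submission
  imports Defs "HOL-Computational_Algebra.Polynomial_FPS" "HOL-Computational_Algebra.Formal_Laurent_Series"
begin

text \<open>
  Let \<open>R(z, q)\<close> and \<open>C(z, q)\<close> be the generating functions of rank and crank, so that the moments are
  the values at \<open>z = 1\<close> of the iterated derivatives \<open>z d/dz\<close>. The rank-crank differential equation of
  Atkin and Garvan expresses \<open>C^3\<close> through \<open>R\<close>, \<open>q dR/dq\<close> and the \<open>z\<close>-derivatives of \<open>R\<close>; its Taylor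
  coefficients at \<open>z = 1\<close> determine the rank moments from \<open>N_2\<close> and the crank moments. By the
  product formula of \<open>C\<close> the crank moments and their \<open>q\<close>-derivatives are the partition generating
  function times polynomials in the divisor sum series of \<open>\<sigma>_1\<close>, \<open>\<sigma>_3\<close>, \<open>\<sigma>_5\<close>, by Ramanujan's convolution
  identities, and the claimed relations become polynomial identities.

  The differential equation is proved with formal series only. Dyson's bijection gives a recurrence for
  the number of partitions of \<open>n\<close> with rank at most \<open>m\<close>, which says that both sides of the equation,
  divided by \<open>(1 - z)^3\<close>, satisfy \<open>f(z q) = - q z^3 f(z)\<close>. The poles at \<open>z = 1\<close> cancel in the difference
  of the two sides, and a Laurent series without pole that satisfies this equation vanishes.
\<close>

section \<open>Generating functions of partitions\<close>

text \<open>The operator \<open>6 q d/dq + (z d/dz)^2 + z d/dz\<close> multiplies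
  \<open>z^m q^n\<close> by \<open>6 n + m (m + 1)\<close>. Dyson's recurrence links
  \<open>(m, n - m + 1)\<close> with \<open>(m - 3, n)\<close>, and this weight agrees at both
  pairs; that singles out the constant 6. The partition numbers on the other side of the recurrence
  thereby get a factor quadratic in \<open>m\<close>, which the third differences caused by
  \<open>(1 - z)^3\<close> annihilate.

  In the moment of even order \<open>j\<close> of the differential equation, \<open>N_j\<close> has
  a factor proportional to \<open>(j - 1) (j - 2)\<close>. It is zero for \<open>j = 2\<close>, so
  \<open>N_2\<close> survives in every identity.

  Give \<sigma>_1, \<sigma>_3, \<sigma>_5 the weights 2, 4, 6 and write \<open>D\<close> for
  \<open>q d/dq\<close>. In weight \<open>2 k\<close> there are \<open>k\<close> series
  \<open>D^i M_(2 l)\<close> with \<open>i + l = k\<close> and \<open>l >= 1\<close>. The number of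
  monomials is also \<open>k\<close> up to \<open>k = 5\<close>, but 7 for \<open>k = 6\<close> and
  8 for \<open>k = 7\<close>. Hence the identity for \<open>N_14\<close> also contains
  \<open>N_12\<close> and \<open>D N_12\<close>.

  Moments need the value \<open>z = 1\<close>, hence coefficients polynomial in \<open>x\<close>;
  the factor \<open>1 / (1 - z)\<close> needs power series in \<open>x\<close>. The map
  \<open>lift\<close> connects the two.\<close>

lemma partitions_of_0 [simp]: "partitions_of 0 = {{#}}"
proof -
  have "p = {#}" if "0 \<notin># p" "sum_mset p = 0" for p :: "nat multiset"
    using that by (cases p) auto
  then show ?thesis by (auto simp: partitions_of_def)
qed

lemma empty_in_partitions_of [simp]: "{#} \<in> partitions_of n \<longleftrightarrow> n = 0"
  by (auto simp: partitions_of_def)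

lemma partitions_of_le:
  assumes "p \<in> partitions_of n" "k \<in># p"
  shows "1 \<le> k" "k \<le> n"
proof -
  show "1 \<le> k"
    using assms by (auto simp: partitions_of_def intro!: Suc_leI gr0I)
  show "k \<le> n"
    using assms by (auto simp: partitions_of_def dest: multi_member_split)
qed

lemma partitions_of_size_le:
  assumes "p \<in> partitions_of n"
  shows "size p \<le> n"
proof -
  have "size p = (\<Sum>k\<in>#p. 1)" by simp
  also have "\<dots> \<le> (\<Sum>k\<in>#p. k)"
    using partitions_of_le(1)[OF assms] by (intro sum_mset_mono)
  finally show ?thesis using assms by (simp add: partitions_of_def)
qed

text \<open>The bijection behind the product formulas: every factor of a product over parts is
  handled by adjoining or removing copies of one part. The bound on the multiplicity makes the
  truncated multiset difference a true inverse.\<close>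

lemma replicate_mset_add_partitions_of:
  assumes "j \<ge> 1"
  shows "bij_betw (\<lambda>p. replicate_mset i j + p) (partitions_of n)
           {p \<in> partitions_of (i * j + n). i \<le> count p j}"
proof (rule bij_betwI[where g = "\<lambda>p. p - replicate_mset i j"])
  show "(\<lambda>p. p - replicate_mset i j)
          \<in> {p \<in> partitions_of (i * j + n). i \<le> count p j} \<rightarrow> partitions_of n"
  proof
    fix p assume p: "p \<in> {p \<in> partitions_of (i * j + n). i \<le> count p j}"
    then have "replicate_mset i j \<subseteq># p"
      by (simp add: count_le_replicate_mset_subset_eq)
    then obtain r where "p = replicate_mset i j + r"
      by (auto simp: mset_subset_eq_exists_conv)
    with p show "p - replicate_mset i j \<in> partitions_of n"
      by (auto simp: partitions_of_def)
  qed
  show "(\<lambda>p. replicate_mset i j + p)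
          \<in> partitions_of n \<rightarrow> {p \<in> partitions_of (i * j + n). i \<le> count p j}"
    using assms by (auto simp: partitions_of_def)
  show "replicate_mset i j + (p - replicate_mset i j) = p"
    if "p \<in> {p \<in> partitions_of (i * j + n). i \<le> count p j}" for p
    using that by (simp add: count_le_replicate_mset_subset_eq)
qed simp

text \<open>The formal counterpart of the infinite product of \<open>1 / (1 - w j X^j)\<close> over
  \<open>j >= 1\<close>; as a sum over partitions it requires no notion of convergence.\<close>

definition part_gf :: "(nat \<Rightarrow> 'a::comm_ring_1) \<Rightarrow> 'a fps" where
  "part_gf w = Abs_fps (\<lambda>n. \<Sum>p\<in>partitions_of n. \<Prod>k\<in>#p. w k)"

lemma part_gf_nth: "part_gf w $ n = (\<Sum>p\<in>partitions_of n. \<Prod>k\<in>#p. w k)"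
  by (simp add: part_gf_def)

lemma part_gf_nth_0 [simp]: "part_gf w $ 0 = 1"
  by (simp add: part_gf_nth)

lemma sum_partitions_of_count_ge:
  assumes "j \<ge> 1" "i * j \<le> n"
  shows "(\<Sum>p | p \<in> partitions_of n \<and> i \<le> count p j. \<Prod>k\<in>#p. w k) =
           w j ^ i * part_gf w $ (n - i * j)"
proof -
  have "bij_betw (\<lambda>p. replicate_mset i j + p) (partitions_of (n - i * j))
          {p \<in> partitions_of n. i \<le> count p j}"
    using replicate_mset_add_partitions_of[OF assms(1), of i "n - i * j"] assms(2) by simp
  from sum.reindex_bij_betw[OF this, of "\<lambda>p. \<Prod>k\<in>#p. w k"]
  show ?thesis by (simp add: part_gf_nth sum_distrib_left)
qed

lemma count_ge_partitions_of_empty: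
  assumes "i * j > n"
  shows "{p \<in> partitions_of n. i \<le> count p j} = {}"
proof (rule equals0I)
  fix p assume p: "p \<in> {p \<in> partitions_of n. i \<le> count p j}"
  then have "replicate_mset i j \<subseteq># p"
    by (simp add: count_le_replicate_mset_subset_eq)
  then obtain r where "p = replicate_mset i j + r"
    by (auto simp: mset_subset_eq_exists_conv)
  with p assms show False by (auto simp: partitions_of_def)
qed

text \<open>The partitions that contain \<open>j\<close> arise by adjoining one copy of
  \<open>j\<close>, so they contribute \<open>w j X^j\<close> times the whole series. This cancels a
  single factor of the product and takes the place of limits of finite products.\<close>

lemma part_gf_remove:
  assumes "j \<ge> 1"
  shows "(1 - fps_const (w j) * fps_X ^ j) * part_gf w = part_gf (w(j := 0))"
proof (rule fps_ext)
  fix n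
  have *: "(\<Prod>k\<in>#p. (w(j := 0)) k) = (if 1 \<le> count p j then 0 else \<Prod>k\<in>#p. w k)" for p
  proof (cases "j \<in># p")
    case True
    then obtain r where "p = add_mset j r" by (auto dest: multi_member_split)
    then show ?thesis by simp
  next
    case False
    then have "image_mset (w(j := 0)) p = image_mset w p"
      by (intro image_mset_cong) auto
    with False show ?thesis by (simp only:) (simp add: not_in_iff)
  qed
  have "part_gf (w(j := 0)) $ n =
      (\<Sum>p\<in>partitions_of n. (\<Prod>k\<in>#p. w k) - (if 1 \<le> count p j then \<Prod>k\<in>#p. w k else 0))"
    unfolding part_gf_nth by (intro sum.cong refl) (subst *, auto)
  also have "\<dots> = part_gf w $ n - (\<Sum>p | p \<in> partitions_of n \<and> 1 \<le> count p j. \<Prod>k\<in>#p. w k)"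
    by (simp add: sum_subtractf part_gf_nth sum.inter_filter finite_partitions_of)
  also have "(\<Sum>p | p \<in> partitions_of n \<and> 1 \<le> count p j. \<Prod>k\<in>#p. w k) =
      (if j \<le> n then w j * part_gf w $ (n - j) else 0)"
    using sum_partitions_of_count_ge[OF assms, of 1 n w] count_ge_partitions_of_empty[of n 1 j]
    by (cases "j \<le> n") (simp_all del: Collect_empty_eq)
  finally have "part_gf (w(j := 0)) $ n =
      part_gf w $ n - (if j \<le> n then w j * part_gf w $ (n - j) else 0)" .
  from this[symmetric] show "((1 - fps_const (w j) * fps_X ^ j) * part_gf w) $ n = part_gf (w(j := 0)) $ n"
    by (cases "n < j") (simp_all add: left_diff_distrib mult.assoc fps_X_power_mult_nth)
qed

text \<open>A multiplicity is written as the number of \<open>i >= 1\<close> not exceeding it,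
  because the condition \<open>i \<le> count p j\<close> is what
  \<open>sum_partitions_of_count_ge\<close> evaluates.\<close>

lemma sum_mset_eq_sum_count:
  assumes "p \<in> partitions_of n"
  shows "(\<Sum>k\<in>#p. c k) = (\<Sum>j\<in>{1..n}. \<Sum>i\<in>{1..n}. if i \<le> count p j then c j else (0::'a::comm_ring_1))"
proof -
  have "set_mset p \<subseteq> {1..n}"
    using partitions_of_le[OF assms] by auto
  then have "(\<Sum>k\<in>#p. c k) = (\<Sum>j\<in>{1..n}. of_nat (count p j) * c j)"
  proof (induction p)
    case (add x p)
    have "(\<Sum>j\<in>{1..n}. of_nat (count (add_mset x p) j) * c j) =
        (\<Sum>j\<in>{1..n}. (if j = x then c j else 0) + of_nat (count p j) * c j)"
      by (intro sum.cong) (auto simp: algebra_simps)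
    also have "\<dots> = c x + (\<Sum>j\<in>{1..n}. of_nat (count p j) * c j)"
      using add.prems by (simp add: sum.distrib)
    finally show ?case using add by simp
  qed simp
  also have "\<dots> = (\<Sum>j\<in>{1..n}. \<Sum>i\<in>{1..n}. if i \<le> count p j then c j else 0)"
  proof (intro sum.cong refl)
    fix j assume j: "j \<in> {1..n}"
    have "count p j \<le> n"
      using partitions_of_size_le[OF assms] count_le_size[of p j] by linarith
    then have "{i \<in> {1..n}. i \<le> count p j} = {1..count p j}" by auto
    then show "of_nat (count p j) * c j = (\<Sum>i\<in>{1..n}. if i \<le> count p j then c j else 0)"
      by (simp add: sum.inter_filter[symmetric])
  qed
  finally show ?thesis .
qed

text \<open>The logarithmic derivative of \<open>\<Prod>j. 1 / (1 - w j X^j)\<close>, for the derivation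
  that multiplies the contribution of a part \<open>j\<close> by \<open>c j\<close>.\<close>

lemma part_gf_log_deriv:
  "(\<Sum>p\<in>partitions_of n. (\<Sum>k\<in>#p. c k) * (\<Prod>k\<in>#p. w k)) =
     (\<Sum>m\<in>{1..n}. (\<Sum>j | j dvd m. c j * w j ^ (m div j)) * part_gf w $ (n - m))"
proof -
  have "(\<Sum>p\<in>partitions_of n. (\<Sum>k\<in>#p. c k) * (\<Prod>k\<in>#p. w k)) =
      (\<Sum>p\<in>partitions_of n. \<Sum>j\<in>{1..n}. \<Sum>i\<in>{1..n}.
         c j * (if i \<le> count p j then \<Prod>k\<in>#p. w k else 0))"
    by (intro sum.cong refl) (auto simp: sum_mset_eq_sum_count sum_distrib_right intro!: sum.cong)
  also have "\<dots> = (\<Sum>j\<in>{1..n}. \<Sum>i\<in>{1..n}. c j *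
      (\<Sum>p\<in>partitions_of n. if i \<le> count p j then \<Prod>k\<in>#p. w k else 0))"
    by (subst sum.swap, rule sum.cong[OF refl], subst sum.swap) (simp add: sum_distrib_left)
  also have "\<dots> = (\<Sum>j\<in>{1..n}. \<Sum>i\<in>{1..n}. if i * j \<le> n
      then c j * w j ^ i * part_gf w $ (n - i * j) else 0)"
  proof (intro sum.cong refl)
    fix j i assume "j \<in> {1..n}" "i \<in> {1..n}"
    then show "c j * (\<Sum>p\<in>partitions_of n. if i \<le> count p j then \<Prod>k\<in>#p. w k else 0) =
        (if i * j \<le> n then c j * w j ^ i * part_gf w $ (n - i * j) else 0)"
      using sum_partitions_of_count_ge[of j i n w] count_ge_partitions_of_empty[of n i j]
      by (cases "i * j \<le> n")
         (simp_all add: sum.inter_filter[symmetric] finite_partitions_of not_le del: Collect_empty_eq)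
  qed
  also have "\<dots> = (\<Sum>x\<in>{x \<in> {1..n} \<times> {1..n}. snd x * fst x \<le> n}.
      c (fst x) * w (fst x) ^ snd x * part_gf w $ (n - snd x * fst x))"
    by (subst sum.inter_filter) (simp_all add: sum.cartesian_product case_prod_beta)
  \<comment> \<open>Collecting the pairs \<open>(j, i)\<close> by \<open>m = i * j\<close> makes
    \<open>j\<close> a divisor of \<open>m\<close> and \<open>i\<close> the quotient
    \<open>m div j\<close>.\<close>
  also have "\<dots> = (\<Sum>(m, j)\<in>Sigma {1..n} (\<lambda>m. {j. j dvd m}).
      c j * w j ^ (m div j) * part_gf w $ (n - m))"
  proof (rule sum.reindex_bij_witness[where i = "\<lambda>(m, j). (j, m div j)" and j = "\<lambda>x. (snd x * fst x, fst x)"])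
    fix x assume "x \<in> Sigma {1..n} (\<lambda>m. {j. j dvd m})"
    then obtain m j k where x: "x = (m, j)" "m = j * k" "1 \<le> m" "m \<le> n" by (auto elim!: dvdE)
    then have "1 \<le> j" "1 \<le> k" by (auto simp: Suc_le_eq)
    moreover from this have "j \<le> j * k" "k \<le> j * k" by simp_all
    with x have "j \<le> n" "k \<le> n" by linarith+
    ultimately show "(case x of (m, j) \<Rightarrow> (j, m div j)) \<in> {x \<in> {1..n} \<times> {1..n}. snd x * fst x \<le> n}"
      using x by (simp add: mult.commute)
    show "(case case x of (m, j) \<Rightarrow> (j, m div j) of x \<Rightarrow> (snd x * fst x, fst x)) = x"
      using x \<open>1 \<le> j\<close> by (simp add: mult.commute)
  next
    fix x assume "x \<in> {x \<in> {1..n} \<times> {1..n}. snd x * fst x \<le> n}"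
    then obtain j i where x: "x = (j, i)" "1 \<le> j" "1 \<le> i" "i * j \<le> n" by auto
    then show "(snd x * fst x, fst x) \<in> Sigma {1..n} (\<lambda>m. {j. j dvd m})"
      by (simp add: Suc_le_eq)
    show "(case (snd x * fst x, fst x) of (m, j) \<Rightarrow> (j, m div j)) = x"
      "(case (snd x * fst x, fst x) of (m, j) \<Rightarrow> c j * w j ^ (m div j) * part_gf w $ (n - m)) =
         c (fst x) * w (fst x) ^ snd x * part_gf w $ (n - snd x * fst x)"
      using x by simp_all
  qed
  also have "\<dots> = (\<Sum>m\<in>{1..n}. \<Sum>j | j dvd m. c j * w j ^ (m div j) * part_gf w $ (n - m))"
    by (subst sum.Sigma) (simp_all add: finite_divisors_nat)
  finally show ?thesis by (simp only: sum_distrib_right)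
qed

section \<open>The distribution of the rank\<close>

definition add_column :: "nat \<Rightarrow> nat multiset \<Rightarrow> nat multiset" where
  "add_column l p = image_mset Suc p + replicate_mset (l - size p) 1"

definition remove_column :: "nat multiset \<Rightarrow> nat multiset" where
  "remove_column p = {#k \<in># image_mset (\<lambda>k. k - 1) p. k \<noteq> 0#}"

lemma size_add_column [simp]: "size p \<le> l \<Longrightarrow> size (add_column l p) = l"
  by (simp add: add_column_def)

lemma sum_mset_image_Suc: "sum_mset (image_mset Suc p) = sum_mset p + size p"
  by (induction p) auto

lemma sum_mset_add_column: "size p \<le> l \<Longrightarrow> sum_mset (add_column l p) = sum_mset p + l"
  by (simp add: add_column_def sum_mset_image_Suc)

lemma zero_not_in_add_column [simp]: "0 \<notin># add_column l p"
  by (auto simp: add_column_def in_replicate_mset)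

lemma add_column_partitions_of:
  "p \<in> partitions_of n \<Longrightarrow> size p \<le> l \<Longrightarrow> add_column l p \<in> partitions_of (n + l)"
  using sum_mset_add_column[of p l] unfolding partitions_of_def mem_Collect_eq by (metis zero_not_in_add_column)

lemma zero_not_in_remove_column [simp]: "0 \<notin># remove_column p"
  by (auto simp: remove_column_def)

lemma size_remove_column_le: "size (remove_column p) \<le> size p"
  using size_filter_mset_lesseq[of "\<lambda>k. k \<noteq> 0" "image_mset (\<lambda>k. k - 1) p"]
  by (simp add: remove_column_def)

lemma remove_column_add_column:
  assumes "0 \<notin># p"
  shows "remove_column (add_column l p) = p"
proof -
  have "remove_column (add_column l p) =
      filter_mset (\<lambda>k. k \<noteq> 0) (image_mset (\<lambda>k. k - 1) (image_mset Suc p)) +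
      filter_mset (\<lambda>k. k \<noteq> 0) (image_mset (\<lambda>k. k - 1) (replicate_mset (l - size p) 1))"
    by (simp only: remove_column_def add_column_def image_mset_union filter_union_mset)
  moreover have "image_mset (\<lambda>k. k - 1) (image_mset Suc p) = p"
    by (simp add: multiset.map_comp o_def)
  moreover have "filter_mset (\<lambda>k. k \<noteq> 0) p = p"
    using assms by (induction p) auto
  moreover have "filter_mset (\<lambda>k. k \<noteq> 0) (image_mset (\<lambda>k. k - 1) (replicate_mset j (1::nat))) = {#}" for j
    by (rule multiset_eqI)
       (simp only: image_replicate_mset count_filter_mset count_replicate_mset count_empty, simp)
  ultimately show ?thesis by (simp only: add_0_right)
qed

lemma add_column_remove_column:
  assumes "0 \<notin># p"
  shows "add_column (size p) (remove_column p) = p"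
  using assms
proof (induction p)
  case empty
  then show ?case by (simp add: add_column_def remove_column_def)
next
  case (add k p)
  then have IH: "add_column (size p) (remove_column p) = p" by simp
  from add.prems have "k > 0" by auto
  show ?case
  proof (cases "k = 1")
    case True
    have "Suc (size p) - size (remove_column p) = Suc (size p - size (remove_column p))"
      using size_remove_column_le[of p] by simp
    moreover have "remove_column (add_mset k p) = remove_column p"
      using True by (simp add: remove_column_def)
    ultimately show ?thesis using IH True by (simp add: add_column_def)
  next
    case False
    then have "remove_column (add_mset k p) = add_mset (k - 1) (remove_column p)"
      using \<open>k > 0\<close> by (simp add: remove_column_def)
    then show ?thesis using IH \<open>k > 0\<close> by (simp add: add_column_def)
  qed
qed

lemma sum_mset_remove_column: "0 \<notin># p \<Longrightarrow> sum_mset (remove_column p) + size p = sum_mset p"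
  using add_column_remove_column[of p] sum_mset_add_column[of "remove_column p" "size p"]
    size_remove_column_le[of p] by simp

lemma remove_column_partitions_of:
  "p \<in> partitions_of n \<Longrightarrow> remove_column p \<in> partitions_of (n - size p)"
  by (auto simp: partitions_of_def dest: sum_mset_remove_column)

lemma remove_column_le: "\<forall>k\<in>#p. k \<le> Suc a \<Longrightarrow> k \<in># remove_column p \<Longrightarrow> k \<le> a"
  by (auto simp: remove_column_def)

lemma add_column_le: "\<forall>k\<in>#p. k \<le> a \<Longrightarrow> k \<in># add_column l p \<Longrightarrow> k \<le> Suc a"
  by (auto simp: add_column_def in_replicate_mset split: if_splits)

section \<open>Symmetry between the largest part and the number of parts\<close>

definition box_partitions :: "nat \<Rightarrow> nat \<Rightarrow> nat \<Rightarrow> nat multiset set" where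
  "box_partitions a b n = {p \<in> partitions_of n. (\<forall>k\<in>#p. k \<le> a) \<and> size p \<le> b}"

lemma finite_box_partitions [simp]: "finite (box_partitions a b n)"
  by (simp add: box_partitions_def finite_partitions_of)

text \<open>Split by whether the largest admissible part occurs; if so, one copy of it is removed.
  Together with \<open>card_box_partitions_Suc2\<close> this gives the two forms of Pascal's rule
  for Gaussian binomial coefficients.\<close>

lemma card_box_partitions_Suc1:
  "card (box_partitions (Suc a) (Suc b) n) = card (box_partitions a (Suc b) n) +
     (if Suc a \<le> n then card (box_partitions (Suc a) b (n - Suc a)) else 0)"
proof -
  define S where "S = {p \<in> box_partitions (Suc a) (Suc b) n. Suc a \<in># p}"
  have "box_partitions (Suc a) (Suc b) n = box_partitions a (Suc b) n \<union> S"
    by (auto simp: box_partitions_def S_def le_Suc_eq)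
  moreover have "box_partitions a (Suc b) n \<inter> S = {}"
    by (auto simp: box_partitions_def S_def)
  moreover have "card S = (if Suc a \<le> n then card (box_partitions (Suc a) b (n - Suc a)) else 0)"
  proof (cases "Suc a \<le> n")
    case True
    have "bij_betw (add_mset (Suc a)) (box_partitions (Suc a) b (n - Suc a)) S"
      by (rule bij_betwI[where g = "\<lambda>p. p - {#Suc a#}"])
         (use True in \<open>auto simp: S_def box_partitions_def partitions_of_def dest!: multi_member_split\<close>)
    with True show ?thesis by (simp add: bij_betw_same_card)
  next
    case False
    then have "S = {}"
      using partitions_of_le(2)[of _ n "Suc a"] by (auto simp: S_def box_partitions_def)
    with False show ?thesis by simp
  qed
  moreover have "finite S" by (simp add: S_def)
  ultimately show ?thesis by (simp add: card_Un_disjoint)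
qed

text \<open>Split by whether the maximal number of parts is attained; if so, the first column has
  full length \<open>Suc b\<close> and is removed.\<close>

lemma card_box_partitions_Suc2:
  "card (box_partitions (Suc a) (Suc b) n) = card (box_partitions (Suc a) b n) +
     (if Suc b \<le> n then card (box_partitions a (Suc b) (n - Suc b)) else 0)"
proof -
  define S where "S = {p \<in> box_partitions (Suc a) (Suc b) n. size p = Suc b}"
  have "box_partitions (Suc a) (Suc b) n = box_partitions (Suc a) b n \<union> S"
    by (auto simp: box_partitions_def S_def le_Suc_eq)
  moreover have "box_partitions (Suc a) b n \<inter> S = {}"
    by (auto simp: box_partitions_def S_def)
  moreover have "card S = (if Suc b \<le> n then card (box_partitions a (Suc b) (n - Suc b)) else 0)"
  proof (cases "Suc b \<le> n")
    case True
    have "bij_betw (add_column (Suc b)) (box_partitions a (Suc b) (n - Suc b)) S"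
    proof (rule bij_betwI[where g = remove_column])
      show "add_column (Suc b) \<in> box_partitions a (Suc b) (n - Suc b) \<rightarrow> S"
        using True add_column_partitions_of[of _ "n - Suc b" "Suc b"]
        by (auto simp: box_partitions_def S_def dest: add_column_le)
      show "remove_column \<in> S \<rightarrow> box_partitions a (Suc b) (n - Suc b)"
        using size_remove_column_le
        by (auto simp: box_partitions_def S_def dest: remove_column_le
              intro: remove_column_partitions_of[of _ n, THEN back_subst[of "\<lambda>n. _ \<in> partitions_of n"]])
           (metis size_remove_column_le)
      show "remove_column (add_column (Suc b) p) = p" if "p \<in> box_partitions a (Suc b) (n - Suc b)" for p
        using that by (intro remove_column_add_column) (auto simp: box_partitions_def partitions_of_def)
      show "add_column (Suc b) (remove_column p) = p" if "p \<in> S" for p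
        using that add_column_remove_column[of p]
        by (auto simp: S_def box_partitions_def partitions_of_def)
    qed
    with True show ?thesis by (simp add: bij_betw_same_card)
  next
    case False
    then have "S = {}"
      by (auto simp: S_def box_partitions_def dest: partitions_of_size_le)
    with False show ?thesis by simp
  qed
  moreover have "finite S" by (simp add: S_def)
  ultimately show ?thesis by (simp add: card_Un_disjoint)
qed

lemma box_partitions_0: "box_partitions 0 b n = {p. p = {#} \<and> n = 0}"
  "box_partitions a 0 n = {p. p = {#} \<and> n = 0}"
proof -
  have "p = {#}" if "p \<in> partitions_of n" "\<forall>k\<in>#p. k = 0" for p
    using that by (cases p) (auto simp: partitions_of_def)
  then have "p \<in> box_partitions 0 b n \<longleftrightarrow> p = {#} \<and> n = 0" for p
    by (cases "p = {#}") (auto simp: box_partitions_def)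
  then show "box_partitions 0 b n = {p. p = {#} \<and> n = 0}" by blast
  show "box_partitions a 0 n = {p. p = {#} \<and> n = 0}"
    by (auto simp: box_partitions_def)
qed

text \<open>The two recurrences are exchanged by conjugation, which therefore need not be constructed.\<close>

lemma card_box_partitions_commute: "card (box_partitions a b n) = card (box_partitions b a n)"
proof (induction "a + b" arbitrary: a b n rule: less_induct)
  case less
  show ?case
  proof (cases "a = 0 \<or> b = 0")
    case True
    then show ?thesis by (auto simp: box_partitions_0)
  next
    case False
    then obtain a' b' where ab: "a = Suc a'" "b = Suc b'" by (meson not0_implies_Suc)
    show ?thesis
      unfolding ab card_box_partitions_Suc1[of a' b'] card_box_partitions_Suc2[of b' a']
      using less[of a' b n] less[of a b' "n - a"] ab by simp
  qed
qed

lemma Max_mset_le_iff: "p \<noteq> {#} \<Longrightarrow> Max_mset p \<le> a \<longleftrightarrow> (\<forall>k\<in>#p. k \<le> a)"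
  by simp

text \<open>Inclusion and exclusion over four boxes isolates the partitions with prescribed largest
  part and number of parts, so the symmetry of the boxes passes to them.\<close>

lemma card_Max_size_commute:
  assumes "n \<ge> 1"
  shows "card {p \<in> partitions_of n. Max_mset p = a \<and> size p = b} =
         card {p \<in> partitions_of n. Max_mset p = b \<and> size p = a}"
proof -
  define E where "E a b = {p \<in> partitions_of n. Max_mset p = a \<and> size p = b}" for a b
  have ne: "p \<noteq> {#}" if "p \<in> partitions_of n" for p
    using that assms by auto
  have box: "box_partitions a b n = {p \<in> partitions_of n. Max_mset p \<le> a \<and> size p \<le> b}" for a b
    unfolding box_partitions_def using ne by (intro Collect_cong) (auto simp: Max_mset_le_iff)
  have E0: "E 0 b = {}" "E a 0 = {}" for a b
  proof -
    have "Max_mset p \<noteq> 0" if "p \<in> partitions_of n" for p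
      using Max_in[of "set_mset p"] ne[OF that] partitions_of_le(1)[OF that] by fastforce
    then show "E 0 b = {}" by (auto simp: E_def)
    show "E a 0 = {}" using ne by (auto simp: E_def)
  qed
  have E: "int (card (E (Suc a) (Suc b))) = int (card (box_partitions (Suc a) (Suc b) n))
      - int (card (box_partitions a (Suc b) n)) - int (card (box_partitions (Suc a) b n))
      + int (card (box_partitions a b n))" for a b
  proof -
    let ?U = "box_partitions a (Suc b) n \<union> box_partitions (Suc a) b n"
    have "box_partitions (Suc a) (Suc b) n = E (Suc a) (Suc b) \<union> ?U"
      by (auto simp: box E_def)
    moreover have "E (Suc a) (Suc b) \<inter> ?U = {}"
      by (auto simp: box E_def)
    moreover have "finite (E (Suc a) (Suc b))"
      by (simp add: E_def finite_partitions_of)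
    ultimately have "card (box_partitions (Suc a) (Suc b) n) = card (E (Suc a) (Suc b)) + card ?U"
      by (simp add: card_Un_disjoint)
    moreover have "box_partitions a (Suc b) n \<inter> box_partitions (Suc a) b n = box_partitions a b n"
      by (auto simp: box)
    then have "card (box_partitions a (Suc b) n) + card (box_partitions (Suc a) b n) =
        card ?U + card (box_partitions a b n)"
      using card_Un_Int[of "box_partitions a (Suc b) n" "box_partitions (Suc a) b n"] by simp
    ultimately show ?thesis by simp
  qed
  have "card (E a b) = card (E b a)"
  proof (cases "a = 0 \<or> b = 0")
    case True
    then show ?thesis by (auto simp: E0)
  next
    case False
    then obtain a' b' where ab: "a = Suc a'" "b = Suc b'" by (meson not0_implies_Suc)
    have "int (card (E a b)) = int (card (E b a))"
      unfolding ab E by (simp add: card_box_partitions_commute)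
    then show ?thesis by simp
  qed
  then show ?thesis by (simp add: E_def)
qed

text \<open>The symmetric joint distribution allows any weight to exchange the two statistics. For
  the rank this yields the symmetry \<open>m -> - m\<close>; for the crank it replaces the largest
  part, which no product sees, by the number of parts.\<close>

lemma sum_Max_size_commute:
  fixes f :: "nat \<Rightarrow> nat \<Rightarrow> 'a::comm_semiring_1"
  assumes "n \<ge> 1"
  shows "(\<Sum>p\<in>partitions_of n. f (Max_mset p) (size p)) = (\<Sum>p\<in>partitions_of n. f (size p) (Max_mset p))"
proof -
  let ?P = "partitions_of n" and ?R = "{..n} \<times> {..n}"
  have M: "Max_mset p \<le> n" if "p \<in> ?P" for p
    using that assms partitions_of_le(2)[OF that] by (subst Max_mset_le_iff) auto
  then have R: "(\<lambda>p. (Max_mset p, size p)) ` ?P \<subseteq> ?R" "(\<lambda>p. (size p, Max_mset p)) ` ?P \<subseteq> ?R"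
    by (auto dest: partitions_of_size_le)
  have "(\<Sum>p\<in>?P. f (Max_mset p) (size p)) =
      (\<Sum>y\<in>?R. of_nat (card {p \<in> ?P. (Max_mset p, size p) = y}) * case_prod f y)"
    using sum_fun_comp[of ?P ?R "\<lambda>p. (Max_mset p, size p)" "case_prod f"] R
    by (simp add: finite_partitions_of)
  also have "\<dots> = (\<Sum>y\<in>?R. of_nat (card {p \<in> ?P. (size p, Max_mset p) = y}) * case_prod f y)"
    using card_Max_size_commute[OF assms] by (intro sum.cong) (auto simp: conj_commute)
  also have "\<dots> = (\<Sum>p\<in>?P. f (size p) (Max_mset p))"
    using sum_fun_comp[of ?P ?R "\<lambda>p. (size p, Max_mset p)" "case_prod f"] R
    by (simp add: finite_partitions_of)
  finally show ?thesis .
qed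

section \<open>Dyson's symmetry and the recurrence for the rank\<close>

lemma Max_add_mset: "\<forall>k\<in>#p. k \<le> s \<Longrightarrow> Max_mset (add_mset s p) = (s::nat)"
  by (auto intro!: Max_eqI)

text \<open>Dyson's map: the first column is removed and its length, increased by \<open>r\<close>, becomes
  the new largest part.\<close>

lemma card_dyson:
  assumes "r \<ge> 1"
  shows "card {p \<in> partitions_of n. \<forall>k\<in>#p. k \<le> Suc (size p + r)} =
         card {p \<in> partitions_of (n + r). part_rank p \<ge> int r - 1}"
proof (rule bij_betw_same_card, rule bij_betwI)
  let ?A = "{p \<in> partitions_of n. \<forall>k\<in>#p. k \<le> Suc (size p + r)}"
  let ?B = "{p \<in> partitions_of (n + r). part_rank p \<ge> int r - 1}"
  let ?f = "\<lambda>p. add_mset (size p + r) (remove_column p)"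
  let ?g = "\<lambda>p. add_column (Max_mset p - r) (p - {#Max_mset p#})"
  \<comment> \<open>The new part is the largest: a part of \<open>p\<close> is at most
    \<open>Suc (size p + r)\<close> and loses 1 with the column.\<close>
  have MaxA: "Max_mset (?f p) = size p + r" if "p \<in> ?A" for p
    using that by (intro Max_add_mset ballI) (auto dest: remove_column_le)
  have B: "\<exists>s q. p = add_mset s q \<and> Max_mset p = s \<and> (\<forall>k\<in>#q. k \<le> s) \<and> size q + r \<le> s" if "p \<in> ?B" for p
  proof -
    from that assms have "p \<noteq> {#}" by auto
    then have "Max_mset p \<in># p" by simp
    then obtain q where q: "p = add_mset (Max_mset p) q" by (metis insert_DiffM)
    moreover have "\<forall>k\<in>#q. k \<le> Max_mset p"
      using q by (metis Max_ge finite_set_mset insertCI set_mset_add_mset_insert)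
    moreover have "size p = Suc (size q)" by (subst q) simp
    ultimately show ?thesis using that by (auto simp: part_rank_def)
  qed
  show "?f \<in> ?A \<rightarrow> ?B"
  proof
    fix p assume p: "p \<in> ?A"
    then have "remove_column p \<in> partitions_of (n - size p)" "size p \<le> n"
      by (auto intro: remove_column_partitions_of partitions_of_size_le)
    then have "?f p \<in> partitions_of (n + r)"
      using assms by (auto simp: partitions_of_def)
    \<comment> \<open>At most \<open>size p\<close> parts survive beside the new part
      \<open>size p + r\<close>, so the rank is at least \<open>r - 1\<close>.\<close>
    moreover have "part_rank (?f p) \<ge> int r - 1"
      unfolding part_rank_def MaxA[OF p] using size_remove_column_le[of p] by simp
    ultimately show "?f p \<in> ?B" by simp
  qed
  show "?g \<in> ?B \<rightarrow> ?A"
  proof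
    fix p assume p: "p \<in> ?B"
    from B[OF p] obtain s q where q: "p = add_mset s q" "Max_mset p = s" "\<forall>k\<in>#q. k \<le> s" "size q + r \<le> s"
      by blast
    have "q \<in> partitions_of (n + r - s)" "s \<le> n + r"
      using p q(1) by (auto simp: partitions_of_def)
    then have "add_column (s - r) q \<in> partitions_of n"
      using add_column_partitions_of[of q "n + r - s" "s - r"] q(4) by simp
    moreover have "?g p = add_column (s - r) q"
      using q(1,2) by simp
    moreover have "\<forall>k\<in>#add_column (s - r) q. k \<le> Suc s"
      using q(3) by (auto dest: add_column_le)
    ultimately show "?g p \<in> ?A" using q(4) by simp
  qed
  show "?g (?f p) = p" if "p \<in> ?A" for p
    using that MaxA[OF that] by (simp add: add_column_remove_column partitions_of_def)
  show "?f (?g p) = p" if "p \<in> ?B" for p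
  proof -
    from B[OF that] obtain s q where q: "p = add_mset s q" "Max_mset p = s" "\<forall>k\<in>#q. k \<le> s" "size q + r \<le> s"
      by blast
    have "0 \<notin># q" using that q(1) by (auto simp: partitions_of_def)
    moreover have "?g p = add_column (s - r) q" using q(1,2) by simp
    ultimately show ?thesis using q by (simp add: remove_column_add_column)
  qed
qed

text \<open>The coefficient of \<open>z^m q^n\<close> in \<open>R(z, q) / (1 - z)\<close>. Integer
  arguments let the recurrence run over all \<open>m\<close> and \<open>n\<close>; the value at
  \<open>n = 0\<close> reflects \<open>N(0,0) = 1\<close>.\<close>

definition rank_le_count :: "int \<Rightarrow> int \<Rightarrow> int" where
  "rank_le_count m n =
     (if n < 0 then 0 else if n = 0 then of_bool (0 \<le> m)
      else int (card {p \<in> partitions_of (nat n). part_rank p \<le> m}))"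

definition partition_count :: "int \<Rightarrow> int" where
  "partition_count n = (if n < 0 then 0 else int (card (partitions_of (nat n))))"

lemma part_rank_bounds:
  assumes "p \<in> partitions_of n" "n \<ge> 1"
  shows "part_rank p < int n" "part_rank p > - int n"
proof -
  have ne: "p \<noteq> {#}" using assms by auto
  then have "Max_mset p \<in># p" by simp
  then have "1 \<le> Max_mset p" "Max_mset p \<le> n"
    using partitions_of_le[OF assms(1)] by auto
  moreover have "size p \<ge> 1" "size p \<le> n"
    using ne partitions_of_size_le[OF assms(1)] by (auto simp: Suc_le_eq nonempty_has_size)
  ultimately show "part_rank p < int n" "part_rank p > - int n"
    by (auto simp: part_rank_def)
qed

lemma rank_le_count_eq_0: "m \<le> - n \<Longrightarrow> n \<noteq> 0 \<Longrightarrow> rank_le_count m n = 0"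
proof (cases "n < 0")
  case False
  assume "m \<le> - n" "n \<noteq> 0"
  then have "{p \<in> partitions_of (nat n). part_rank p \<le> m} = {}"
    using False part_rank_bounds(2)[of _ "nat n"] by force
  with False \<open>n \<noteq> 0\<close> show ?thesis by (simp only: rank_le_count_def) simp
qed (simp add: rank_le_count_def)

lemma rank_le_count_eq_all: "m \<ge> n - 1 \<Longrightarrow> n \<noteq> 0 \<Longrightarrow> rank_le_count m n = partition_count n"
proof (cases "n < 0")
  case False
  assume "m \<ge> n - 1" "n \<noteq> 0"
  then have "{p \<in> partitions_of (nat n). part_rank p \<le> m} = partitions_of (nat n)"
    using False part_rank_bounds(1)[of _ "nat n"] by force
  with False \<open>n \<noteq> 0\<close> show ?thesis by (simp add: rank_le_count_def partition_count_def)
qed (simp add: rank_le_count_def partition_count_def)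

lemma rank_count_eq_diff:
  "rank_count m n = rank_le_count m (int n) - rank_le_count (m - 1) (int n)"
proof (cases "n = 0")
  case False
  have "{p \<in> partitions_of n. part_rank p \<le> m} =
      {p \<in> partitions_of n. part_rank p = m} \<union> {p \<in> partitions_of n. part_rank p \<le> m - 1}"
    by auto
  then have "card {p \<in> partitions_of n. part_rank p \<le> m} =
      card {p \<in> partitions_of n. part_rank p = m} + card {p \<in> partitions_of n. part_rank p \<le> m - 1}"
    by (simp add: card_Un_disjoint finite_partitions_of disjoint_iff)
  with False show ?thesis by (simp add: rank_count_def rank_le_count_def)
qed (auto simp: rank_count_def rank_le_count_def)

text \<open>Exchanging largest part and number of parts negates the rank, so rank at most
  \<open>- m - 1\<close> is as frequent as rank greater than \<open>m\<close>.\<close>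

lemma rank_le_count_symmetry: "rank_le_count m n + rank_le_count (- m - 1) n = partition_count n"
proof (cases "n > 0")
  case True
  define N where "N = nat n"
  have "int (card {p \<in> partitions_of N. part_rank p \<le> - m - 1}) =
      (\<Sum>p\<in>partitions_of N. if int (Max_mset p) - int (size p) \<le> - m - 1 then 1 else 0)"
    by (simp add: sum.inter_filter[symmetric] finite_partitions_of part_rank_def)
  also have "\<dots> = (\<Sum>p\<in>partitions_of N. if int (size p) - int (Max_mset p) \<le> - m - 1 then 1 else 0)"
    using True by (intro sum_Max_size_commute) (simp add: N_def)
  also have "\<dots> = int (card {p \<in> partitions_of N. \<not> part_rank p \<le> m})"
  proof -
    have "{p \<in> partitions_of N. int (size p) - int (Max_mset p) \<le> - m - 1} =
        {p \<in> partitions_of N. \<not> part_rank p \<le> m}"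
      by (auto simp: part_rank_def)
    then show ?thesis by (simp add: sum.inter_filter[symmetric] finite_partitions_of)
  qed
  finally have "int (card {p \<in> partitions_of N. part_rank p \<le> - m - 1}) =
      int (card {p \<in> partitions_of N. \<not> part_rank p \<le> m})" .
  moreover have "partitions_of N = {p \<in> partitions_of N. part_rank p \<le> m} \<union>
      {p \<in> partitions_of N. \<not> part_rank p \<le> m}" by auto
  then have "card (partitions_of N) = card {p \<in> partitions_of N. part_rank p \<le> m} +
      card {p \<in> partitions_of N. \<not> part_rank p \<le> m}"
    by (subst card_Un_disjoint[symmetric]) (auto simp: finite_partitions_of)
  ultimately show ?thesis
    using True by (simp add: rank_le_count_def partition_count_def N_def)
qed (auto simp: rank_le_count_def partition_count_def)

text \<open>\<open>card_dyson\<close> matches rank at most \<open>r + 1\<close> for \<open>n\<close>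
  with rank at least \<open>r - 1\<close> for \<open>n + r\<close>, the complement of rank at most
  \<open>r - 2\<close>. The empty partition is consistent with the convention at
  \<open>n = 0\<close> because \<open>r + 1\<close> is positive.\<close>

lemma rank_le_count_dyson:
  assumes "r \<ge> 1" "n \<ge> 0"
  shows "rank_le_count (r - 2) (n + r) + rank_le_count (r + 1) n = partition_count (n + r)"
proof -
  define R N where "R = nat r" and "N = nat n"
  have [simp]: "r = int R" "n = int N" using assms by (simp_all add: R_def N_def)
  have R: "R \<ge> 1" using assms by simp
  have "rank_le_count (r + 1) n = int (card {p \<in> partitions_of N. \<forall>k\<in>#p. k \<le> Suc (size p + R)})"
  proof (cases "N = 0")
    case False
    have "part_rank p \<le> r + 1 \<longleftrightarrow> (\<forall>k\<in>#p. k \<le> Suc (size p + R))" if "p \<in> partitions_of N" for p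
    proof -
      have "part_rank p \<le> r + 1 \<longleftrightarrow> Max_mset p \<le> Suc (size p + R)"
        by (auto simp: part_rank_def)
      also have "\<dots> \<longleftrightarrow> (\<forall>k\<in>#p. k \<le> Suc (size p + R))"
        using that False by (intro Max_mset_le_iff) auto
      finally show ?thesis .
    qed
    then have "{p \<in> partitions_of N. part_rank p \<le> r + 1} =
        {p \<in> partitions_of N. \<forall>k\<in>#p. k \<le> Suc (size p + R)}" by auto
    with False show ?thesis by (simp add: rank_le_count_def)
  next
    case True
    then have "{p \<in> partitions_of N. \<forall>k\<in>#p. k \<le> Suc (size p + R)} = {{#}}" by auto
    with True show ?thesis by (simp add: rank_le_count_def)
  qed
  also have "\<dots> = int (card {p \<in> partitions_of (N + R). part_rank p \<ge> int R - 1})"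
    using card_dyson[OF R, of N] by simp
  also have "\<dots> = partition_count (n + r) - rank_le_count (r - 2) (n + r)"
  proof -
    have "partitions_of (N + R) = {p \<in> partitions_of (N + R). part_rank p \<ge> int R - 1} \<union>
        {p \<in> partitions_of (N + R). part_rank p \<le> int R - 2}" by auto
    then have "card (partitions_of (N + R)) = card {p \<in> partitions_of (N + R). part_rank p \<ge> int R - 1} +
        card {p \<in> partitions_of (N + R). part_rank p \<le> int R - 2}"
      by (subst card_Un_disjoint[symmetric]) (auto simp: finite_partitions_of)
    with R show ?thesis
      by (simp add: partition_count_def rank_le_count_def nat_add_distrib)
  qed
  finally show ?thesis by simp
qed

text \<open>The two exceptional cases come from the convention at \<open>n = 0\<close>.\<close>

lemma rank_le_count_shift:
  assumes "\<not> (m = 2 \<and> n = 0)" "\<not> (m = 0 \<and> n = - 1)"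
  shows "rank_le_count (m - 3) n + rank_le_count m (n - m + 1) = partition_count n"
proof -
  have neg: "rank_le_count k n = 0" "partition_count n = 0" if "n < 0" for k n
    using that by (simp_all add: rank_le_count_def partition_count_def)
  have pos: "rank_le_count (m - 3) n + rank_le_count m (n - m + 1) = partition_count n"
    if "m \<ge> 2" "\<not> (m = 2 \<and> n = 0)" for m n
  proof (cases "n \<ge> m - 1")
    case True
    with that rank_le_count_dyson[of "m - 1" "n - m + 1"] show ?thesis by simp
  next
    case False
    show ?thesis
    proof (cases "n = 0")
      case True
      with that show ?thesis by (simp add: neg rank_le_count_def partition_count_def)
    next
      case n: False
      \<comment> \<open>Now \<open>n - m + 1\<close> is negative, and \<open>m - 3\<close> is at
        least \<open>n - 1\<close>, the bound for the rank of a partition of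
        \<open>n\<close>.\<close>
      then show ?thesis using False that by (simp add: neg rank_le_count_eq_all)
    qed
  qed
  consider "m \<ge> 2" | "m = 1" | "m \<le> 0" by linarith
  then show ?thesis
  proof cases
    case 1
    with pos assms show ?thesis by blast
  next
    case 2
    with rank_le_count_symmetry[of 1 n] show ?thesis by simp
  next
    case 3
    \<comment> \<open>The case \<open>2 - m\<close>, \<open>n - m + 1\<close> is already known. The
      rank symmetry, applied once for \<open>n - m + 1\<close> and once for \<open>n\<close>,
      converts it into the claim.\<close>
    have e: "2 - m - 3 = - m - 1" "n - m + 1 - (2 - m) + 1 = n" by simp_all
    have "rank_le_count (- m - 1) (n - m + 1) + rank_le_count (2 - m) n = partition_count (n - m + 1)"
      using pos[of "2 - m" "n - m + 1"] 3 assms(2) unfolding e by auto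
    moreover have "rank_le_count m (n - m + 1) + rank_le_count (- m - 1) (n - m + 1) =
        partition_count (n - m + 1)" by (rule rank_le_count_symmetry)
    moreover have "rank_le_count (m - 3) n + rank_le_count (2 - m) n = partition_count n"
    proof -
      have "- (m - 3) - 1 = 2 - m" by simp
      with rank_le_count_symmetry[of "m - 3" n] show ?thesis by metis
    qed
    ultimately show ?thesis by linarith
  qed
qed

section \<open>The generating function of the crank\<close>

lemma part_gf_cong:
  assumes "\<And>k. k \<ge> 1 \<Longrightarrow> v k = w k"
  shows "part_gf v = part_gf w"
proof (rule fps_ext)
  fix n
  have "image_mset v p = image_mset w p" if "p \<in> partitions_of n" for p
    using partitions_of_le(1)[OF that] assms by (intro image_mset_cong) auto
  then show "part_gf v $ n = part_gf w $ n"
    unfolding part_gf_nth by (intro sum.cong) auto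
qed

lemma prod_mset_image_eq_0: "k \<in># p \<Longrightarrow> w k = (0::'a::comm_ring_1) \<Longrightarrow> (\<Prod>k\<in>#p. w k) = 0"
  by (auto dest!: multi_member_split)

lemma part_gf_nth_eq_0:
  assumes "n \<ge> 1" "\<And>k. k \<in> {1..n} \<Longrightarrow> w k = 0"
  shows "part_gf w $ n = 0"
  unfolding part_gf_nth
proof (intro sum.neutral ballI)
  fix p assume p: "p \<in> partitions_of n"
  with assms(1) have "p \<noteq> {#}" by auto
  then obtain k where "k \<in># p" by auto
  with partitions_of_le[OF p this] assms(2) show "(\<Prod>k\<in>#p. w k) = 0"
    by (intro prod_mset_image_eq_0[of k]) auto
qed

lemma prod_mset_monom: "(\<Prod>k\<in>#p. monom 1 (f k)) = monom (1::'a::comm_semiring_1) (\<Sum>k\<in>#p. f k)"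
  by (induction p) (simp_all add: mult_monom)

lemma partitions_of_1: "partitions_of 1 = {{#1#}}"
proof -
  have "p = {#1#}" if p: "p \<in> partitions_of 1" for p
  proof -
    from p have "p \<noteq> {#}" by auto
    then obtain k r where kr: "p = add_mset k r" using multiset_cases by blast
    with partitions_of_le[OF p, of k] have "k = 1" by simp
    with kr p have "r \<in> partitions_of 0" by (auto simp: partitions_of_def)
    with kr \<open>k = 1\<close> show ?thesis by simp
  qed
  then show ?thesis by (auto simp: partitions_of_def)
qed

text \<open>Laurent polynomials in \<open>z\<close> with coefficients in \<open>q\<close> are encoded as power series over the
  polynomials in \<open>x\<close>: the monomial \<open>z^m q^n\<close> with \<open>m \<ge> -n\<close> becomes \<open>x^(n + m) X^n\<close>. Thus \<open>z\<close> is \<open>x\<close>,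
  \<open>q\<close> is \<open>x X\<close> and \<open>q / z\<close> is \<open>X\<close>.\<close>

definition z_fps :: "real poly fps" where
  "z_fps = fps_const (monom 1 1)"

definition q_fps :: "real poly fps" where
  "q_fps = z_fps * fps_X"

definition gf_q :: "real poly fps" where
  "gf_q = part_gf (\<lambda>k. monom 1 k)"

definition gf_zq :: "real poly fps" where
  "gf_zq = part_gf (\<lambda>k. monom 1 (Suc k))"

definition gf_qz :: "real poly fps" where
  "gf_qz = part_gf (\<lambda>k. monom 1 (k - 1))"

definition laurent_gf :: "(int \<Rightarrow> nat \<Rightarrow> int) \<Rightarrow> real poly fps" where
  "laurent_gf c = Abs_fps (\<lambda>n. \<Sum>m\<in>{- int n..int n}. monom (of_int (c m n)) (nat (int n + m)))"

definition crank_gf :: "real poly fps" where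
  "crank_gf = laurent_gf crank_count"

definition rank_gf :: "real poly fps" where
  "rank_gf = laurent_gf rank_count"

lemma q_fps_power: "q_fps ^ k = fps_const (monom 1 k) * fps_X ^ k"
  by (simp add: q_fps_def z_fps_def power_mult_distrib fps_const_power[symmetric] monom_power)

text \<open>In terms of \<open>q\<close> and \<open>z\<close>, the inverse of
  \<open>(1 - q) ... (1 - q^w) (1 - z q^(w+1)) (1 - z q^(w+2)) ...\<close>. Parts above
  \<open>w\<close> are marked by \<open>z\<close>, as the crank demands when there are
  \<open>w\<close> ones.\<close>

definition mixed_gf :: "nat \<Rightarrow> real poly fps" where
  "mixed_gf w = part_gf (\<lambda>k. if k \<le> w then monom 1 k else monom 1 (Suc k))"

lemma mixed_gf_0: "mixed_gf 0 = gf_zq"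
  unfolding mixed_gf_def gf_zq_def by (rule part_gf_cong) auto

text \<open>The two weightings differ only at the part \<open>Suc w\<close>, and both sides are the
  series with this part removed.\<close>

lemma mixed_gf_Suc:
  "(1 - q_fps ^ Suc w) * mixed_gf (Suc w) = (1 - z_fps * q_fps ^ Suc w) * mixed_gf w"
proof -
  let ?v = "\<lambda>w k. if k \<le> w then monom 1 k else monom (1::real) (Suc k)"
  have "(?v (Suc w)) (Suc w := 0) = (?v w) (Suc w := 0)"
    by (auto simp: fun_eq_iff le_Suc_eq)
  moreover have "(1 - q_fps ^ Suc w) * mixed_gf (Suc w) = part_gf ((?v (Suc w)) (Suc w := 0))"
    using part_gf_remove[of "Suc w" "?v (Suc w)"]
    by (simp add: mixed_gf_def q_fps_power del: fun_upd_apply power_Suc)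
  moreover have "z_fps * q_fps ^ Suc w = fps_const (monom 1 (Suc (Suc w))) * fps_X ^ Suc w"
    by (simp add: q_fps_power z_fps_def mult.assoc[symmetric] mult_monom del: power_Suc)
  then have "(1 - z_fps * q_fps ^ Suc w) * mixed_gf w = part_gf ((?v w) (Suc w := 0))"
    using part_gf_remove[of "Suc w" "?v w"]
    by (simp add: mixed_gf_def del: fun_upd_apply power_Suc)
  ultimately show ?thesis by simp
qed

text \<open>The largest part can be traded for the number of parts over all partitions, but not over
  those without ones. So the partitions with a one are subtracted: deleting a one keeps the largest
  part, as \<open>n \<ge> 2\<close> leaves something behind.\<close>

lemma sum_no_ones:
  assumes "n \<ge> 2"
  shows "(\<Sum>p | p \<in> partitions_of n \<and> count p 1 = 0. monom 1 (n + Max_mset p)) =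
           ((1 - q_fps) * gf_zq) $ n"
proof -
  have zq: "(\<Sum>p\<in>partitions_of n. monom 1 (n + Max_mset p)) = gf_zq $ n" if "n \<ge> 1" for n
  proof -
    have "(\<Sum>p\<in>partitions_of n. monom (1::real) (n + Max_mset p)) =
        (\<Sum>p\<in>partitions_of n. monom 1 (n + size p))"
      by (rule sum_Max_size_commute[OF that])
    also have "\<dots> = gf_zq $ n"
      unfolding gf_zq_def part_gf_nth prod_mset_monom
      by (intro sum.cong) (auto simp: partitions_of_def sum_mset_image_Suc)
    finally show ?thesis .
  qed
  have "(\<Sum>p | p \<in> partitions_of n \<and> 1 \<le> count p 1. monom (1::real) (n + Max_mset p)) =
      (\<Sum>p\<in>partitions_of (n - 1). monom 1 (n + Max_mset (replicate_mset 1 1 + p)))"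
    using assms replicate_mset_add_partitions_of[of 1 1 "n - 1"]
    by (intro sum.reindex_bij_betw[symmetric]) simp
  also have "\<dots> = (\<Sum>p\<in>partitions_of (n - 1). monom 1 1 * monom 1 (n - 1 + Max_mset p))"
  proof (intro sum.cong refl)
    fix p assume p: "p \<in> partitions_of (n - 1)"
    with assms have ne: "p \<noteq> {#}" by auto
    then have "Max_mset p \<ge> 1" using partitions_of_le(1)[OF p] by auto
    then have "Max_mset (replicate_mset 1 1 + p) = Max_mset p"
      using ne by simp
    then show "monom (1::real) (n + Max_mset (replicate_mset 1 1 + p)) = monom 1 1 * monom 1 (n - 1 + Max_mset p)"
      using assms by (simp add: mult_monom)
  qed
  also have "\<dots> = monom 1 1 * gf_zq $ (n - 1)"
    using zq[of "n - 1"] assms by (simp only: sum_distrib_left[symmetric])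
  finally have ones: "(\<Sum>p | p \<in> partitions_of n \<and> 1 \<le> count p 1. monom (1::real) (n + Max_mset p)) =
      monom 1 1 * gf_zq $ (n - 1)" .
  have "partitions_of n = {p \<in> partitions_of n. count p 1 = 0} \<union> {p \<in> partitions_of n. 1 \<le> count p 1}"
    by (auto simp: Suc_le_eq simp del: count_greater_zero_iff)
  then have "gf_zq $ n = (\<Sum>p | p \<in> partitions_of n \<and> count p 1 = 0. monom 1 (n + Max_mset p)) +
      (\<Sum>p | p \<in> partitions_of n \<and> 1 \<le> count p 1. monom 1 (n + Max_mset p))"
    using zq[of n] assms by (subst sum.union_disjoint[symmetric]) (auto simp: finite_partitions_of count_eq_zero_iff)
  with ones show ?thesis
    using assms by (simp add: left_diff_distrib q_fps_def z_fps_def mult.assoc)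
qed

text \<open>The \<open>w\<close> ones carry \<open>(q / z)^w = X^w\<close>, whence the index
  \<open>n - w\<close>. Every other part carries \<open>q^k\<close>, or \<open>z q^k\<close> if it
  exceeds \<open>w\<close>; the factor \<open>1 - q_fps\<close> removes the part 1 from
  \<open>mixed_gf w\<close>.\<close>

lemma sum_ones:
  assumes "1 \<le> w" "w \<le> n"
  shows "(\<Sum>p | p \<in> partitions_of n \<and> count p 1 = w. monom 1 (nat (int n + part_crank p))) =
           ((1 - q_fps) * mixed_gf w) $ (n - w)"
proof -
  let ?v = "\<lambda>k. if k \<le> w then monom 1 k else monom (1::real) (Suc k)"
  let ?S = "{p \<in> partitions_of (n - w). 1 \<notin># p}"
  have bij: "bij_betw (\<lambda>p. replicate_mset w 1 + p) ?S {p \<in> partitions_of n. count p 1 = w}"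
  proof -
    have "bij_betw (\<lambda>p. replicate_mset w 1 + p) (partitions_of (n - w)) {p \<in> partitions_of n. w \<le> count p 1}"
      using replicate_mset_add_partitions_of[of 1 w "n - w"] assms by simp
    moreover have "(\<lambda>p. replicate_mset w 1 + p) ` ?S = {p \<in> partitions_of n. count p 1 = w}"
    proof (rule set_eqI)
      fix p
      show "p \<in> (\<lambda>p. replicate_mset w 1 + p) ` ?S \<longleftrightarrow> p \<in> {p \<in> partitions_of n. count p 1 = w}"
      proof
        assume "p \<in> (\<lambda>p. replicate_mset w 1 + p) ` ?S"
        then obtain r where r: "p = replicate_mset w 1 + r" "r \<in> ?S" by blast
        with bij_betwE[OF calculation] have "p \<in> {p \<in> partitions_of n. w \<le> count p 1}" by blast
        with r show "p \<in> {p \<in> partitions_of n. count p 1 = w}" by (simp add: not_in_iff)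
      next
        assume p: "p \<in> {p \<in> partitions_of n. count p 1 = w}"
        then have "p \<in> (\<lambda>p. replicate_mset w 1 + p) ` partitions_of (n - w)"
          using bij_betw_imp_surj_on[OF calculation] by simp
        then obtain r where r: "p = replicate_mset w 1 + r" "r \<in> partitions_of (n - w)" by blast
        with p have "1 \<notin># r" by (simp add: not_in_iff)
        with r show "p \<in> (\<lambda>p. replicate_mset w 1 + p) ` ?S" by blast
      qed
    qed
    ultimately show ?thesis
      using bij_betw_subset[of _ _ _ ?S] by blast
  qed
  have "(\<Sum>p | p \<in> partitions_of n \<and> count p 1 = w. monom (1::real) (nat (int n + part_crank p))) =
      (\<Sum>p\<in>?S. monom 1 (nat (int n + part_crank (replicate_mset w 1 + p))))"
    by (rule sum.reindex_bij_betw[OF bij, symmetric])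
  also have "\<dots> = (\<Sum>p\<in>?S. \<Prod>k\<in>#p. (?v(1 := 0)) k)"
  proof (intro sum.cong refl)
    fix p assume p: "p \<in> ?S"
    have "filter_mset (\<lambda>k. k > w) (replicate_mset w 1) = {#}"
      using assms by (intro multiset_eqI) (simp only: count_filter_mset count_replicate_mset count_empty, simp)
    then have "part_crank (replicate_mset w 1 + p) = int (size {#k \<in># p. k > w#}) - int w"
      using p assms by (simp add: part_crank_def not_in_iff)
    then have "nat (int n + part_crank (replicate_mset w 1 + p)) = n - w + size {#k \<in># p. k > w#}"
      using assms by simp
    moreover have "image_mset (?v(1 := 0)) p = image_mset (\<lambda>k. monom 1 (if k \<le> w then k else Suc k)) p"
      using p by (intro image_mset_cong) auto
    moreover have "(\<Sum>k\<in>#p. if k \<le> w then k else Suc k) = sum_mset p + size {#k \<in># p. k > w#}"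
      by (induction p) auto
    ultimately show "monom 1 (nat (int n + part_crank (replicate_mset w 1 + p))) = (\<Prod>k\<in>#p. (?v(1 := 0)) k)"
      using p by (simp only: prod_mset_monom) (simp add: partitions_of_def)
  qed
  also have "\<dots> = part_gf (?v(1 := 0)) $ (n - w)"
    unfolding part_gf_nth
    by (intro sum.mono_neutral_left) (auto simp: finite_partitions_of intro!: prod_mset_image_eq_0[of 1])
  also have "part_gf (?v(1 := 0)) = (1 - q_fps) * mixed_gf w"
    using part_gf_remove[of 1 ?v] assms by (simp add: mixed_gf_def q_fps_def z_fps_def del: fun_upd_apply)
  finally show ?thesis .
qed

lemma part_crank_bounds:
  assumes "p \<in> partitions_of n" "n \<ge> 1"
  shows "part_crank p \<in> {- int n..int n}"
proof -
  have "p \<noteq> {#}" using assms by auto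
  then have "Max_mset p \<le> n" using partitions_of_le(2)[OF assms(1)] by auto
  moreover have "size {#k \<in># p. k > count p 1#} \<le> n" "count p 1 \<le> n"
    using partitions_of_size_le[OF assms(1)] size_filter_mset_lesseq[of "\<lambda>k. k > count p 1" p]
      count_le_size[of p 1] by linarith+
  ultimately show ?thesis by (auto simp: part_crank_def)
qed

lemma crank_gf_nth:
  assumes "n \<ge> 2"
  shows "crank_gf $ n = (\<Sum>p\<in>partitions_of n. monom 1 (nat (int n + part_crank p)))"
proof -
  have "(\<Sum>p\<in>partitions_of n. monom (1::real) (nat (int n + part_crank p))) =
      (\<Sum>m\<in>{- int n..int n}. of_nat (card {p \<in> partitions_of n. part_crank p = m}) * monom 1 (nat (int n + m)))"
    by (rule sum_fun_comp) (use part_crank_bounds assms in \<open>auto simp: finite_partitions_of\<close>)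
  also have "\<dots> = crank_gf $ n"
    using assms by (simp add: crank_gf_def laurent_gf_def crank_count_def of_nat_poly smult_monom)
  finally show ?thesis by simp
qed

lemma crank_gf_nth_eq: "crank_gf $ n = (\<Sum>w\<le>n. ((1 - q_fps) * mixed_gf w) $ (n - w))"
proof -
  consider "n = 0" | "n = 1" | "n \<ge> 2" by linarith
  then show ?thesis
  proof cases
    case 1
    then show ?thesis
      by (simp add: crank_gf_def laurent_gf_def crank_count_def mixed_gf_def monom_0 q_fps_def fps_mult_nth)
  next
    case 2
    \<comment> \<open>At \<open>n = 1\<close> the right-hand side is \<open>x^2 - x + 1\<close>, so
      its term is \<open>(z - 1 + 1 / z) q\<close>. This is the convention for
      \<open>M(m,1)\<close>.\<close>
    have "{- 1..1} = {- 1, 0, 1 :: int}" by auto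
    moreover have "mixed_gf 0 $ 1 = monom 1 2"
      by (simp only: mixed_gf_def part_gf_nth partitions_of_1) (simp add: numeral_2_eq_2)
    moreover have "{..1} = {0, 1 :: nat}" by auto
    moreover have "mixed_gf w $ 0 = 1" for w by (simp add: mixed_gf_def)
    ultimately show ?thesis using 2
      by (simp add: crank_gf_def laurent_gf_def crank_count_def left_diff_distrib q_fps_def z_fps_def mult.assoc
          monom_altdef one_pCons minus_monom numeral_2_eq_2)
  next
    case 3
    have "crank_gf $ n = (\<Sum>w\<le>n. \<Sum>p | p \<in> partitions_of n \<and> count p 1 = w. monom 1 (nat (int n + part_crank p)))"
      unfolding crank_gf_nth[OF 3]
      by (rule sum.group[symmetric])
         (auto simp: finite_partitions_of intro: order_trans[OF count_le_size partitions_of_size_le])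
    also have "\<dots> = (\<Sum>w\<le>n. ((1 - q_fps) * mixed_gf w) $ (n - w))"
    proof (intro sum.cong refl)
      fix w assume w: "w \<in> {..n}"
      show "(\<Sum>p | p \<in> partitions_of n \<and> count p 1 = w. monom 1 (nat (int n + part_crank p))) =
          ((1 - q_fps) * mixed_gf w) $ (n - w)"
      proof (cases "w = 0")
        case True
        have "nat (int n + part_crank p) = n + Max_mset p" if "count p 1 = 0" for p
          using that by (simp add: part_crank_def not_in_iff nat_add_distrib)
        then have "(\<Sum>p | p \<in> partitions_of n \<and> count p 1 = w. monom (1::real) (nat (int n + part_crank p))) =
            (\<Sum>p | p \<in> partitions_of n \<and> count p 1 = 0. monom 1 (n + Max_mset p))"
          using True by (intro sum.cong) auto
        with sum_no_ones[OF 3] True show ?thesis by (simp add: mixed_gf_0)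
      qed (use sum_ones[of w n] w in auto)
    qed
    finally show ?thesis .
  qed
qed

section \<open>The product formula from the q-binomial series\<close>

definition qz_fps :: "nat \<Rightarrow> real poly fps" where
  "qz_fps j = fps_const (monom 1 (j - 1)) * fps_X ^ j"

text \<open>The sum of \<open>t^w mixed_gf w\<close> over all \<open>w\<close> at
  \<open>t = q^j / z\<close>. Up to the factor \<open>gf_zq\<close> it is the q-binomial series with
  numerator parameter \<open>z q\<close>. For \<open>j \<ge> 1\<close> the powers \<open>t^w\<close>
  with \<open>w > n\<close> do not reach \<open>X^n\<close>, so a finite sum gives each
  coefficient.\<close>

definition mixed_sum :: "nat \<Rightarrow> real poly fps" where
  "mixed_sum j = Abs_fps (\<lambda>n. \<Sum>w\<le>n. (qz_fps j ^ w * mixed_gf w) $ n)"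

lemma qz_fps_mult_z: "j \<ge> 1 \<Longrightarrow> z_fps * qz_fps j = q_fps ^ j"
  by (simp add: qz_fps_def z_fps_def q_fps_power mult.assoc[symmetric] mult_monom)

lemma qz_fps_Suc:
  assumes "j \<ge> 1"
  shows "qz_fps (Suc j) = qz_fps j * q_fps"
proof -
  from assms have "fps_const (monom (1::real) j) = fps_const (monom 1 (j - 1)) * fps_const (monom 1 1)"
    by (simp add: mult_monom)
  then have "qz_fps (Suc j) = fps_const (monom 1 (j - 1)) * fps_const (monom 1 1) * (fps_X ^ j * fps_X)"
    by (simp only: qz_fps_def diff_Suc_1 power_Suc2)
  then show ?thesis by (simp only: qz_fps_def q_fps_def z_fps_def mult_ac)
qed

lemma qz_fps_power_nth_eq_0:
  assumes "j \<ge> 1" "n < w"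
  shows "(qz_fps j ^ w * f) $ n = 0"
proof -
  have "n < j * w" using assms
    by (metis le_trans less_le_trans mult_le_mono1 nat_mult_1 order.refl)
  moreover have "qz_fps j ^ w * f = fps_X ^ (j * w) * (fps_const (monom 1 (j - 1) ^ w) * f)"
    by (simp add: qz_fps_def power_mult_distrib power_mult mult_ac fps_const_power)
  ultimately show ?thesis by (simp only: fps_X_power_mult_nth) simp
qed

lemma mixed_sum_nth:
  assumes "j \<ge> 1" "n \<le> M"
  shows "mixed_sum j $ n = (\<Sum>w\<le>M. qz_fps j ^ w * mixed_gf w) $ n"
proof -
  have "(\<Sum>w\<le>M. (qz_fps j ^ w * mixed_gf w) $ n) = (\<Sum>w\<le>n. (qz_fps j ^ w * mixed_gf w) $ n)"
    using assms by (intro sum.mono_neutral_right) (auto intro: qz_fps_power_nth_eq_0)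
  then show ?thesis by (simp add: mixed_sum_def fps_sum_nth)
qed

lemma crank_gf_eq_mixed_sum: "crank_gf = (1 - q_fps) * mixed_sum 1"
proof (rule fps_ext)
  fix n
  have "((1 - q_fps) * mixed_sum 1) $ n = ((1 - q_fps) * (\<Sum>w\<le>n. qz_fps 1 ^ w * mixed_gf w)) $ n"
    unfolding fps_mult_nth by (intro sum.cong refl) (subst mixed_sum_nth[where M = n], auto)
  also have "\<dots> = (\<Sum>w\<le>n. qz_fps 1 ^ w * ((1 - q_fps) * mixed_gf w)) $ n"
    by (simp add: sum_distrib_left mult.left_commute)
  also have "\<dots> = (\<Sum>w\<le>n. ((1 - q_fps) * mixed_gf w) $ (n - w))"
    by (simp add: fps_sum_nth qz_fps_def fps_X_power_mult_nth monom_0 flip: one_pCons)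
  finally show "crank_gf $ n = ((1 - q_fps) * mixed_sum 1) $ n"
    by (simp add: crank_gf_nth_eq)
qed

text \<open>The q-binomial functional equation \<open>(1 - t) F(t) = (1 - a t) F(q t)\<close> with
  \<open>a = z q\<close> and \<open>t = q^j / z\<close>, so that \<open>a t = q^(j+1)\<close>. For
  partial sums it holds up to an explicit remainder, whose order in \<open>X\<close> exceeds
  \<open>M\<close>.\<close>

lemma mixed_partial_sum:
  assumes "j \<ge> 1"
  shows "(1 - qz_fps j) * (\<Sum>w\<le>M. qz_fps j ^ w * mixed_gf w) -
           (1 - q_fps ^ Suc j) * (\<Sum>w\<le>M. qz_fps (Suc j) ^ w * mixed_gf w) =
         - (qz_fps j ^ Suc M * ((1 - z_fps * q_fps ^ Suc M) * mixed_gf M))"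
proof (induction M)
  case 0
  have ze: "q_fps ^ Suc j = z_fps * qz_fps j * q_fps"
    by (simp add: qz_fps_mult_z[OF assms])
  show ?case unfolding ze by (simp add: algebra_simps)
next
  case (Suc M)
  define e Q R S T u where defs: "e = qz_fps j" "Q = mixed_gf M" "R = mixed_gf (Suc M)"
    "S = (\<Sum>w\<le>M. qz_fps j ^ w * mixed_gf w)" "T = (\<Sum>w\<le>M. qz_fps (Suc j) ^ w * mixed_gf w)"
    "u = q_fps ^ Suc M"
  have e': "qz_fps (Suc j) ^ Suc M = e ^ Suc M * u"
    unfolding qz_fps_Suc[OF assms] by (simp add: defs power_mult_distrib)
  have ze: "q_fps ^ Suc j = z_fps * e * q_fps"
    using qz_fps_mult_z[OF assms] by (simp add: defs mult_ac)
  have Q: "(1 - z_fps * u) * Q = (1 - u) * R"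
    using mixed_gf_Suc[of M] by (simp add: defs)
  have IH: "(1 - e) * S - (1 - z_fps * e * q_fps) * T = - (e ^ Suc M * ((1 - z_fps * u) * Q))"
    using Suc.IH unfolding ze by (simp only: defs)
  have "(1 - e) * (S + e ^ Suc M * R) - (1 - z_fps * e * q_fps) * (T + e ^ Suc M * u * R) =
      - (e ^ Suc M * e * ((1 - z_fps * (u * q_fps)) * R))"
    using IH unfolding Q by (simp only: ring_distribs) (simp add: algebra_simps)
  moreover have "q_fps ^ Suc (Suc M) = u * q_fps" "qz_fps j ^ Suc (Suc M) = e ^ Suc M * e"
    by (simp_all add: defs mult.commute)
  ultimately show ?case
    unfolding sum.atMost_Suc e' ze by (simp only: defs(1,3,4,5)[symmetric]) (simp only: defs)
qed

lemma mixed_sum_Suc: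
  assumes "j \<ge> 1"
  shows "(1 - qz_fps j) * mixed_sum j = (1 - q_fps ^ Suc j) * mixed_sum (Suc j)"
proof (rule fps_ext)
  fix n
  have *: "(f * mixed_sum j) $ n = (f * (\<Sum>w\<le>n. qz_fps j ^ w * mixed_gf w)) $ n" if "j \<ge> 1" for f j
    unfolding fps_mult_nth using that by (intro sum.cong refl) (subst mixed_sum_nth[where M = n], auto)
  have "(qz_fps j ^ Suc n * ((1 - z_fps * q_fps ^ Suc n) * mixed_gf n)) $ n = 0"
    using assms by (intro qz_fps_power_nth_eq_0) auto
  then show "((1 - qz_fps j) * mixed_sum j) $ n = ((1 - q_fps ^ Suc j) * mixed_sum (Suc j)) $ n"
    using arg_cong[OF mixed_partial_sum[OF assms, of n], of "\<lambda>f. f $ n"] assms by (simp add: *)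
qed

text \<open>Both sides satisfy the functional equation \<open>(1 - q^j / z) f j = f (j + 1)\<close>, and they agree
  in the limit \<open>j \<rightarrow> \<infinity>\<close>.\<close>

lemma mixed_sum_mult_tail:
  assumes "j \<ge> 1"
  shows "mixed_sum j * part_gf (\<lambda>k. if k \<ge> Suc j then monom 1 k else 0) =
         part_gf (\<lambda>k. if k \<ge> j then monom 1 (k - 1) else 0) * gf_zq"
proof -
  define A where "A j = part_gf (\<lambda>k. if k \<ge> j then monom (1::real) k else 0)" for j
  define B where "B j = part_gf (\<lambda>k. if k \<ge> j then monom (1::real) (k - 1) else 0)" for j
  define D where "D j = mixed_sum j * A (Suc j) - B j * gf_zq" for j
  have A: "(1 - q_fps ^ j) * A j = A (Suc j)" if "j \<ge> 1" for j
  proof -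
    have "(\<lambda>k. if k \<ge> j then monom (1::real) k else 0) (j := 0) = (\<lambda>k. if k \<ge> Suc j then monom 1 k else 0)"
      by (auto simp: fun_eq_iff)
    with part_gf_remove[OF that, of "\<lambda>k. if k \<ge> j then monom (1::real) k else 0"]
    show ?thesis by (simp add: A_def q_fps_power del: fun_upd_apply)
  qed
  have B: "(1 - qz_fps j) * B j = B (Suc j)" if "j \<ge> 1" for j
  proof -
    have "(\<lambda>k. if k \<ge> j then monom (1::real) (k - 1) else 0) (j := 0) =
        (\<lambda>k. if k \<ge> Suc j then monom 1 (k - 1) else 0)"
      by (auto simp: fun_eq_iff)
    with part_gf_remove[OF that, of "\<lambda>k. if k \<ge> j then monom (1::real) (k - 1) else 0"]
    show ?thesis by (simp add: B_def qz_fps_def del: fun_upd_apply)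
  qed
  have D: "(1 - qz_fps j) * D j = D (Suc j)" if "j \<ge> 1" for j
  proof -
    have "(1 - qz_fps j) * D j = ((1 - qz_fps j) * mixed_sum j) * A (Suc j) - ((1 - qz_fps j) * B j) * gf_zq"
      by (simp add: D_def algebra_simps)
    also have "\<dots> = mixed_sum (Suc j) * ((1 - q_fps ^ Suc j) * A (Suc j)) - B (Suc j) * gf_zq"
      unfolding mixed_sum_Suc[OF that] B[OF that] by (simp add: mult_ac)
    finally show ?thesis by (simp only: A[of "Suc j"] D_def)
  qed
  \<comment> \<open>For \<open>n < j\<close> both tails look like 1 up to degree \<open>n\<close>,
    and of \<open>mixed_sum j\<close> only the term \<open>w = 0\<close>, which is
    \<open>gf_zq\<close>, remains.\<close>
  have large: "D j $ n = 0" if "n < j" for n j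
  proof -
    have "A (Suc j) $ i = (if i = 0 then 1 else 0)" "B j $ i = (if i = 0 then 1 else 0)" if "i \<le> n" for i
      using that \<open>n < j\<close> by (auto simp: A_def B_def intro!: part_gf_nth_eq_0)
    moreover have "mixed_sum j $ n = gf_zq $ n"
    proof -
      have "(qz_fps j ^ w * mixed_gf w) $ n = 0" if "w \<noteq> 0" for w
      proof -
        from that obtain v where "w = Suc v" by (cases w) auto
        then have "qz_fps j ^ w * mixed_gf w =
            fps_const (monom 1 (j - 1)) * (fps_X ^ j * (qz_fps j ^ v * mixed_gf w))"
          by (simp only: power_Suc qz_fps_def mult.assoc)
        then show ?thesis using \<open>n < j\<close>
          by (simp only: fps_mult_left_const_nth fps_X_power_mult_nth) simp
      qed
      then have "(\<Sum>w\<le>n. (qz_fps j ^ w * mixed_gf w) $ n) = (\<Sum>w\<in>{0}. (qz_fps j ^ w * mixed_gf w) $ n)"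
        by (intro sum.mono_neutral_right) auto
      then show ?thesis by (simp add: mixed_sum_def mixed_gf_0)
    qed
    moreover have "(f * g) $ n = f $ n" if "\<And>i. i \<le> n \<Longrightarrow> g $ i = (if i = 0 then 1 else 0)"
      for f g :: "real poly fps"
    proof -
      have "(f * g) $ n = (\<Sum>i = 0..n. f $ i * (if n - i = 0 then 1 else 0))"
        unfolding fps_mult_nth using that by (intro sum.cong) auto
      also have "\<dots> = (\<Sum>i\<in>{n}. f $ i)"
        by (intro sum.mono_neutral_cong_right) auto
      finally show ?thesis by simp
    qed
    ultimately show ?thesis
      by (simp add: D_def mult.commute[of _ gf_zq])
  qed
  have "\<forall>j\<ge>1. D j $ n = 0" for n
  proof (induction n rule: less_induct)
    case (less n)
    \<comment> \<open>In \<open>(1 - qz_fps j) * D j\<close> the correction involves only lower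
      coefficients of \<open>D j\<close>, which vanish by induction. Hence the coefficient is
      independent of \<open>j\<close> and can be read off at large \<open>j\<close>.\<close>
    have step: "D j $ n = D (Suc j) $ n" if "j \<ge> 1" for j
    proof -
      have "D (Suc j) $ n = D j $ n - (qz_fps j * D j) $ n"
        using D[OF that] by (simp add: left_diff_distrib flip: fps_sub_nth)
      also have "(qz_fps j * D j) $ n = 0"
        using less.IH that by (simp add: qz_fps_def mult.assoc fps_X_power_mult_nth)
      finally show ?thesis by simp
    qed
    have "D j $ n = D (j + i) $ n" if "j \<ge> 1" for j i
    proof (induction i)
      case (Suc i)
      with step[of "j + i"] that show ?case by simp
    qed simp
    from this[of _ "Suc n"] large[of n] show ?case by auto
  qed
  then have "D j = 0" using assms by (intro fps_ext) simp
  then show ?thesis by (simp add: D_def A_def B_def)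
qed

text \<open>The case \<open>j = 1\<close> of \<open>mixed_sum_mult_tail\<close>: the factor
  \<open>1 - q\<close> of the crank series cancels the part 1 of \<open>gf_q\<close>.\<close>

theorem crank_gf_product: "crank_gf * gf_q = gf_zq * gf_qz"
proof -
  have "(1 - q_fps) * gf_q = part_gf (\<lambda>k. if k \<ge> 2 then monom 1 k else 0)"
    using part_gf_remove[of 1 "\<lambda>k. monom (1::real) k"]
    by (simp add: gf_q_def q_fps_def z_fps_def) (rule part_gf_cong, auto)
  moreover have "gf_qz = part_gf (\<lambda>k. if k \<ge> 1 then monom 1 (k - 1) else 0)"
    unfolding gf_qz_def by (rule part_gf_cong) auto
  moreover have "crank_gf * gf_q = mixed_sum 1 * ((1 - q_fps) * gf_q)"
    by (simp add: crank_gf_eq_mixed_sum mult_ac)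
  ultimately show ?thesis
    using mixed_sum_mult_tail[of 1] by (simp add: numeral_2_eq_2 mult.commute)
qed

section \<open>Convolution sums of divisor functions\<close>

lemma numeral_mult_fps_nth [simp]: "(numeral k * f) $ n = numeral k * (f $ n :: 'a::comm_ring_1)"
  by (simp add: numeral_fps_const)

lemma of_nat_mult_fps_nth [simp]: "(of_nat k * f) $ n = of_nat k * (f $ n :: 'a::comm_ring_1)"
  by (simp flip: fps_of_nat)

definition sigma_gf :: "nat \<Rightarrow> real fps" where
  "sigma_gf j = Abs_fps (\<lambda>n. if n = 0 then 0 else \<Sum>d | d dvd n. real d ^ j)"

lemma sigma_gf_nth_0 [simp]: "sigma_gf j $ 0 = 0"
  by (simp add: sigma_gf_def)

lemma sigma_gf_nth: "n \<ge> 1 \<Longrightarrow> sigma_gf j $ n = (\<Sum>d | d dvd n. real d ^ j)"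
  by (simp add: sigma_gf_def)

section \<open>Sums over the solutions of a x + b y = n\<close>

definition quads :: "nat \<Rightarrow> (nat \<times> nat \<times> nat \<times> nat) set" where
  "quads n = {(a, b, x, y). 1 \<le> a \<and> 1 \<le> b \<and> 1 \<le> x \<and> 1 \<le> y \<and> a * x + b * y = n}"

definition quad_sum :: "nat \<Rightarrow> (nat \<Rightarrow> nat \<Rightarrow> nat \<Rightarrow> nat \<Rightarrow> real) \<Rightarrow> real" where
  "quad_sum n g = (\<Sum>(a, b, x, y)\<in>quads n. g a b x y)"

lemma quads_le:
  assumes "(a, b, x, y) \<in> quads n"
  shows "a \<le> n" "b \<le> n" "x \<le> n" "y \<le> n"
proof -
  from assms have *: "1 \<le> a" "1 \<le> b" "1 \<le> x" "1 \<le> y" "a * x + b * y = n"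
    by (auto simp: quads_def)
  from * have "a \<le> a * x" "x \<le> a * x" "b \<le> b * y" "y \<le> b * y" by simp_all
  with * show "a \<le> n" "b \<le> n" "x \<le> n" "y \<le> n" by linarith+
qed

lemma finite_quads [simp]: "finite (quads n)"
proof (rule finite_subset)
  show "quads n \<subseteq> {..n} \<times> {..n} \<times> {..n} \<times> {..n}"
    using quads_le by auto
qed simp

lemma quad_sum_cong:
  "(\<And>a b x y. (a, b, x, y) \<in> quads n \<Longrightarrow> g a b x y = h a b x y) \<Longrightarrow> quad_sum n g = quad_sum n h"
  unfolding quad_sum_def by (intro sum.cong) auto

lemma quad_sum_add: "quad_sum n (\<lambda>a b x y. g a b x y + h a b x y) = quad_sum n g + quad_sum n h"
  by (simp add: quad_sum_def case_prod_beta sum.distrib)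

lemma quad_sum_cmult: "quad_sum n (\<lambda>a b x y. c * g a b x y) = c * quad_sum n g"
  by (simp add: quad_sum_def case_prod_beta sum_distrib_left)

lemma quad_sum_if:
  "quad_sum n (\<lambda>a b x y. if P a b x y then g a b x y else 0) =
     (\<Sum>t\<in>{t \<in> quads n. case t of (a, b, x, y) \<Rightarrow> P a b x y}. case t of (a, b, x, y) \<Rightarrow> g a b x y)"
  unfolding quad_sum_def by (subst sum.inter_filter) (auto intro!: sum.cong)

text \<open>One step of Euclid's algorithm: \<open>(a - b) x + b (x + y) = a x + b y\<close>. The
  inequality between \<open>a\<close> and \<open>b\<close> becomes one between the new
  \<open>x\<close> and \<open>y\<close>.\<close>

lemma quad_sum_shear:
  "quad_sum n (\<lambda>a b x y. if b < a then g a b else 0) =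
   quad_sum n (\<lambda>a b x y. if x < y then g (a + b) b else 0)"
  unfolding quad_sum_if
  by (rule sum.reindex_bij_witness[where i = "\<lambda>(a, b, x, y). (a + b, b, x, y - x)"
        and j = "\<lambda>(a, b, x, y). (a - b, b, x, x + y)"])
     (auto simp: quads_def algebra_simps diff_mult_distrib diff_mult_distrib2,
      auto intro!: le_add_diff_inverse trans_le_add1 mult_le_mono)

text \<open>The companion shear \<open>(a, b - a, x + y, y)\<close> fixes \<open>a\<close>, so it
  transports functions of \<open>a\<close> alone.\<close>

lemma quad_sum_shear2:
  "quad_sum n (\<lambda>a b x y. if a < b then f a else 0) =
   quad_sum n (\<lambda>a b x y. if y < x then f a else 0)"
  unfolding quad_sum_if
  by (rule sum.reindex_bij_witness[where i = "\<lambda>(a, b, x, y). (a, b + a, x - y, y)"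
        and j = "\<lambda>(a, b, x, y). (a, b - a, x + y, y)"])
     (auto simp: quads_def algebra_simps diff_mult_distrib diff_mult_distrib2,
      auto intro!: le_add_diff_inverse trans_le_add1 mult_le_mono)

lemma quad_sum_swap: "quad_sum n g = quad_sum n (\<lambda>a b x y. g b a y x)"
  unfolding quad_sum_def
  by (rule sum.reindex_bij_witness[where i = "\<lambda>(a, b, x, y). (b, a, y, x)"
        and j = "\<lambda>(a, b, x, y). (b, a, y, x)"]) (auto simp: quads_def)

lemma quad_sum_trichotomy_ab:
  "quad_sum n g = quad_sum n (\<lambda>a b x y. if a < b then g a b x y else 0) +
     quad_sum n (\<lambda>a b x y. if a = b then g a b x y else 0) +
     quad_sum n (\<lambda>a b x y. if b < a then g a b x y else 0)"
  by (simp only: quad_sum_add[symmetric]) (rule quad_sum_cong, auto)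

lemma quad_sum_trichotomy_xy:
  "quad_sum n g = quad_sum n (\<lambda>a b x y. if x < y then g a b x y else 0) +
     quad_sum n (\<lambda>a b x y. if x = y then g a b x y else 0) +
     quad_sum n (\<lambda>a b x y. if y < x then g a b x y else 0)"
  by (simp only: quad_sum_add[symmetric]) (rule quad_sum_cong, auto)

lemma quad_sum_symmetric_ab:
  assumes "\<And>a b. g a b = g b a"
  shows "quad_sum n (\<lambda>a b x y. g a b) = 2 * quad_sum n (\<lambda>a b x y. if b < a then g a b else 0) +
     quad_sum n (\<lambda>a b x y. if a = b then g a b else 0)"
proof -
  have "quad_sum n (\<lambda>a b x y. if a < b then g a b else 0) =
      quad_sum n (\<lambda>a b x y. if b < a then g a b else 0)"
    by (subst quad_sum_swap) (rule quad_sum_cong, simp add: assms)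
  with quad_sum_trichotomy_ab[of n "\<lambda>a b x y. g a b"] show ?thesis by simp
qed

lemma quad_sum_symmetric_xy:
  assumes "\<And>a b. g a b = g b a"
  shows "quad_sum n (\<lambda>a b x y. g a b) = 2 * quad_sum n (\<lambda>a b x y. if x < y then g a b else 0) +
     quad_sum n (\<lambda>a b x y. if x = y then g a b else 0)"
proof -
  have "quad_sum n (\<lambda>a b x y. if y < x then g a b else 0) =
      quad_sum n (\<lambda>a b x y. if x < y then g a b else 0)"
    by (subst quad_sum_swap) (rule quad_sum_cong, simp add: assms)
  with quad_sum_trichotomy_xy[of n "\<lambda>a b x y. g a b"] show ?thesis by simp
qed

lemma dvd_decomp:
  assumes "d dvd n" "n \<ge> (1::nat)"
  obtains k where "n = d * k" "1 \<le> d" "1 \<le> k"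
  using assms by (auto elim!: dvdE simp: Suc_le_eq)

text \<open>On \<open>x = y\<close> the equation reads \<open>(a + b) x = n\<close>, so
  \<open>d = a + b\<close> runs through the divisors.\<close>

lemma quad_sum_diag_xy:
  assumes "n \<ge> 1"
  shows "quad_sum n (\<lambda>a b x y. if x = y then g a b else 0) =
           (\<Sum>d | d dvd n. \<Sum>a\<in>{1..<d}. g a (d - a))"
proof -
  have "quad_sum n (\<lambda>a b x y. if x = y then g a b else 0) =
      (\<Sum>(d, a)\<in>Sigma {d. d dvd n} (\<lambda>d. {1..<d}). g a (d - a))"
    unfolding quad_sum_if
  proof (rule sum.reindex_bij_witness[where i = "\<lambda>(d, a). (a, d - a, n div d, n div d)"
        and j = "\<lambda>(a, b, x, y). (a + b, a)"])
    fix t assume "t \<in> {t \<in> quads n. case t of (a, b, x, y) \<Rightarrow> x = y}"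
    then obtain a b x where t: "t = (a, b, x, x)" "1 \<le> a" "1 \<le> b" "1 \<le> x" "n = (a + b) * x"
      by (auto simp: quads_def algebra_simps)
    then show "(case case t of (a, b, x, y) \<Rightarrow> (a + b, a) of (d, a) \<Rightarrow> (a, d - a, n div d, n div d)) = t"
      "(case t of (a, b, x, y) \<Rightarrow> (a + b, a)) \<in> (SIGMA d:{d. d dvd n}. {1..<d})"
      "(case case t of (a, b, x, y) \<Rightarrow> (a + b, a) of (d, a) \<Rightarrow> g a (d - a)) = (case t of (a, b, x, y) \<Rightarrow> g a b)"
      by simp_all
  next
    fix t assume "t \<in> (SIGMA d:{d. d dvd n}. {1..<d})"
    then obtain d a where t: "t = (d, a)" "d dvd n" "1 \<le> a" "a < d" by auto
    from dvd_decomp[OF t(2) assms] obtain k where "n = d * k" "1 \<le> k" by blast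
    with t show "(case t of (d, a) \<Rightarrow> (a, d - a, n div d, n div d)) \<in>
        {t \<in> quads n. case t of (a, b, x, y) \<Rightarrow> x = y}"
      "(case case t of (d, a) \<Rightarrow> (a, d - a, n div d, n div d) of (a, b, x, y) \<Rightarrow> (a + b, a)) = t"
      by (simp_all add: quads_def add_mult_distrib[symmetric])
  qed
  also have "\<dots> = (\<Sum>d | d dvd n. \<Sum>a\<in>{1..<d}. g a (d - a))"
    using assms by (subst sum.Sigma) (auto simp: finite_divisors_nat)
  finally show ?thesis .
qed

text \<open>On \<open>a = b = d\<close> the equation reads \<open>x + y = n / d\<close>, with
  \<open>n / d - 1\<close> solutions.\<close>

lemma quad_sum_diag_ab:
  assumes "n \<ge> 1"
  shows "quad_sum n (\<lambda>a b x y. if a = b then f a else 0) =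
           (\<Sum>d | d dvd n. (real n / real d - 1) * f d)"
proof -
  have "quad_sum n (\<lambda>a b x y. if a = b then f a else 0) =
      (\<Sum>(d, x)\<in>Sigma {d. d dvd n} (\<lambda>d. {1..<n div d}). f d)"
    unfolding quad_sum_if
  proof (rule sum.reindex_bij_witness[where i = "\<lambda>(d, x). (d, d, x, n div d - x)"
        and j = "\<lambda>(a, b, x, y). (a, x)"])
    fix t assume "t \<in> {t \<in> quads n. case t of (a, b, x, y) \<Rightarrow> a = b}"
    then obtain a x y where t: "t = (a, a, x, y)" "1 \<le> a" "1 \<le> x" "1 \<le> y" "n = a * (x + y)"
      by (auto simp: quads_def algebra_simps)
    then show "(case case t of (a, b, x, y) \<Rightarrow> (a, x) of (d, x) \<Rightarrow> (d, d, x, n div d - x)) = t"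
      "(case t of (a, b, x, y) \<Rightarrow> (a, x)) \<in> (SIGMA d:{d. d dvd n}. {1..<n div d})"
      "(case case t of (a, b, x, y) \<Rightarrow> (a, x) of (d, x) \<Rightarrow> f d) = (case t of (a, b, x, y) \<Rightarrow> f a)"
      by simp_all
  next
    fix t assume "t \<in> (SIGMA d:{d. d dvd n}. {1..<n div d})"
    then obtain d x where t: "t = (d, x)" "d dvd n" "1 \<le> x" "x < n div d" by auto
    from dvd_decomp[OF t(2) assms] obtain k where "n = d * k" "1 \<le> d" by blast
    with t show "(case t of (d, x) \<Rightarrow> (d, d, x, n div d - x)) \<in>
        {t \<in> quads n. case t of (a, b, x, y) \<Rightarrow> a = b}"
      "(case case t of (d, x) \<Rightarrow> (d, d, x, n div d - x) of (a, b, x, y) \<Rightarrow> (a, x)) = t"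
      by (simp_all add: quads_def add_mult_distrib2[symmetric])
  qed
  also have "\<dots> = (\<Sum>d | d dvd n. \<Sum>x\<in>{1..<n div d}. f d)"
    using assms by (subst sum.Sigma) (auto simp: finite_divisors_nat)
  also have "\<dots> = (\<Sum>d | d dvd n. (real n / real d - 1) * f d)"
  proof (intro sum.cong refl)
    fix d assume "d \<in> {d. d dvd n}"
    then obtain k where "n = d * k" "1 \<le> d" "1 \<le> k" using dvd_decomp assms by blast
    then show "(\<Sum>x\<in>{1..<n div d}. f d) = (real n / real d - 1) * f d"
      by (simp add: of_nat_diff)
  qed
  finally show ?thesis .
qed

lemma sigma_gf_mult_nth: "(sigma_gf i * sigma_gf j) $ n = quad_sum n (\<lambda>a b x y. real a ^ i * real b ^ j)"
proof -
  have "(sigma_gf i * sigma_gf j) $ n = (\<Sum>m = 0..n. sigma_gf i $ m * sigma_gf j $ (n - m))"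
    by (rule fps_mult_nth)
  also have "\<dots> = (\<Sum>m\<in>{1..<n}. sigma_gf i $ m * sigma_gf j $ (n - m))"
  proof (intro sum.mono_neutral_right ballI)
    fix m assume "m \<in> {0..n} - {1..<n}"
    then have "m = 0 \<or> m = n" by auto
    then show "sigma_gf i $ m * sigma_gf j $ (n - m) = 0" by auto
  qed auto
  also have "\<dots> = (\<Sum>m\<in>{1..<n}. \<Sum>(a, b)\<in>{d. d dvd m} \<times> {d. d dvd n - m}. real a ^ i * real b ^ j)"
    by (intro sum.cong refl) (simp add: sigma_gf_nth Suc_le_eq sum_product sum.cartesian_product)
  also have "\<dots> = (\<Sum>(m, a, b)\<in>Sigma {1..<n} (\<lambda>m. {d. d dvd m} \<times> {d. d dvd n - m}). real a ^ i * real b ^ j)"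
    by (subst sum.Sigma) (auto simp: finite_divisors_nat)
  also have "\<dots> = quad_sum n (\<lambda>a b x y. real a ^ i * real b ^ j)"
    unfolding quad_sum_def
  proof (rule sum.reindex_bij_witness[where j = "\<lambda>(m, a, b). (a, b, m div a, (n - m) div b)"
        and i = "\<lambda>(a, b, x, y). (a * x, a, b)"])
    fix t assume "t \<in> Sigma {1..<n} (\<lambda>m. {d. d dvd m} \<times> {d. d dvd n - m})"
    then obtain m a b where t: "t = (m, a, b)" "1 \<le> m" "m < n" "a dvd m" "b dvd n - m" by auto
    from dvd_decomp[OF t(4) t(2)] obtain x where x: "m = a * x" "1 \<le> a" "1 \<le> x" by blast
    have "1 \<le> n - m" using t by simp
    from dvd_decomp[OF t(5) this] obtain y where y: "n - m = b * y" "1 \<le> b" "1 \<le> y" by blast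
    have n: "n = a * x + b * y" using x y t by simp
    show "(case t of (m, a, b) \<Rightarrow> (a, b, m div a, (n - m) div b)) \<in> quads n"
      "(case case t of (m, a, b) \<Rightarrow> (a, b, m div a, (n - m) div b) of (a, b, x, y) \<Rightarrow> (a * x, a, b)) = t"
      "(case case t of (m, a, b) \<Rightarrow> (a, b, m div a, (n - m) div b) of (a, b, x, y) \<Rightarrow> real a ^ i * real b ^ j) =
        (case t of (m, a, b) \<Rightarrow> real a ^ i * real b ^ j)"
      using x y unfolding t n by (simp_all add: quads_def)
  next
    fix t assume "t \<in> quads n"
    then obtain a b x y where t: "t = (a, b, x, y)" "1 \<le> a" "1 \<le> b" "1 \<le> x" "1 \<le> y" "n = a * x + b * y"
      by (auto simp: quads_def)
    then show "(case t of (a, b, x, y) \<Rightarrow> (a * x, a, b)) \<in> Sigma {1..<n} (\<lambda>m. {d. d dvd m} \<times> {d. d dvd n - m})"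
      "(case case t of (a, b, x, y) \<Rightarrow> (a * x, a, b) of (m, a, b) \<Rightarrow> (a, b, m div a, (n - m) div b)) = t"
      by (simp_all add: Suc_le_eq)
  qed
  finally show ?thesis .
qed

text \<open>Liouville's elementary method. The shears move the sums of \<open>f (a + b)\<close> and
  \<open>f (a - b)\<close> to sums of \<open>f a\<close> over half regions, which cancel up to the
  diagonals \<open>a = b\<close> and \<open>x = y\<close>. Evenness makes \<open>f (a - b)\<close>
  symmetric, and \<open>f 0 = 0\<close> kills its diagonal.\<close>

lemma liouville_convolution:
  fixes f :: "real \<Rightarrow> real"
  assumes "n \<ge> 1" and even: "\<And>u. f (- u) = f u" and f0: "f 0 = 0"
  shows "quad_sum n (\<lambda>a b x y. f (real a + real b) - f (real a - real b)) =
    (\<Sum>d | d dvd n. 2 * (\<Sum>a\<in>{1..<d}. f (real a)) + (real d + 1) * f (real d)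
        - 2 * real n / real d * f (real d))"
proof -
  let ?x_lt_y = "\<lambda>g. quad_sum n (\<lambda>a b x y. if x < y then g a b else 0)"
  let ?x_eq_y = "\<lambda>g. quad_sum n (\<lambda>a b x y. if x = y then g a b else 0)"
  let ?a_gt_b = "\<lambda>g. quad_sum n (\<lambda>a b x y. if b < a then g a b else 0)"
  let ?a_eq_b = "\<lambda>g. quad_sum n (\<lambda>a b x y. if a = b then g a b else 0)"
  have sym: "f (real a - real b) = f (real b - real a)" for a b :: nat
    using even[of "real b - real a"] by simp
  have "quad_sum n (\<lambda>a b x y. f (real a + real b) - f (real a - real b)) =
      quad_sum n (\<lambda>a b x y. f (real a + real b)) - quad_sum n (\<lambda>a b x y. f (real a - real b))"
    by (simp add: quad_sum_def case_prod_beta sum_subtractf)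
  moreover have "quad_sum n (\<lambda>a b x y. f (real a - real b)) = 2 * ?x_lt_y (\<lambda>a b. f (real a))"
  proof -
    have "?a_gt_b (\<lambda>a b. f (real a - real b)) = ?x_lt_y (\<lambda>a b. f (real a))"
      by (subst quad_sum_shear) (simp cong: if_cong)
    moreover have "?a_eq_b (\<lambda>a b. f (real a - real b)) = quad_sum n (\<lambda>_ _ _ _. 0)"
      by (rule quad_sum_cong) (simp add: f0)
    then have "?a_eq_b (\<lambda>a b. f (real a - real b)) = 0"
      by (simp add: quad_sum_def case_prod_beta)
    ultimately show ?thesis
      using quad_sum_symmetric_ab[of "\<lambda>a b. f (real a - real b)" n] sym by simp
  qed
  moreover have "quad_sum n (\<lambda>a b x y. f (real a + real b)) =
      2 * ?a_gt_b (\<lambda>a b. f (real a)) + ?x_eq_y (\<lambda>a b. f (real a + real b))"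
  proof -
    have "?a_gt_b (\<lambda>a b. f (real a)) = ?x_lt_y (\<lambda>a b. f (real a + real b))"
      by (subst quad_sum_shear) (simp only: of_nat_add)
    then show ?thesis
      using quad_sum_symmetric_xy[of "\<lambda>a b. f (real a + real b)" n] by (simp add: add.commute)
  qed
  \<comment> \<open>Both trichotomies decompose the same sum, and by \<open>quad_sum_shear2\<close>
    the regions \<open>a < b\<close> and \<open>y < x\<close> contribute equally.\<close>
  moreover have "?a_gt_b (\<lambda>a b. f (real a)) - ?x_lt_y (\<lambda>a b. f (real a)) =
      ?x_eq_y (\<lambda>a b. f (real a)) - ?a_eq_b (\<lambda>a b. f (real a))"
    using quad_sum_trichotomy_ab[of n "\<lambda>a b x y. f (real a)"] quad_sum_shear2[of n "\<lambda>a. f (real a)"]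
      quad_sum_trichotomy_xy[of n "\<lambda>a b x y. f (real a)"] by simp
  ultimately have "quad_sum n (\<lambda>a b x y. f (real a + real b) - f (real a - real b)) =
      2 * ?x_eq_y (\<lambda>a b. f (real a)) - 2 * ?a_eq_b (\<lambda>a b. f (real a)) + ?x_eq_y (\<lambda>a b. f (real a + real b))"
    by simp
  also have "?a_eq_b (\<lambda>a b. f (real a)) = (\<Sum>d | d dvd n. (real n / real d - 1) * f (real d))"
    by (rule quad_sum_diag_ab[OF assms(1)])
  also have "?x_eq_y (\<lambda>a b. f (real a)) = (\<Sum>d | d dvd n. \<Sum>a\<in>{1..<d}. f (real a))"
    by (rule quad_sum_diag_xy[OF assms(1)])
  also have "?x_eq_y (\<lambda>a b. f (real a + real b)) = (\<Sum>d | d dvd n. (real d - 1) * f (real d))"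
  proof -
    have *: "(\<Sum>a\<in>{1..<d}. f (real a + real (d - a))) = (real d - 1) * f (real d)" if "d dvd n" for d
    proof -
      have "d \<ge> 1" using that assms(1) by (auto elim!: dvdE simp: Suc_le_eq)
      moreover have "(\<Sum>a\<in>{1..<d}. f (real a + real (d - a))) = (\<Sum>a\<in>{1..<d}. f (real d))"
        by (intro sum.cong) (auto simp: of_nat_diff)
      ultimately show ?thesis by (simp add: of_nat_diff)
    qed
    show ?thesis unfolding quad_sum_diag_xy[OF assms(1)] by (intro sum.cong refl) (rule *, simp)
  qed
  finally show ?thesis
    by (simp add: sum_distrib_left sum_subtractf[symmetric] sum.distrib[symmetric] algebra_simps)
qed

lemma sum_lessThan_Suc_1: "(\<Sum>a\<in>{1..<Suc d}. f a) = (\<Sum>a\<in>{1..<d}. f a) + (if d = 0 then 0 else f d)"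
  for f :: "nat \<Rightarrow> real"
  by (cases d) auto

text \<open>Faulhaber's formulas, doubled. In the cases of even exponent, adding that power of
  \<open>d\<close> cancels the only even power and leaves an odd polynomial, the shape that
  \<open>sigma_gf_convolution\<close> expects. The cubes serve
  \<open>sigma_gf_3_square\<close>.\<close>

lemma sum_powers:
  "2 * (\<Sum>a\<in>{1..<d}. real a ^ 2) = 2/3 * real d ^ 3 - real d ^ 2 + 1/3 * real d"
  "2 * (\<Sum>a\<in>{1..<d}. real a ^ 3) = 1/2 * real d ^ 4 - real d ^ 3 + 1/2 * real d ^ 2"
  "2 * (\<Sum>a\<in>{1..<d}. real a ^ 4) = 2/5 * real d ^ 5 - real d ^ 4 + 2/3 * real d ^ 3 - 1/15 * real d"
  "2 * (\<Sum>a\<in>{1..<d}. real a ^ 6) = 2/7 * real d ^ 7 - real d ^ 6 + real d ^ 5 - 1/3 * real d ^ 3 + 1/21 * real d"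
  "2 * (\<Sum>a\<in>{1..<d}. real a ^ 8) = 2/9 * real d ^ 9 - real d ^ 8 + 4/3 * real d ^ 7 - 14/15 * real d ^ 5
     + 4/9 * real d ^ 3 - 1/15 * real d"
  "2 * (\<Sum>a\<in>{1..<d}. real a ^ 10) = 2/11 * real d ^ 11 - real d ^ 10 + 5/3 * real d ^ 9 - 2 * real d ^ 7
     + 2 * real d ^ 5 - real d ^ 3 + 5/33 * real d"
  "2 * (\<Sum>a\<in>{1..<d}. real a ^ 12) = 2/13 * real d ^ 13 - real d ^ 12 + 2 * real d ^ 11 - 11/3 * real d ^ 9
     + 44/7 * real d ^ 7 - 33/5 * real d ^ 5 + 10/3 * real d ^ 3 - 691/1365 * real d"
  by (induction d; simp add: sum_lessThan_Suc_1 del: sum.op_ivl_Suc; simp add: field_simps eval_nat_numeral)+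

text \<open>Liouville's identity for \<open>f u = u^(2 k)\<close>. The difference
  \<open>f (a + b) - f (a - b)\<close> retains the odd powers of \<open>a\<close> and
  \<open>b\<close>; the term with \<open>n / d\<close> becomes the derivative of
  \<open>sigma_gf (2 * k - 1)\<close>.\<close>

lemma sigma_gf_convolution:
  fixes k :: nat
  assumes "k \<ge> 1"
    and P: "\<And>d. 2 * (\<Sum>a\<in>{1..<d}. real a ^ (2 * k)) + real d ^ (2 * k) = (\<Sum>i\<le>k. c i * real d ^ (2 * i + 1))"
  shows "2 * (\<Sum>i<k. of_nat (2 * k choose (2 * i + 1)) * sigma_gf (2 * i + 1) * sigma_gf (2 * k - (2 * i + 1))) =
    sigma_gf (2 * k + 1) + (\<Sum>i\<le>k. fps_const (c i) * sigma_gf (2 * i + 1)) - 2 * fps_XD (sigma_gf (2 * k - 1))"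
    (is "?L = ?R")
proof (rule fps_ext)
  fix n
  show "?L $ n = ?R $ n"
  proof (cases "n = 0")
    case True
    then show ?thesis by (simp add: fps_sum_nth fps_XD_def)
  next
    case False
    then have n: "n \<ge> 1" by simp
    have binom: "2 * (\<Sum>i<k. real (2 * k choose (2 * i + 1)) * (u ^ (2 * i + 1) * v ^ (2 * k - (2 * i + 1)))) =
        (u + v) ^ (2 * k) - (u - v) ^ (2 * k)" for u v :: real
    proof -
      have "(u + v) ^ (2 * k) - (- v + u) ^ (2 * k) =
          (\<Sum>j\<le>2 * k. real (2 * k choose j) * (u ^ j * (v ^ (2 * k - j) - (- v) ^ (2 * k - j))))"
        by (subst add.commute[of "- v" u], simp only: binomial_ring sum_subtractf[symmetric])
           (simp add: algebra_simps)
      also have "\<dots> = (\<Sum>j\<in>(\<lambda>i. 2 * i + 1) ` {..<k}.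
          real (2 * k choose j) * (u ^ j * (v ^ (2 * k - j) - (- v) ^ (2 * k - j))))"
      proof (intro sum.mono_neutral_right ballI)
        fix j assume j: "j \<in> {..2 * k} - (\<lambda>i. 2 * i + 1) ` {..<k}"
        have "even j"
        proof (rule ccontr)
          assume "odd j"
          then obtain i where "j = 2 * i + 1" by (rule oddE)
          with j show False by auto
        qed
        then show "real (2 * k choose j) * (u ^ j * (v ^ (2 * k - j) - (- v) ^ (2 * k - j))) = 0"
          by simp
      qed auto
      also have "\<dots> = (\<Sum>i<k. real (2 * k choose (2 * i + 1)) * (u ^ (2 * i + 1) * (2 * v ^ (2 * k - (2 * i + 1)))))"
      proof (subst sum.reindex, simp add: inj_on_def, intro sum.cong refl)
        fix i assume "i \<in> {..<k}"
        then have "odd (2 * k - (2 * i + 1))" by auto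
        then show "((\<lambda>j. real (2 * k choose j) * (u ^ j * (v ^ (2 * k - j) - (- v) ^ (2 * k - j)))) \<circ> (\<lambda>i. 2 * i + 1)) i =
            real (2 * k choose (2 * i + 1)) * (u ^ (2 * i + 1) * (2 * v ^ (2 * k - (2 * i + 1))))"
          by (simp only: o_def power_minus_odd) simp
      qed
      finally show ?thesis by (simp add: sum_distrib_left mult_ac)
    qed
    have "?L $ n = 2 * (\<Sum>i<k. real (2 * k choose (2 * i + 1)) *
        quad_sum n (\<lambda>a b x y. real a ^ (2 * i + 1) * real b ^ (2 * k - (2 * i + 1))))"
      by (simp only: sigma_gf_mult_nth[symmetric] mult.assoc of_nat_mult_fps_nth numeral_mult_fps_nth fps_sum_nth)
    also have "\<dots> = quad_sum n (\<lambda>a b x y. 2 * (\<Sum>i<k. real (2 * k choose (2 * i + 1)) *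
        (real a ^ (2 * i + 1) * real b ^ (2 * k - (2 * i + 1)))))"
      unfolding quad_sum_def case_prod_beta sum_distrib_left by (subst sum.swap) simp
    also have "\<dots> = quad_sum n (\<lambda>a b x y. (real a + real b) ^ (2 * k) - (real a - real b) ^ (2 * k))"
      by (simp only: binom)
    also have "\<dots> = (\<Sum>d | d dvd n. 2 * (\<Sum>a\<in>{1..<d}. real a ^ (2 * k)) + (real d + 1) * real d ^ (2 * k)
        - 2 * real n / real d * real d ^ (2 * k))"
      using assms(1) by (intro liouville_convolution[OF n]) auto
    also have "\<dots> = (\<Sum>d | d dvd n. real d ^ (2 * k + 1) + (\<Sum>i\<le>k. c i * real d ^ (2 * i + 1))
        - 2 * real n * real d ^ (2 * k - 1))"
    proof (intro sum.cong refl)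
      fix d assume "d \<in> {d. d dvd n}"
      then have "d \<noteq> 0" using n by (auto elim!: dvdE)
      then have "real d ^ (2 * k) = real d * real d ^ (2 * k - 1)"
        using assms(1) by (simp add: power_eq_if)
      with \<open>d \<noteq> 0\<close> have "2 * real n / real d * real d ^ (2 * k) = 2 * real n * real d ^ (2 * k - 1)"
        by simp
      then show "2 * (\<Sum>a\<in>{1..<d}. real a ^ (2 * k)) + (real d + 1) * real d ^ (2 * k)
          - 2 * real n / real d * real d ^ (2 * k) =
        real d ^ (2 * k + 1) + (\<Sum>i\<le>k. c i * real d ^ (2 * i + 1)) - 2 * real n * real d ^ (2 * k - 1)"
        using P[of d] by (simp add: algebra_simps)
    qed
    also have "\<dots> = ?R $ n"
      using n by (simp add: sigma_gf_nth fps_sum_nth sum.distrib sum_subtractf sum_distrib_left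
          sum.swap[of _ "{d. d dvd n}"] numeral_mult_fps_nth mult.assoc)
    finally show ?thesis .
  qed
qed

text \<open>This is \<open>E_4^2 = E_8\<close>. Liouville's identity with exponent 6 mixes the
  square with \<open>sigma_gf 1 * sigma_gf 5\<close>, so a different function is sheared:
  \<open>k(a, b) = (a b (a - b))^2\<close> is symmetric, vanishes for \<open>a = b\<close> and
  satisfies \<open>k(a + b, b) - k(a, b) = 4 a^3 b^3\<close>.\<close>

lemma sigma_gf_3_square: "120 * (sigma_gf 3 * sigma_gf 3) = sigma_gf 7 - sigma_gf 3"
proof (rule fps_ext)
  fix n
  show "(120 * (sigma_gf 3 * sigma_gf 3)) $ n = (sigma_gf 7 - sigma_gf 3) $ n"
  proof (cases "n = 0")
    case False
    then have n: "n \<ge> 1" by simp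
    let ?k = "\<lambda>a b :: nat. (real a * real b * (real a - real b)) ^ 2"
    let ?m = "\<lambda>a b :: nat. real a ^ 3 * real b ^ 3"
    let ?x_lt_y = "\<lambda>g. quad_sum n (\<lambda>a b x y. if x < y then g a b else 0)"
    let ?x_eq_y = "\<lambda>g. quad_sum n (\<lambda>a b x y. if x = y then g a b else 0)"
    have k: "?k a b = ?k b a" "?m a b = ?m b a" for a b by algebra+
    have "quad_sum n (\<lambda>a b x y. if a = b then ?k a b else 0) = quad_sum n (\<lambda>_ _ _ _. 0)"
      by (rule quad_sum_cong) simp
    then have "quad_sum n (\<lambda>a b x y. ?k a b) = 2 * quad_sum n (\<lambda>a b x y. if b < a then ?k a b else 0)"
      using quad_sum_symmetric_ab[of ?k n, OF k(1)] by (simp add: quad_sum_def case_prod_beta)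
    also have "quad_sum n (\<lambda>a b x y. if b < a then ?k a b else 0) = ?x_lt_y (\<lambda>a b. ?k a b + 4 * ?m a b)"
      by (subst quad_sum_shear, rule quad_sum_cong) (simp add: algebra_simps power2_eq_square power3_eq_cube)
    also have "\<dots> = ?x_lt_y ?k + 4 * ?x_lt_y ?m"
      by (simp only: quad_sum_add[symmetric] quad_sum_cmult[symmetric]) (rule quad_sum_cong, simp)
    finally have "8 * ?x_lt_y ?m = ?x_eq_y ?k"
      using quad_sum_symmetric_xy[of ?k n, OF k(1)] by simp
    then have "4 * quad_sum n (\<lambda>a b x y. ?m a b) = ?x_eq_y ?k + 4 * ?x_eq_y ?m"
      using quad_sum_symmetric_xy[of ?m n, OF k(2)] by simp
    also have "\<dots> = ?x_eq_y (\<lambda>a b. ?k a b + 4 * ?m a b)"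
      by (simp only: quad_sum_add[symmetric] quad_sum_cmult[symmetric]) (rule quad_sum_cong, simp)
    also have "\<dots> = (\<Sum>d | d dvd n. \<Sum>a\<in>{1..<d}. ?k a (d - a) + 4 * ?m a (d - a))"
      by (rule quad_sum_diag_xy[OF n])
    also have "\<dots> = (\<Sum>d | d dvd n. (real d ^ 7 - real d ^ 3) / 30)"
    proof (intro sum.cong refl)
      fix d
      \<comment> \<open>On the diagonal \<open>k(a, b) + 4 a^3 b^3 = (a b (a + b))^2\<close> with
        \<open>a + b = d\<close>.\<close>
      have "(\<Sum>a\<in>{1..<d}. ?k a (d - a) + 4 * ?m a (d - a)) =
          (\<Sum>a\<in>{1..<d}. real d ^ 4 * real a ^ 2 - 2 * real d ^ 3 * real a ^ 3 + real d ^ 2 * real a ^ 4)"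
        by (intro sum.cong) (auto simp: of_nat_diff algebra_simps eval_nat_numeral)
      also have "\<dots> = real d ^ 4 * (\<Sum>a\<in>{1..<d}. real a ^ 2) - 2 * real d ^ 3 * (\<Sum>a\<in>{1..<d}. real a ^ 3)
          + real d ^ 2 * (\<Sum>a\<in>{1..<d}. real a ^ 4)"
        by (simp only: sum.distrib sum_subtractf sum_distrib_left)
      also have "\<dots> = (real d ^ 7 - real d ^ 3) / 30"
        using sum_powers(1,2,3)[of d] by (simp add: eval_nat_numeral field_simps) algebra
      finally show "(\<Sum>a\<in>{1..<d}. ?k a (d - a) + 4 * ?m a (d - a)) = (real d ^ 7 - real d ^ 3) / 30" .
    qed
    finally have "120 * quad_sum n (\<lambda>a b x y. ?m a b) = (\<Sum>d | d dvd n. real d ^ 7 - real d ^ 3)"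
      by (simp add: sum_divide_distrib[symmetric])
    then show ?thesis
      using n by (simp only: numeral_mult_fps_nth sigma_gf_mult_nth)
        (simp add: sigma_gf_nth sum_subtractf)
  qed (simp add: numeral_mult_fps_nth)
qed

section \<open>Moments\<close>

lemma fps_XD_mult: "fps_XD (f * g) = fps_XD f * g + f * fps_XD (g :: 'a::comm_ring_1 fps)"
  by (simp add: fps_XD_def algebra_simps)

lemma pderiv_sum: "pderiv (\<Sum>x\<in>A. f x) = (\<Sum>x\<in>A. pderiv (f x :: 'a::idom poly))"
  by (induction A rule: infinite_finite_induct) (simp_all add: pderiv_add)

text \<open>Since \<open>x^a X^n\<close> is \<open>z^(a - n) q^n\<close>, the derivation
  \<open>z d/dz\<close> is \<open>x d/dx\<close> minus \<open>n\<close>. The exponent of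
  \<open>X\<close> is that of \<open>q\<close>, so \<open>fps_XD\<close> is \<open>q d/dq\<close>
  with \<open>z\<close> kept fixed.\<close>

definition z_deriv :: "real poly fps \<Rightarrow> real poly fps" where
  "z_deriv f = Abs_fps (\<lambda>n. monom 1 1 * pderiv (f $ n) - of_nat n * f $ n)"

lemma z_deriv_nth: "z_deriv f $ n = monom 1 1 * pderiv (f $ n) - of_nat n * f $ n"
  by (simp add: z_deriv_def)

lemma z_deriv_add: "z_deriv (f + g) = z_deriv f + z_deriv g"
  by (rule fps_ext) (simp add: z_deriv_nth pderiv_add algebra_simps)

lemma z_deriv_diff: "z_deriv (f - g) = z_deriv f - z_deriv g"
  by (rule fps_ext) (simp add: z_deriv_nth pderiv_diff algebra_simps)

lemma z_deriv_mult: "z_deriv (f * g) = z_deriv f * g + f * z_deriv g"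
proof (rule fps_ext)
  fix n
  have "z_deriv (f * g) $ n = (\<Sum>i = 0..n. monom 1 1 * pderiv (f $ i * g $ (n - i))
      - of_nat n * (f $ i * g $ (n - i)))"
    by (simp add: z_deriv_nth fps_mult_nth pderiv_sum sum_distrib_left sum_subtractf)
  also have "\<dots> = (\<Sum>i = 0..n. z_deriv f $ i * g $ (n - i) + f $ i * z_deriv g $ (n - i))"
  proof (intro sum.cong refl)
    fix i assume "i \<in> {0..n}"
    then have "(of_nat n :: real poly) = of_nat i + of_nat (n - i)"
      by (simp flip: of_nat_add)
    then show "monom 1 1 * pderiv (f $ i * g $ (n - i)) - of_nat n * (f $ i * g $ (n - i)) =
        z_deriv f $ i * g $ (n - i) + f $ i * z_deriv g $ (n - i)"
      by (simp add: z_deriv_nth pderiv_mult algebra_simps)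
  qed
  also have "\<dots> = (z_deriv f * g + f * z_deriv g) $ n"
    by (simp add: fps_mult_nth sum.distrib)
  finally show "z_deriv (f * g) $ n = (z_deriv f * g + f * z_deriv g) $ n" .
qed

lemma z_deriv_const_X: "z_deriv (fps_const (monom c a) * fps_X ^ n) =
    fps_const (of_int (int a - int n)) * (fps_const (monom c a) * fps_X ^ n)"
proof (rule fps_ext)
  fix k
  have "monom 1 1 * pderiv (monom c a) = of_nat a * monom c a"
    by (cases a) (simp_all add: pderiv_monom mult_monom of_nat_poly smult_monom)
  then show "z_deriv (fps_const (monom c a) * fps_X ^ n) $ k =
      (fps_const (of_int (int a - int n)) * (fps_const (monom c a) * fps_X ^ n)) $ k"
    by (simp add: z_deriv_nth fps_X_power_nth algebra_simps)
qed

lemma z_deriv_z [simp]: "z_deriv z_fps = z_fps"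
  using z_deriv_const_X[of 1 1 0] by (simp add: z_fps_def)

lemma z_deriv_X [simp]: "z_deriv fps_X = - fps_X"
  using z_deriv_const_X[of 1 0 1] by (simp add: monom_0 flip: one_pCons fps_const_neg)

lemma z_deriv_numeral [simp]: "z_deriv (numeral k) = 0" "z_deriv 1 = 0"
  by (rule fps_ext, simp add: z_deriv_nth numeral_fps_const numeral_poly pderiv_pCons)+

lemma z_deriv_q [simp]: "z_deriv q_fps = 0"
  by (simp add: q_fps_def z_deriv_mult)

lemma z_deriv_XD: "z_deriv (fps_XD f) = fps_XD (z_deriv f)"
  by (rule fps_ext) (simp add: z_deriv_nth pderiv_mult algebra_simps)

definition at_1 :: "real poly fps \<Rightarrow> real fps" where
  "at_1 f = Abs_fps (\<lambda>n. poly (f $ n) 1)"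

lemma at_1_nth: "at_1 f $ n = poly (f $ n) 1"
  by (simp add: at_1_def)

lemma at_1_add [simp]: "at_1 (f + g) = at_1 f + at_1 g"
  by (rule fps_ext) (simp add: at_1_nth)

lemma at_1_diff [simp]: "at_1 (f - g) = at_1 f - at_1 g"
  by (rule fps_ext) (simp add: at_1_nth)

lemma at_1_mult [simp]: "at_1 (f * g) = at_1 f * at_1 g"
  by (rule fps_ext) (simp add: at_1_nth fps_mult_nth poly_sum)

lemma at_1_1 [simp]: "at_1 1 = 1"
  by (rule fps_ext) (simp add: at_1_nth)

lemma at_1_0 [simp]: "at_1 0 = 0"
  by (rule fps_ext) (simp add: at_1_nth)

lemma at_1_numeral [simp]: "at_1 (numeral k) = numeral k"
  by (rule fps_ext) (simp add: at_1_nth numeral_fps_const)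

lemma at_1_power [simp]: "at_1 (f ^ k) = at_1 f ^ k"
  by (induction k) simp_all

lemma at_1_z [simp]: "at_1 z_fps = 1"
  by (rule fps_ext) (simp add: at_1_nth z_fps_def poly_monom)

lemma at_1_X [simp]: "at_1 fps_X = fps_X"
  by (rule fps_ext) (simp add: at_1_nth fps_X_def)

lemma at_1_q [simp]: "at_1 q_fps = fps_X"
  by (simp add: q_fps_def)

lemma at_1_XD: "at_1 (fps_XD f) = fps_XD (at_1 f)"
  by (rule fps_ext) (simp add: at_1_nth)

definition moment :: "nat \<Rightarrow> real poly fps \<Rightarrow> real fps" where
  "moment j f = at_1 ((z_deriv ^^ j) f)"

lemma moment_0: "moment 0 f = at_1 f"
  by (simp add: moment_def)

lemma moment_Suc: "moment (Suc j) f = moment j (z_deriv f)"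
  by (simp add: moment_def funpow_swap1)

lemma moment_add: "moment j (f + g) = moment j f + moment j g"
  by (induction j arbitrary: f g) (simp_all add: moment_0 moment_Suc z_deriv_add)

lemma moment_diff: "moment j (f - g) = moment j f - moment j g"
  by (induction j arbitrary: f g) (simp_all add: moment_0 moment_Suc z_deriv_diff)

lemma moment_XD: "moment j (fps_XD f) = fps_XD (moment j f)"
  by (induction j arbitrary: f) (simp_all add: moment_0 moment_Suc z_deriv_XD at_1_XD)

text \<open>Leibniz' rule for the iterated derivation, carried through the multiplicative map
  \<open>at_1\<close>.\<close>

lemma moment_mult:
  "moment j (f * g) = (\<Sum>i\<le>j. of_nat (j choose i) * moment i f * moment (j - i) g)"
proof (induction j arbitrary: f g)
  case 0
  then show ?case by (simp add: moment_0)
next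
  case (Suc j)
  let ?c = "\<lambda>i. of_nat (Suc j choose i) * moment i f * moment (Suc j - i) g"
  have "moment (Suc j) (f * g) =
      (\<Sum>i\<le>j. of_nat (j choose i) * moment (Suc i) f * moment (j - i) g) +
      (\<Sum>i\<le>j. of_nat (j choose i) * moment i f * moment (Suc j - i) g)"
    by (simp add: moment_Suc z_deriv_mult moment_add Suc.IH Suc_diff_le)
  also have "(\<Sum>i\<le>j. of_nat (j choose i) * moment i f * moment (Suc j - i) g) =
      moment 0 f * moment (Suc j) g +
      (\<Sum>i\<le>j. of_nat (j choose Suc i) * moment (Suc i) f * moment (j - i) g)"
  proof -
    have "(\<Sum>i\<le>j. of_nat (j choose i) * moment i f * moment (Suc j - i) g) =
        (\<Sum>i\<le>Suc j. of_nat (j choose i) * moment i f * moment (Suc j - i) g)"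
      by (simp add: binomial_eq_0)
    also have "\<dots> = moment 0 f * moment (Suc j) g +
        (\<Sum>i\<le>j. of_nat (j choose Suc i) * moment (Suc i) f * moment (j - i) g)"
      by (subst sum.atMost_Suc_shift) simp
    finally show ?thesis .
  qed
  also have "(\<Sum>i\<le>j. of_nat (j choose i) * moment (Suc i) f * moment (j - i) g) +
      (moment 0 f * moment (Suc j) g +
      (\<Sum>i\<le>j. of_nat (j choose Suc i) * moment (Suc i) f * moment (j - i) g)) =
      moment 0 f * moment (Suc j) g + (\<Sum>i\<le>j. ?c (Suc i))"
    by (simp add: algebra_simps sum.distrib)
  also have "\<dots> = (\<Sum>i\<le>Suc j. ?c i)"
    by (subst sum.atMost_Suc_shift) simp
  finally show ?case .
qed

lemma z_deriv_laurent_gf: "z_deriv (laurent_gf c) = laurent_gf (\<lambda>m n. m * c m n)"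
proof (rule fps_ext)
  fix n
  have "monom 1 1 * pderiv (monom (of_int (c m n)) (nat (int n + m))) -
      of_nat n * monom (of_int (c m n)) (nat (int n + m)) =
      monom (of_int (m * c m n) :: real) (nat (int n + m))" if "m \<in> {- int n..int n}" for m
  proof -
    define a where "a = nat (int n + m)"
    have m: "m = int a - int n" using that by (simp add: a_def)
    have "monom 1 1 * pderiv (monom (of_int (c m n) :: real) a) = of_nat a * monom (of_int (c m n)) a"
      by (cases a) (simp_all add: pderiv_monom mult_monom of_nat_poly smult_monom)
    then show ?thesis
      unfolding a_def[symmetric] by (simp add: of_nat_poly smult_monom diff_monom m algebra_simps)
  qed
  then show "z_deriv (laurent_gf c) $ n = laurent_gf (\<lambda>m n. m * c m n) $ n"
    by (simp add: z_deriv_nth laurent_gf_def pderiv_sum sum_distrib_left sum_subtractf[symmetric])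
qed

lemma moment_laurent_gf_nth:
  "moment j (laurent_gf c) $ n = of_int (\<Sum>m\<in>{- int n..int n}. m ^ j * c m n)"
proof (induction j arbitrary: c)
  case 0
  then show ?case by (simp add: moment_0 at_1_nth laurent_gf_def poly_sum poly_monom)
next
  case (Suc j)
  then show ?case by (simp add: moment_Suc z_deriv_laurent_gf mult_ac)
qed

lemma rank_count_nonzero:
  assumes "rank_count m n \<noteq> 0"
  shows "m \<in> {- int n..int n}"
proof (cases "n \<le> 1")
  case True
  then have "n = 0 \<or> n = 1" by linarith
  with assms show ?thesis
    by (auto simp: rank_count_def partitions_of_1[unfolded One_nat_def] part_rank_def split: if_splits)
next
  case False
  with assms have "{p \<in> partitions_of n. part_rank p = m} \<noteq> {}"
    by (auto simp: rank_count_def simp del: Collect_empty_eq)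
  with False show ?thesis using part_rank_bounds[of _ n] by force
qed

lemma crank_count_nonzero:
  assumes "crank_count m n \<noteq> 0"
  shows "m \<in> {- int n..int n}"
proof (cases "n \<le> 1")
  case True
  then have "n = 0 \<or> n = 1" by linarith
  with assms show ?thesis
    by (auto simp: crank_count_def partitions_of_1[unfolded One_nat_def] split: if_splits)
next
  case False
  with assms have "{p \<in> partitions_of n. part_crank p = m} \<noteq> {}"
    by (auto simp: crank_count_def simp del: Collect_empty_eq)
  with False show ?thesis using part_crank_bounds[of _ n] by force
qed

lemma moment_rank_gf_nth: "moment j rank_gf $ n = of_int (rank_moment j n)"
proof -
  have "rank_moment j n = (\<Sum>m\<in>{- int n..int n}. m ^ j * rank_count m n)"
    unfolding rank_moment_def by (intro Sum_any.expand_superset) (auto dest: rank_count_nonzero)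
  then show ?thesis by (simp add: rank_gf_def moment_laurent_gf_nth)
qed

lemma moment_crank_gf_nth: "moment j crank_gf $ n = of_int (crank_moment j n)"
proof -
  have "crank_moment j n = (\<Sum>m\<in>{- int n..int n}. m ^ j * crank_count m n)"
    unfolding crank_moment_def by (intro Sum_any.expand_superset) (auto dest: crank_count_nonzero)
  then show ?thesis by (simp add: crank_gf_def moment_laurent_gf_nth)
qed

section \<open>Moments of the crank from logarithmic derivatives\<close>

definition partition_gf :: "real fps" where
  "partition_gf = part_gf (\<lambda>_. 1)"

lemma partition_gf_nth: "partition_gf $ n = real (card (partitions_of n))"
  by (simp add: partition_gf_def part_gf_nth)

lemma partition_gf_nonzero: "partition_gf \<noteq> 0"
proof
  assume "partition_gf = 0"
  then have "partition_gf $ 0 = 0" by simp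
  then show False by (simp add: partition_gf_def)
qed

lemma at_1_part_gf_monom: "at_1 (part_gf (\<lambda>k. monom 1 (f k))) = partition_gf"
  by (rule fps_ext) (simp add: at_1_nth part_gf_nth prod_mset_monom poly_sum poly_monom partition_gf_def)

lemma at_1_gf [simp]: "at_1 gf_q = partition_gf" "at_1 gf_zq = partition_gf" "at_1 gf_qz = partition_gf"
  unfolding gf_q_def gf_zq_def gf_qz_def by (rule at_1_part_gf_monom)+

text \<open>The derivation \<open>q d/dq\<close> multiplies a partition of \<open>n\<close> by
  \<open>n\<close>, the sum of its parts; this is \<open>part_gf_log_deriv\<close> with each part
  counted by its size.\<close>

lemma fps_XD_partition_gf: "fps_XD partition_gf = sigma_gf 1 * partition_gf"
proof (rule fps_ext)
  fix n
  have "(\<Sum>p\<in>partitions_of n. (\<Sum>k\<in>#p. real k) * (\<Prod>k\<in>#p. 1)) = (\<Sum>p\<in>partitions_of n. real n)"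
    by (intro sum.cong) (auto simp: partitions_of_def of_nat_sum_mset[symmetric] simp del: of_nat_sum_mset)
  then have "real n * partition_gf $ n =
      (\<Sum>m\<in>{1..n}. (\<Sum>j | j dvd m. real j * 1 ^ (m div j)) * partition_gf $ (n - m))"
    using part_gf_log_deriv[of real "\<lambda>_. 1" n] by (simp add: partition_gf_def[symmetric] partition_gf_nth mult.commute)
  also have "\<dots> = (\<Sum>m\<in>{1..n}. sigma_gf 1 $ m * partition_gf $ (n - m))"
    by (intro sum.cong) (auto simp: sigma_gf_nth)
  also have "\<dots> = (\<Sum>m = 0..n. sigma_gf 1 $ m * partition_gf $ (n - m))"
    by (intro sum.mono_neutral_left) (auto simp: Suc_le_eq)
  finally show "fps_XD partition_gf $ n = (sigma_gf 1 * partition_gf) $ n"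
    by (simp add: fps_mult_nth)
qed

text \<open>The logarithmic \<open>z\<close>-derivative of \<open>gf_zq * gf_qz\<close>.\<close>

definition zq_log :: "real poly fps" where
  "zq_log = Abs_fps (\<lambda>n. if n = 0 then 0 else \<Sum>d | d dvd n. monom 1 (n + d))"

definition qz_log :: "real poly fps" where
  "qz_log = Abs_fps (\<lambda>n. if n = 0 then 0 else \<Sum>d | d dvd n. monom (- 1) (n - d))"

lemma sum_divisors_flip:
  assumes "n \<ge> (1::nat)"
  shows "(\<Sum>d | d dvd n. f d (n div d)) = (\<Sum>d | d dvd n. f (n div d) d)"
  using assms
  by (intro sum.reindex_bij_witness[where i = "\<lambda>d. n div d" and j = "\<lambda>d. n div d"])
     (auto elim!: dvdE)

lemma monom_times_pderiv: "monom 1 1 * pderiv (monom c a) = of_nat a * monom (c::real) a"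
  by (cases a) (simp_all add: pderiv_monom mult_monom of_nat_poly smult_monom)

text \<open>When \<open>f k = k + c\<close>, the part \<open>k\<close> carries
  \<open>z^c q^k\<close>, so the derivation counts each part with \<open>c\<close>. The three series
  used have \<open>c\<close> equal to 0, 1 and -1.\<close>

lemma z_deriv_part_gf:
  assumes "\<And>k. k \<ge> 1 \<Longrightarrow> (of_nat (f k) :: real poly) = of_nat k + c"
  shows "z_deriv (part_gf (\<lambda>k. monom 1 (f k))) = part_gf (\<lambda>k. monom 1 (f k)) *
    Abs_fps (\<lambda>n. if n = 0 then 0 else \<Sum>d | d dvd n. c * monom 1 (f (n div d) * d))"
    (is "_ = ?G * ?L")
proof (rule fps_ext)
  fix n
  have "z_deriv ?G $ n = (\<Sum>p\<in>partitions_of n. (\<Sum>k\<in>#p. c) * (\<Prod>k\<in>#p. monom 1 (f k)))"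
  proof -
    have "monom 1 1 * pderiv (monom 1 (\<Sum>k\<in>#p. f k)) - of_nat n * monom (1::real) (\<Sum>k\<in>#p. f k) =
        (\<Sum>k\<in>#p. c) * monom 1 (\<Sum>k\<in>#p. f k)" if "p \<in> partitions_of n" for p
    proof -
      have "of_nat (\<Sum>k\<in>#p. f k) = of_nat (sum_mset p) + (\<Sum>k\<in>#p. c)"
        using partitions_of_le(1)[OF that] assms by (induction p) (auto simp: algebra_simps)
      then have "of_nat (\<Sum>k\<in>#p. f k) = of_nat n + (\<Sum>k\<in>#p. c)"
        using that by (simp only: partitions_of_def mem_Collect_eq)
      then show ?thesis by (simp only: monom_times_pderiv) (simp add: algebra_simps)
    qed
    then show ?thesis
      by (simp add: z_deriv_nth part_gf_nth prod_mset_monom pderiv_sum sum_distrib_left sum_subtractf[symmetric])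
  qed
  also have "\<dots> = (\<Sum>m\<in>{1..n}. (\<Sum>j | j dvd m. c * monom 1 (f j) ^ (m div j)) * ?G $ (n - m))"
    by (rule part_gf_log_deriv)
  also have "\<dots> = (\<Sum>m\<in>{1..n}. ?L $ m * ?G $ (n - m))"
  proof (intro sum.cong refl)
    fix m assume "m \<in> {1..n}"
    then show "(\<Sum>j | j dvd m. c * monom 1 (f j) ^ (m div j)) * ?G $ (n - m) = ?L $ m * ?G $ (n - m)"
      using sum_divisors_flip[of m "\<lambda>j k. c * monom (1::real) (f j * k)"] by (simp add: monom_power)
  qed
  also have "\<dots> = (\<Sum>m = 0..n. ?L $ m * ?G $ (n - m))"
    by (intro sum.mono_neutral_left) auto
  finally show "z_deriv ?G $ n = (?G * ?L) $ n"
    by (simp add: fps_mult_nth mult.commute[of ?G])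
qed

lemma z_deriv_gf_q [simp]: "z_deriv gf_q = 0"
proof -
  have "Abs_fps (\<lambda>n. if n = 0 then 0 else \<Sum>d | d dvd n. 0 * monom (1::real) (n div d * d)) = 0"
    by (rule fps_ext) simp
  with z_deriv_part_gf[of "\<lambda>k. k" 0] show ?thesis by (simp only: gf_q_def) simp
qed

lemma z_deriv_gf_zq: "z_deriv gf_zq = gf_zq * zq_log"
proof -
  have "Abs_fps (\<lambda>n. if n = 0 then 0 else \<Sum>d | d dvd n. 1 * monom (1::real) (Suc (n div d) * d)) = zq_log"
    unfolding zq_log_def by (rule fps_ext) (auto intro!: sum.cong simp: algebra_simps)
  with z_deriv_part_gf[of Suc 1] show ?thesis by (simp add: gf_zq_def add.commute)
qed

lemma z_deriv_gf_qz: "z_deriv gf_qz = gf_qz * qz_log"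
proof -
  have "Abs_fps (\<lambda>n. if n = 0 then 0 else \<Sum>d | d dvd n. - 1 * monom (1::real) ((n div d - 1) * d)) = qz_log"
    unfolding qz_log_def
    by (rule fps_ext) (auto intro!: sum.cong simp: algebra_simps minus_monom diff_mult_distrib)
  moreover have "of_nat (k - 1) = of_nat k + (- 1 :: real poly)" if "k \<ge> 1" for k
    using that by (simp add: of_nat_diff)
  ultimately show ?thesis
    using z_deriv_part_gf[of "\<lambda>k. k - 1" "- 1"] by (simp add: gf_qz_def)
qed

lemma gf_q_nonzero: "gf_q \<noteq> 0"
  using at_1_gf(1) partition_gf_nonzero by (metis at_1_0)

lemma z_deriv_crank_gf: "z_deriv crank_gf = crank_gf * (zq_log + qz_log)"
proof -
  have "z_deriv (crank_gf * gf_q) = z_deriv (gf_zq * gf_qz)"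
    by (simp only: crank_gf_product)
  also have "\<dots> = gf_zq * gf_qz * (zq_log + qz_log)"
    by (simp add: z_deriv_mult z_deriv_gf_zq z_deriv_gf_qz algebra_simps)
  also have "\<dots> = crank_gf * (zq_log + qz_log) * gf_q"
    unfolding crank_gf_product[symmetric] by (simp only: mult_ac)
  finally have "z_deriv crank_gf * gf_q = crank_gf * (zq_log + qz_log) * gf_q"
    by (simp add: z_deriv_mult)
  then show ?thesis using gf_q_nonzero by simp
qed

lemma moment_zq_log_nth: "moment j zq_log $ n = sigma_gf j $ n"
proof -
  have "(z_deriv ^^ j) zq_log $ n = (if n = 0 then 0 else \<Sum>d | d dvd n. monom (real d ^ j) (n + d))"
  proof (induction j)
    case (Suc j)
    have "monom 1 1 * pderiv (monom (real d ^ j) (n + d)) - of_nat n * monom (real d ^ j) (n + d) =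
        monom (real d ^ Suc j) (n + d)" for d
      by (simp only: monom_times_pderiv) (simp add: of_nat_poly smult_monom add_monom algebra_simps)
    then show ?case
      by (simp add: z_deriv_nth Suc.IH pderiv_sum sum_distrib_left sum_subtractf[symmetric])
  qed (simp add: zq_log_def)
  then show ?thesis
    by (simp add: moment_def at_1_nth poly_sum poly_monom sigma_gf_def)
qed

lemma moment_qz_log_nth: "moment j qz_log $ n = - ((- 1) ^ j * sigma_gf j $ n)"
proof -
  have "(z_deriv ^^ j) qz_log $ n = (if n = 0 then 0 else \<Sum>d | d dvd n. monom (- ((- real d) ^ j)) (n - d))"
  proof (induction j)
    case (Suc j)
    have "monom 1 1 * pderiv (monom (- ((- real d) ^ j)) (n - d)) - of_nat n * monom (- ((- real d) ^ j)) (n - d) =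
        monom (- ((- real d) ^ Suc j)) (n - d)" if "d dvd n" "n > 0" for d
      using dvd_imp_le[OF that]
      by (simp only: monom_times_pderiv) (simp add: of_nat_poly smult_monom diff_monom of_nat_diff algebra_simps)
    then show ?case
      by (simp add: z_deriv_nth Suc.IH pderiv_sum sum_distrib_left sum_subtractf[symmetric])
  qed (simp add: qz_log_def)
  then show ?thesis
    by (simp add: moment_def at_1_nth poly_sum poly_monom sigma_gf_def sum_negf power_minus[of "real _"]
        sum_distrib_left)
qed

text \<open>A divisor \<open>d\<close> contributes \<open>d^j\<close> through \<open>zq_log\<close>
  and \<open>- ((- d)^j)\<close> through \<open>qz_log\<close>: even orders cancel and odd orders
  double.\<close>

lemma moment_log: "moment j (zq_log + qz_log) = (if odd j then 2 * sigma_gf j else 0)"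
  by (rule fps_ext) (simp add: moment_add moment_zq_log_nth moment_qz_log_nth)

lemma moment_crank_gf_0: "moment 0 crank_gf = partition_gf"
proof -
  have "at_1 (crank_gf * gf_q) = at_1 (gf_zq * gf_qz)"
    by (simp only: crank_gf_product)
  then show ?thesis using partition_gf_nonzero by (simp add: moment_0)
qed

text \<open>Leibniz' rule for \<open>z_deriv_crank_gf\<close>. By this recursion each crank moment
  is \<open>partition_gf\<close> times a polynomial in the odd divisor series.\<close>

lemma moment_crank_gf_Suc:
  "moment (Suc j) crank_gf =
     (\<Sum>i\<le>j. of_nat (j choose i) * moment i crank_gf * (if odd (j - i) then 2 * sigma_gf (j - i) else 0))"
  by (simp only: moment_Suc z_deriv_crank_gf moment_mult moment_log)

lemma moment_crank_gf_odd: "odd j \<Longrightarrow> moment j crank_gf = 0"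
proof (induction j rule: less_induct)
  case (less j)
  then obtain i where j: "j = Suc i" by (cases j) auto
  have *: "moment k crank_gf * (if odd (i - k) then 2 * sigma_gf (i - k) else 0) = 0" if "k \<le> i" for k
    using less that unfolding j by (cases "odd k") (auto simp: even_diff_nat)
  show ?case unfolding j moment_crank_gf_Suc mult.assoc
  proof (intro sum.neutral ballI)
    fix k assume "k \<in> {..i}"
    then show "of_nat (i choose k) * (moment k crank_gf *
        (if odd (i - k) then 2 * sigma_gf (i - k) else 0)) = 0"
      using *[of k] by simp
  qed
qed

lemma moment_rank_gf_0: "moment 0 rank_gf = partition_gf"
proof (rule fps_ext)
  fix n
  have "(\<Sum>m\<in>{- int n..- int n + int k}. rank_count m n) =
      rank_le_count (- int n + int k) (int n) - rank_le_count (- int n - 1) (int n)" for k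
  proof (induction k)
    case (Suc k)
    have "{- int n..- int n + int (Suc k)} = insert (- int n + int (Suc k)) {- int n..- int n + int k}"
      by auto
    then show ?case using Suc by (simp add: rank_count_eq_diff)
  qed (simp add: rank_count_eq_diff)
  from this[of "2 * n"] have "(\<Sum>m\<in>{- int n..int n}. rank_count m n) =
      rank_le_count (int n) (int n) - rank_le_count (- int n - 1) (int n)" by simp
  also have "\<dots> = int (card (partitions_of n))"
    using rank_le_count_eq_all[of "int n" "int n"] rank_le_count_eq_0[of "- int n - 1" "int n"]
    by (cases "n = 0") (simp_all add: partition_count_def rank_le_count_def)
  finally show "moment 0 rank_gf $ n = partition_gf $ n"
    by (simp add: rank_gf_def moment_laurent_gf_nth partition_gf_nth)
qed

section \<open>The rank-crank differential equation\<close>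

text \<open>The inverse of \<open>1 - z\<close> is not polynomial in \<open>x\<close>; after this
  injective embedding it is \<open>geom\<close>, and polynomial identities can be carried back by
  \<open>lift_inj\<close>.\<close>

definition lift :: "real poly fps \<Rightarrow> real fps fps" where
  "lift f = Abs_fps (\<lambda>n. fps_of_poly (f $ n))"

lemma lift_nth: "lift f $ n = fps_of_poly (f $ n)"
  by (simp add: lift_def)

lemma lift_nth_nth: "lift f $ n $ a = coeff (f $ n) a"
  by (simp add: lift_nth)

lemma lift_add: "lift (f + g) = lift f + lift g"
  by (rule fps_ext) (simp add: lift_nth fps_of_poly_add)

lemma lift_diff: "lift (f - g) = lift f - lift g"
  by (rule fps_ext) (simp add: lift_nth fps_of_poly_diff)

lemma lift_mult: "lift (f * g) = lift f * lift g"
  by (rule fps_ext) (simp add: lift_nth fps_mult_nth fps_of_poly_sum fps_of_poly_mult)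

lemma lift_1: "lift 1 = 1"
  by (rule fps_ext) (simp add: lift_nth)

lemma lift_numeral: "lift (numeral k) = numeral k"
  by (rule fps_ext) (simp add: lift_nth numeral_fps_const fps_of_poly_numeral)

lemma lift_power: "lift (f ^ k) = lift f ^ k"
  by (induction k) (simp_all add: lift_1 lift_mult)

lemma lift_z: "lift z_fps = fps_const fps_X"
  by (rule fps_ext) (simp add: lift_nth z_fps_def fps_of_poly_monom)

lemma lift_X: "lift fps_X = fps_X"
  by (rule fps_ext) (simp add: lift_nth fps_X_def)

lemma lift_XD: "lift (fps_XD f) = fps_XD (lift f)"
  by (rule fps_ext, rule fps_ext) (simp add: lift_nth_nth of_nat_poly)
    

lemma lift_inj: "lift f = lift g \<Longrightarrow> f = g"
  by (simp add: fps_eq_iff lift_nth poly_eq_iff)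

definition z_deriv' :: "real fps fps \<Rightarrow> real fps fps" where
  "z_deriv' f = Abs_fps (\<lambda>n. fps_XD (f $ n) - of_nat n * f $ n)"

lemma z_deriv'_nth: "z_deriv' f $ n = fps_XD (f $ n) - of_nat n * f $ n"
  by (simp add: z_deriv'_def)

lemma z_deriv'_nth_nth: "z_deriv' f $ n $ a = (real a - real n) * f $ n $ a"
  by (simp add: z_deriv'_nth algebra_simps)

lemma z_deriv'_add: "z_deriv' (f + g) = z_deriv' f + z_deriv' g"
  by (rule fps_ext, rule fps_ext) (simp add: z_deriv'_nth_nth algebra_simps)

lemma z_deriv'_diff: "z_deriv' (f - g) = z_deriv' f - z_deriv' g"
  by (rule fps_ext, rule fps_ext) (simp add: z_deriv'_nth_nth algebra_simps)

lemma z_deriv'_mult: "z_deriv' (f * g) = z_deriv' f * g + f * z_deriv' g"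
proof (rule fps_ext)
  fix n
  have sum: "fps_XD (\<Sum>x\<in>A. h x) = (\<Sum>x\<in>A. fps_XD (h x :: real fps))" for A :: "nat set" and h
    by (induction A rule: infinite_finite_induct) (simp_all add: fps_XD_def distrib_left)
  have "z_deriv' (f * g) $ n = (\<Sum>i = 0..n. fps_XD (f $ i * g $ (n - i)) - of_nat n * (f $ i * g $ (n - i)))"
    by (simp add: z_deriv'_nth fps_mult_nth sum sum_distrib_left sum_subtractf)
  also have "\<dots> = (\<Sum>i = 0..n. z_deriv' f $ i * g $ (n - i) + f $ i * z_deriv' g $ (n - i))"
  proof (intro sum.cong refl)
    fix i assume "i \<in> {0..n}"
    then have "(of_nat n :: real fps) = of_nat i + of_nat (n - i)"
      by (simp flip: of_nat_add)
    then show "fps_XD (f $ i * g $ (n - i)) - of_nat n * (f $ i * g $ (n - i)) =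
        z_deriv' f $ i * g $ (n - i) + f $ i * z_deriv' g $ (n - i)"
      by (simp add: z_deriv'_nth fps_XD_mult algebra_simps)
  qed
  also have "\<dots> = (z_deriv' f * g + f * z_deriv' g) $ n"
    by (simp add: fps_mult_nth sum.distrib)
  finally show "z_deriv' (f * g) $ n = (z_deriv' f * g + f * z_deriv' g) $ n" .
qed

lemma lift_z_deriv: "lift (z_deriv f) = z_deriv' (lift f)"
proof (rule fps_ext, rule fps_ext)
  fix n a
  show "lift (z_deriv f) $ n $ a = z_deriv' (lift f) $ n $ a"
    by (cases a) (simp_all add: lift_nth_nth z_deriv_nth z_deriv'_nth_nth coeff_monom_mult coeff_pderiv
        of_nat_poly algebra_simps)
qed

text \<open>The substitution \<open>z \<mapsto> z q\<close> sends \<open>z^m q^n\<close> to \<open>z^m q^(n + m)\<close>, that is \<open>x^a X^n\<close> to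
  \<open>x^(2 a - n) X^a\<close>. It is defined on the series without monomials \<open>x^a X^n\<close> with \<open>2 a < n\<close>.\<close>

definition shiftable :: "real fps fps \<Rightarrow> bool" where
  "shiftable f \<longleftrightarrow> (\<forall>n a. 2 * a < n \<longrightarrow> f $ n $ a = 0)"

definition shift :: "real fps fps \<Rightarrow> real fps fps" where
  "shift f = Abs_fps (\<lambda>n. Abs_fps (\<lambda>a. if a \<le> 2 * n then f $ (2 * n - a) $ n else 0))"

lemma shift_nth: "shift f $ n $ a = (if a \<le> 2 * n then f $ (2 * n - a) $ n else 0)"
  by (simp add: shift_def)

lemma shiftable_add: "shiftable f \<Longrightarrow> shiftable g \<Longrightarrow> shiftable (f + g)"
  by (simp add: shiftable_def)

lemma shiftable_diff: "shiftable f \<Longrightarrow> shiftable g \<Longrightarrow> shiftable (f - g)"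
  by (simp add: shiftable_def)

lemma shift_add: "shift (f + g) = shift f + shift g"
  by (rule fps_ext, rule fps_ext) (simp add: shift_nth)

lemma shift_diff: "shift (f - g) = shift f - shift g"
  by (rule fps_ext, rule fps_ext) (simp add: shift_nth)

lemma fps_mult_nth_nth:
  "(f * g) $ n $ a = (\<Sum>(i, j)\<in>{0..n} \<times> {0..a}. f $ i $ j * g $ (n - i) $ (a - j))"
  for f g :: "real fps fps"
  by (simp add: fps_mult_nth fps_sum_nth sum.cartesian_product)

lemma shiftable_mult:
  assumes "shiftable f" "shiftable g"
  shows "shiftable (f * g)"
  unfolding shiftable_def
proof (intro allI impI)
  fix n a :: nat assume na: "2 * a < n"
  show "(f * g) $ n $ a = 0" unfolding fps_mult_nth_nth
  proof (intro sum.neutral ballI)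
    fix t assume "t \<in> {0..n} \<times> {0..a}"
    then obtain i j where t: "t = (i, j)" "i \<le> n" "j \<le> a" by auto
    then have "2 * j < i \<or> 2 * (a - j) < n - i" using na by linarith
    with assms show "(case t of (i, j) \<Rightarrow> f $ i $ j * g $ (n - i) $ (a - j)) = 0"
      by (auto simp: shiftable_def t)
  qed
qed

text \<open>\<open>shift\<close> discards monomials with \<open>2 a < n\<close>, so multiplicativity
  requires factors without them. The two convolution sums then correspond under
  \<open>(i, j) -> (j, 2 * j - i)\<close>, and the index pairs outside the common range contribute
  0.\<close>

lemma shift_mult:
  assumes "shiftable f" "shiftable g"
  shows "shift (f * g) = shift f * shift g"
proof (rule fps_ext, rule fps_ext)
  fix n a :: nat
  let ?B = "{(M, c). M \<le> n \<and> c \<le> a \<and> c \<le> 2 * M \<and> a - c \<le> 2 * (n - M)}"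
  have R: "(shift f * shift g) $ n $ a =
      (\<Sum>(M, c)\<in>?B. f $ (2 * M - c) $ M * g $ (2 * (n - M) - (a - c)) $ (n - M))"
    unfolding fps_mult_nth_nth
    by (rule sum.mono_neutral_cong_right) (auto simp: shift_nth split: if_splits)
  show "shift (f * g) $ n $ a = (shift f * shift g) $ n $ a"
  proof (cases "a \<le> 2 * n")
    case True
    let ?A = "{(i, j). i \<le> 2 * n - a \<and> j \<le> n \<and> i \<le> 2 * j \<and> 2 * j \<le> i + a}"
    have "shift (f * g) $ n $ a =
        (\<Sum>(i, j)\<in>{0..2 * n - a} \<times> {0..n}. f $ i $ j * g $ (2 * n - a - i) $ (n - j))"
      using True by (simp add: shift_nth fps_mult_nth_nth)
    also have "\<dots> = (\<Sum>(i, j)\<in>?A. f $ i $ j * g $ (2 * n - a - i) $ (n - j))"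
    proof (intro sum.mono_neutral_right ballI)
      fix t assume "t \<in> {0..2 * n - a} \<times> {0..n} - ?A"
      moreover obtain i j where t: "t = (i, j)" by (cases t)
      ultimately have "i \<le> 2 * n - a" "j \<le> n" "\<not> (i \<le> 2 * j \<and> 2 * j \<le> i + a)" by auto
      then have "2 * j < i \<or> 2 * (n - j) < 2 * n - a - i" by linarith
      with assms show "(case t of (i, j) \<Rightarrow> f $ i $ j * g $ (2 * n - a - i) $ (n - j)) = 0"
        by (auto simp: shiftable_def t)
    qed auto
    also have "\<dots> = (\<Sum>(M, c)\<in>?B. f $ (2 * M - c) $ M * g $ (2 * (n - M) - (a - c)) $ (n - M))"
    proof (rule sum.reindex_bij_witness[where i = "\<lambda>(M, c). (2 * M - c, M)" and j = "\<lambda>(i, j). (j, 2 * j - i)"])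
      fix t assume "t \<in> ?A"
      then obtain i j where t: "t = (i, j)" "i \<le> 2 * n - a" "j \<le> n" "i \<le> 2 * j" "2 * j \<le> i + a" by auto
      then have "2 * (n - j) - (a - (2 * j - i)) = 2 * n - a - i" "a - (2 * j - i) \<le> 2 * (n - j)"
        using True by linarith+
      with t show "(case case t of (i, j) \<Rightarrow> (j, 2 * j - i) of (M, c) \<Rightarrow> (2 * M - c, M)) = t"
        "(case t of (i, j) \<Rightarrow> (j, 2 * j - i)) \<in> ?B"
        "(case case t of (i, j) \<Rightarrow> (j, 2 * j - i) of (M, c) \<Rightarrow>
            f $ (2 * M - c) $ M * g $ (2 * (n - M) - (a - c)) $ (n - M)) =
          (case t of (i, j) \<Rightarrow> f $ i $ j * g $ (2 * n - a - i) $ (n - j))"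
        by simp_all
    next
      fix t assume "t \<in> ?B"
      then obtain M c where t: "t = (M, c)" "M \<le> n" "c \<le> a" "c \<le> 2 * M" "a - c \<le> 2 * (n - M)" by auto
      then have "2 * M - c \<le> 2 * n - a" "2 * M \<le> 2 * M - c + a" using True by linarith+
      with t show "(case case t of (M, c) \<Rightarrow> (2 * M - c, M) of (i, j) \<Rightarrow> (j, 2 * j - i)) = t"
        "(case t of (M, c) \<Rightarrow> (2 * M - c, M)) \<in> ?A"
        by simp_all
    qed
    finally show ?thesis unfolding R .
  next
    case False
    then have "?B = {}" by auto
    with False show ?thesis by (simp only: R shift_nth) simp
  qed
qed

lemma shiftable_1 [simp]: "shiftable 1" and shift_1 [simp]: "shift 1 = 1"
proof -
  show "shiftable 1" by (simp add: shiftable_def)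
  show "shift 1 = 1"
    by (rule fps_ext, rule fps_ext) (auto simp: shift_nth)
qed

lemma shiftable_power: "shiftable f \<Longrightarrow> shiftable (f ^ k)"
  by (induction k) (simp_all add: shiftable_mult)

lemma shift_power: "shiftable f \<Longrightarrow> shift (f ^ k) = shift f ^ k"
  by (induction k) (simp_all add: shift_mult shiftable_power)

abbreviation x_var :: "real fps fps" where "x_var \<equiv> fps_const fps_X"

lemma shiftable_x [simp]: "shiftable x_var" and shift_x [simp]: "shift x_var = x_var ^ 2 * fps_X"
proof -
  show "shiftable x_var" by (auto simp: shiftable_def)
  have "x_var ^ 2 * fps_X = fps_X * fps_const (fps_X ^ 2)"
    by (simp add: power2_eq_square mult.commute)
  then show "shift x_var = x_var ^ 2 * fps_X"
    by (intro fps_ext) (auto simp: shift_nth fps_X_power_nth fps_X_mult_nth split: if_splits)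
qed

definition geom :: "real fps fps" where
  "geom = fps_const (Abs_fps (\<lambda>_. 1))"

lemma geom_inverse: "(1 - x_var) * geom = 1"
proof -
  have "(1 - fps_X) * Abs_fps (\<lambda>_. 1) = (1 :: real fps)"
    by (rule fps_ext) (auto simp: left_diff_distrib fps_X_mult_nth)
  then have "fps_const ((1 - fps_X) * Abs_fps (\<lambda>_. 1)) = (1 :: real fps fps)"
    by (simp only: fps_const_1_eq_1)
  then show ?thesis
    unfolding geom_def by (simp only: fps_const_mult[symmetric] fps_const_sub[symmetric] fps_const_1_eq_1)
qed

lemma shiftable_geom [simp]: "shiftable geom"
  by (auto simp: shiftable_def geom_def)

lemma shift_geom: "(1 - x_var ^ 2 * fps_X) * shift geom = 1"
  using arg_cong[OF geom_inverse, of shift]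
  by (simp add: shift_mult shiftable_diff shift_diff)

text \<open>Coefficient of \<open>z^m q^n\<close> for arbitrary integers \<open>m\<close> and \<open>n\<close>.\<close>

definition zq_coeff :: "real fps fps \<Rightarrow> int \<Rightarrow> int \<Rightarrow> real" where
  "zq_coeff f m n = (if 0 \<le> n \<and> 0 \<le> n + m then f $ nat n $ nat (n + m) else 0)"

lemma zq_coeff_add: "zq_coeff (f + g) m n = zq_coeff f m n + zq_coeff g m n"
  by (simp add: zq_coeff_def)

lemma zq_coeff_diff: "zq_coeff (f - g) m n = zq_coeff f m n - zq_coeff g m n"
  by (simp add: zq_coeff_def)

lemma zq_coeff_numeral: "zq_coeff (numeral k * f) m n = numeral k * zq_coeff f m n"
  by (simp add: zq_coeff_def)

lemma zq_coeff_x: "zq_coeff (x_var * f) m n = zq_coeff f (m - 1) n"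
  by (auto simp: zq_coeff_def fps_X_mult_nth nat_diff_distrib algebra_simps)

lemma zq_coeff_X: "zq_coeff (fps_X * f) m n = zq_coeff f (m + 1) (n - 1)"
  by (auto simp: zq_coeff_def fps_X_mult_nth nat_diff_distrib algebra_simps)

lemma zq_coeff_shift:
  assumes "shiftable f"
  shows "zq_coeff (shift f) m n = zq_coeff f m (n - m)"
proof (cases "0 \<le> n \<and> 0 \<le> n + m \<and> m \<le> n")
  case True
  define N a where "N = nat n" and "a = nat (n + m)"
  have nm: "n = int N" "m = int a - int N" using True by (simp_all add: N_def a_def)
  have "a \<le> 2 * N" using True by (simp add: nm)
  moreover have "nat (n - m) = 2 * N - a" using True by (simp add: nm)
  ultimately show ?thesis using True
    by (simp add: zq_coeff_def shift_nth flip: N_def a_def)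
next
  case False
  have "f $ nat (n - m) $ nat n = 0" if "0 \<le> n" "\<not> 0 \<le> n + m"
    using assms that by (simp add: shiftable_def)
  moreover have "\<not> nat (n + m) \<le> 2 * nat n" if "0 \<le> n" "\<not> m \<le> n"
    using that by linarith
  ultimately show ?thesis using False
    by (auto simp: zq_coeff_def shift_nth)
qed

lemma zq_coeff_eqI:
  assumes "\<And>m n. zq_coeff f m n = zq_coeff g m n"
  shows "f = g"
proof (rule fps_ext, rule fps_ext)
  fix n a
  show "f $ n $ a = g $ n $ a"
    using assms[of "int a - int n" "int n"] by (simp add: zq_coeff_def)
qed

lemma zq_coeff_cube_X: "zq_coeff ((1 - fps_X) ^ 3 * f) m n = zq_coeff f m n - 3 * zq_coeff f (m + 1) (n - 1)
    + 3 * zq_coeff f (m + 2) (n - 2) - zq_coeff f (m + 3) (n - 3)"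
proof -
  have "(1 - fps_X) ^ 3 * f = f - 3 * (fps_X * f) + 3 * (fps_X * (fps_X * f)) - fps_X * (fps_X * (fps_X * f))"
    by (simp add: power3_eq_cube algebra_simps)
  then show ?thesis
    by (simp only: zq_coeff_diff zq_coeff_add zq_coeff_numeral zq_coeff_X) (simp add: algebra_simps)
qed

lemma zq_coeff_cube_x: "zq_coeff (x_var * fps_X * (1 - x_var) ^ 3 * f) m n = zq_coeff f m (n - 1)
    - 3 * zq_coeff f (m - 1) (n - 1) + 3 * zq_coeff f (m - 2) (n - 1) - zq_coeff f (m - 3) (n - 1)"
proof -
  let ?x = x_var
  have "x * y * (1 - x) ^ 3 * f = x * (y * f) - 3 * (x * (x * (y * f))) + 3 * (x * (x * (x * (y * f))))
      - x * (x * (x * (x * (y * f))))" for x y :: "real fps fps"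
    by (simp add: power3_eq_cube algebra_simps)
  then show ?thesis
    by (simp only: zq_coeff_diff zq_coeff_add zq_coeff_numeral zq_coeff_X zq_coeff_x) (simp add: algebra_simps)
qed

text \<open>In terms of \<open>z\<close> and \<open>q\<close>:
  \<open>(1 - 1/z)^3 f(z q) = q (1 - z)^3 f(z)\<close>, a form of
  \<open>f(z q) = - q z^3 f(z)\<close> that respects poles. The factor \<open>(1 - q/z)^3\<close>
  removes a pole at \<open>z = q\<close>, whose expansion in powers of \<open>q/z\<close> could not
  be shifted.\<close>

definition shift_invariant :: "real fps fps \<Rightarrow> bool" where
  "shift_invariant f \<longleftrightarrow> shiftable ((1 - fps_X) ^ 3 * f) \<and>
     shift ((1 - fps_X) ^ 3 * f) = x_var * fps_X * (1 - x_var) ^ 3 * f"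

text \<open>Three consecutive zeros force the preceding value to be zero, so vanishing far to the
  right propagates to the left.\<close>

lemma third_difference_zero:
  fixes g :: "int \<Rightarrow> real"
  assumes "\<And>m. g m - 3 * g (m + 1) + 3 * g (m + 2) - g (m + 3) = 0" "\<And>m. m \<ge> M \<Longrightarrow> g m = 0"
  shows "g m = 0"
proof -
  have "g (M - int k) = 0 \<and> g (M - int k + 1) = 0 \<and> g (M - int k + 2) = 0" for k
  proof (induction k)
    case (Suc k)
    define j where "j = M - int (Suc k)"
    have "M - int k = j + 1" "j + 1 + 1 = j + 2" "j + 1 + 2 = j + 3" by (simp_all add: j_def)
    with assms(1)[of j] Suc show ?case unfolding j_def[symmetric] by simp
  qed (simp add: assms(2))
  from this[of "nat (M - m)"] assms(2)[of m] show ?thesis by (cases "m \<ge> M") auto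
qed

text \<open>The functional equation \<open>f(z q) = - q z^3 f(z)\<close> determines the coefficient of \<open>z^m q^n\<close> by
  one with a smaller power of \<open>q\<close>, as soon as it holds without a contribution from the pole at
  \<open>z = 1\<close>.\<close>

lemma shift_invariant_unique:
  assumes inv: "shift_invariant f"
    and fin: "\<And>n. \<exists>M. \<forall>m\<ge>M. zq_coeff f m n = 0"
  shows "f = 0"
proof -
  let ?d = "zq_coeff f"
  have neg: "?d m n = 0" if "n < 0" for m n
    using that by (simp add: zq_coeff_def)
  \<comment> \<open>\<open>h n m\<close> is the coefficient of \<open>z^m q^n\<close> in
    \<open>f(z q) + q z^3 f(z)\<close>. Invariance only says that its third differences in
    \<open>m\<close> vanish; the support condition excludes a nonzero quadratic polynomial.\<close>
  define h where "h n m = ?d m (n - m) + ?d (m - 3) (n - 1)" for n m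
  have "h n m = 0" for n m
  proof -
    obtain M where M: "\<And>m. m \<ge> M \<Longrightarrow> ?d m (n - 1) = 0" using fin[of "n - 1"] by blast
    show ?thesis
    proof (rule third_difference_zero[where M = "max (M + 3) (n + 1)"])
      fix m assume "m \<ge> max (M + 3) (n + 1)"
      then show "h n m = 0" using M[of "m - 3"] neg[of "n - m" m] by (simp add: h_def)
    next
      fix m
      have "zq_coeff ((1 - fps_X) ^ 3 * f) m (n - m) = zq_coeff (x_var * fps_X * (1 - x_var) ^ 3 * f) m n"
        using inv zq_coeff_shift[of "(1 - fps_X) ^ 3 * f" m n] by (simp add: shift_invariant_def)
      then show "h n m - 3 * h n (m + 1) + 3 * h n (m + 2) - h n (m + 3) = 0"
        unfolding zq_coeff_cube_X zq_coeff_cube_x by (simp add: h_def algebra_simps)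
    qed
  qed
  then have rec: "?d m n = - ?d (m - 3) (n + m - 1)" for m n
    by (simp add: h_def eq_neg_iff_add_eq_0) (metis add_diff_cancel_right' diff_add_eq)
  \<comment> \<open>For \<open>m \<le> 0\<close> the recurrence lowers \<open>n\<close> and keeps
    \<open>m\<close> nonpositive; for \<open>m \<ge> 0\<close> it is read in the opposite direction,
    again lowering \<open>n\<close>.\<close>
  have A: "?d m n = 0" if "m \<le> 0" for m n
    using that
  proof (induction "nat (n + 1)" arbitrary: m n rule: less_induct)
    case less
    show ?case
    proof (cases "n < 0")
      case False
      then have "?d (m - 3) (n + m - 1) = 0" using less.prems by (intro less.hyps) auto
      then show ?thesis by (subst rec) simp
    qed (rule neg)
  qed
  have B: "?d m n = 0" if "m \<ge> 0" for m n
    using that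
  proof (induction "nat (n + 1)" arbitrary: m n rule: less_induct)
    case less
    show ?case
    proof (cases "n < 0")
      case False
      then have "?d (m + 3) (n - m - 2) = 0" using less.prems by (intro less.hyps) auto
      then show ?thesis using rec[of "m + 3" "n - m - 2"] by simp
    qed (rule neg)
  qed
  show ?thesis
  proof (rule zq_coeff_eqI)
    fix m n
    show "?d m n = zq_coeff 0 m n" using A[of m n] B[of m n] by (cases "m \<le> 0") (auto simp: zq_coeff_def)
  qed
qed

lemma shift_invariant_diff:
  "shift_invariant f \<Longrightarrow> shift_invariant g \<Longrightarrow> shift_invariant (f - g)"
  by (simp add: shift_invariant_def right_diff_distrib shiftable_diff shift_diff)

lemma shift_invariant_mult:
  assumes "shiftable c" "shift c = c" "shift_invariant f"
  shows "shift_invariant (c * f)"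
  using assms by (simp add: shift_invariant_def mult.left_commute[of _ c] shiftable_mult shift_mult)

text \<open>The heat operator \<open>6 q d/dq + (z d/dz)^2 + z d/dz\<close> applied to \<open>R(z) / (1 - z)\<close>.\<close>

definition rank_heat :: "real fps fps" where
  "rank_heat = Abs_fps (\<lambda>n. Abs_fps (\<lambda>a. let m = int a - int n in
     of_int ((6 * int n + m * (m + 1)) * rank_le_count m (int n))))"

lemma zq_coeff_rank_heat: "zq_coeff rank_heat m n = of_int ((6 * n + m * (m + 1)) * rank_le_count m n)"
proof (cases "0 \<le> n \<and> 0 \<le> n + m")
  case False
  then have "rank_le_count m n = 0"
    using rank_le_count_eq_0[of m n] by (auto simp: rank_le_count_def)
  with False show ?thesis by (auto simp: zq_coeff_def)
qed (simp add: zq_coeff_def rank_heat_def Let_def)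

text \<open>The common weight of the two terms also vanishes at both pairs excluded from
  \<open>rank_le_count_shift\<close>, so the weighted recurrence has no exceptions.\<close>

lemma rank_heat_recurrence:
  "zq_coeff rank_heat (m - 3) n + zq_coeff rank_heat m (n - m + 1) =
     of_int ((6 * n + (m - 3) * (m - 2)) * partition_count n)"
proof -
  have weight: "6 * (n - m + 1) + m * (m + 1) = 6 * n + (m - 3) * (m - 2)"
    by (simp add: algebra_simps)
  have "(6 * n + (m - 3) * (m - 2)) * (rank_le_count (m - 3) n + rank_le_count m (n - m + 1)) =
      (6 * n + (m - 3) * (m - 2)) * partition_count n"
  proof (cases "(m = 2 \<and> n = 0) \<or> (m = 0 \<and> n = - 1)")
    case True
    then have "6 * n + (m - 3) * (m - 2) = 0" by auto
    then show ?thesis by simp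
  next
    case False
    then show ?thesis using rank_le_count_shift[of m n] by simp
  qed
  moreover have "zq_coeff rank_heat (m - 3) n + zq_coeff rank_heat m (n - m + 1) =
      of_int ((6 * n + (m - 3) * (m - 2)) * (rank_le_count (m - 3) n + rank_le_count m (n - m + 1)))"
    unfolding zq_coeff_rank_heat weight by (simp add: algebra_simps)
  ultimately show ?thesis by (simp only:)
qed

text \<open>The right-hand side of \<open>rank_heat_recurrence\<close> is quadratic in
  \<open>m\<close>, so its third differences are zero. What remains is exactly the coefficient form
  of the functional equation.\<close>

lemma shift_invariant_rank_heat: "shift_invariant rank_heat"
proof -
  let ?g = "zq_coeff rank_heat"
  have key: "zq_coeff ((1 - fps_X) ^ 3 * rank_heat) m (n - m) =
      zq_coeff (x_var * fps_X * (1 - x_var) ^ 3 * rank_heat) m n" for m n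
  proof -
    have h: "?g (k - 3) (n - 1) + ?g k (n - k) =
        of_int ((6 * (n - 1) + (k - 3) * (k - 2)) * partition_count (n - 1))" for k
      using rank_heat_recurrence[of k "n - 1"] by (simp add: algebra_simps)
    show ?thesis
      using h[of m] h[of "m + 1"] h[of "m + 2"] h[of "m + 3"]
      unfolding zq_coeff_cube_X zq_coeff_cube_x by (simp add: algebra_simps)
  qed
  have good: "shiftable ((1 - fps_X) ^ 3 * rank_heat)"
    unfolding shiftable_def
  proof (intro allI impI)
    fix n a :: nat assume na: "2 * a < n"
    let ?m = "int a - int n"
    have "((1 - fps_X) ^ 3 * rank_heat) $ n $ a = zq_coeff ((1 - fps_X) ^ 3 * rank_heat) ?m (int a - ?m)"
      by (simp add: zq_coeff_def)
    also have "\<dots> = 0"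
    proof -
      \<comment> \<open>By \<open>key\<close> the coefficient is a combination of counts for
        \<open>a - 1\<close> with rank at most \<open>?m - i\<close>. Since \<open>2 * a < n\<close>
        puts \<open>?m\<close> below \<open>- a\<close>, no such partitions exist;
        \<open>a = 1\<close> falls under the convention for the empty partition.\<close>
      have "?g (?m - i) (int a - 1) = 0" if "i \<ge> 0" for i
      proof (cases "a = 1")
        case True
        with that na have "rank_le_count (?m - i) 0 = 0" by (simp add: rank_le_count_def)
        with True show ?thesis by (simp add: zq_coeff_rank_heat)
      next
        case False
        with that na have "rank_le_count (?m - i) (int a - 1) = 0" by (intro rank_le_count_eq_0) auto
        then show ?thesis by (simp add: zq_coeff_rank_heat)
      qed
      from this[of 0] this[of 1] this[of 2] this[of 3] show ?thesis
        unfolding key zq_coeff_cube_x by simp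
    qed
    finally show "((1 - fps_X) ^ 3 * rank_heat) $ n $ a = 0" .
  qed
  moreover have "shift ((1 - fps_X) ^ 3 * rank_heat) = x_var * fps_X * (1 - x_var) ^ 3 * rank_heat"
    by (rule zq_coeff_eqI) (simp only: zq_coeff_shift[OF good] key)
  ultimately show ?thesis by (simp add: shift_invariant_def)
qed

text \<open>\<open>(1 - z)^3\<close> times the heat operator applied to \<open>R / (1 - z)\<close>,
  with all denominators cleared, so that it can be evaluated at \<open>z = 1\<close>.\<close>

definition rank_op :: "real poly fps" where
  "rank_op = (1 - z_fps) ^ 2 * (6 * fps_XD rank_gf + z_deriv (z_deriv rank_gf)) +
     (1 - z_fps ^ 2) * z_deriv rank_gf + 2 * z_fps * rank_gf"

text \<open>Multiplication by \<open>1 / (1 - z)\<close> sums the coefficients over smaller powers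
  of \<open>z\<close>, and ranks below \<open>- n\<close> do not occur.\<close>

lemma rank_partial_sums:
  "(geom * lift rank_gf) $ n $ a = of_int (rank_le_count (int a - int n) (int n))"
proof -
  have coeff: "coeff (rank_gf $ n) i = of_int (rank_count (int i - int n) n)" for i
  proof -
    have "coeff (rank_gf $ n) i = (\<Sum>m\<in>{- int n..int n}. if m = int i - int n then of_int (rank_count m n) else 0)"
      unfolding rank_gf_def laurent_gf_def fps_nth_Abs_fps coeff_sum by (intro sum.cong refl) auto
    also have "\<dots> = of_int (rank_count (int i - int n) n)"
      using rank_count_nonzero[of "int i - int n" n] by auto
    finally show ?thesis .
  qed
  have "(geom * lift rank_gf) $ n = fps_of_poly (rank_gf $ n) * Abs_fps (\<lambda>_. 1)"
    by (simp add: geom_def lift_nth mult.commute)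
  then have "(geom * lift rank_gf) $ n $ a = (\<Sum>i = 0..a. coeff (rank_gf $ n) i)"
    by (simp add: fps_mult_nth)
  also have "\<dots> = of_int (rank_le_count (int a - int n) (int n)) - of_int (rank_le_count (- int n - 1) (int n))"
    by (induction a) (simp_all add: coeff rank_count_eq_diff algebra_simps)
  also have "rank_le_count (- int n - 1) (int n) = 0"
    using rank_le_count_eq_0[of "- int n - 1" "int n"] by (cases "n = 0") (simp_all add: rank_le_count_def)
  finally show ?thesis by simp
qed

lemma rank_heat_eq: "(1 - x_var) ^ 3 * rank_heat = lift rank_op"
proof -
  let ?x = x_var
  define I R where "I = geom" and "R = lift rank_gf"
  have I: "(1 - ?x) * I = 1" by (simp add: I_def geom_inverse)
  have heat: "rank_heat = 6 * fps_XD (I * R) + z_deriv' (z_deriv' (I * R)) + z_deriv' (I * R)"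
    by (rule fps_ext, rule fps_ext)
       (simp add: I_def R_def z_deriv'_nth_nth rank_partial_sums rank_heat_def Let_def algebra_simps)
  have x: "z_deriv' ?x = ?x"
    by (rule fps_ext, rule fps_ext) (simp add: z_deriv'_nth_nth)
  have one: "z_deriv' 1 = 0"
    by (rule fps_ext, rule fps_ext) (simp add: z_deriv'_nth_nth)
  have XI: "fps_XD I = 0"
    by (rule fps_ext) (simp add: I_def geom_def)
  \<comment> \<open>The derivative of \<open>1 / (1 - z)\<close>. Applying it twice creates the
    triple pole that \<open>(1 - x)^3\<close> clears.\<close>
  have DI: "z_deriv' I = ?x * I ^ 2"
  proof -
    have "0 = z_deriv' ((1 - ?x) * I)" by (simp add: I one)
    also have "\<dots> = - ?x * I + (1 - ?x) * z_deriv' I"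
      by (simp add: z_deriv'_mult z_deriv'_diff one x)
    finally have "I * (- ?x * I + (1 - ?x) * z_deriv' I) = 0" by simp
    then have "((1 - ?x) * I) * z_deriv' I = ?x * I ^ 2"
      by algebra
    then show ?thesis by (simp add: I)
  qed
  have "z_deriv' (I ^ 2) = 2 * ?x * I ^ 3"
    by (simp add: power2_eq_square z_deriv'_mult DI power3_eq_cube algebra_simps)
  then have "z_deriv' (z_deriv' (I * R)) =
      (?x * I ^ 2 + 2 * ?x ^ 2 * I ^ 3) * R + 2 * ?x * I ^ 2 * z_deriv' R + I * z_deriv' (z_deriv' R)"
    by (simp add: z_deriv'_mult z_deriv'_add DI x algebra_simps power2_eq_square)
  then have heat': "rank_heat = 6 * (I * fps_XD R) +
      (?x * I ^ 2 + 2 * ?x ^ 2 * I ^ 3) * R + 2 * ?x * I ^ 2 * z_deriv' R + I * z_deriv' (z_deriv' R) +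
      (?x * I ^ 2 * R + I * z_deriv' R)"
    unfolding heat by (simp add: fps_XD_mult XI z_deriv'_mult DI)
  have "(1 - ?x) ^ 3 * rank_heat = 6 * (1 - ?x) ^ 2 * ((1 - ?x) * I) * fps_XD R +
      (2 * ?x * (1 - ?x) * ((1 - ?x) * I) ^ 2 + 2 * ?x ^ 2 * ((1 - ?x) * I) ^ 3) * R +
      (2 * ?x * (1 - ?x) * ((1 - ?x) * I) ^ 2 + (1 - ?x) ^ 2 * ((1 - ?x) * I)) * z_deriv' R +
      (1 - ?x) ^ 2 * ((1 - ?x) * I) * z_deriv' (z_deriv' R)"
    unfolding heat' by algebra
  also have "\<dots> = (1 - ?x) ^ 2 * (6 * fps_XD R + z_deriv' (z_deriv' R)) + (1 - ?x ^ 2) * z_deriv' R + 2 * ?x * R"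
    unfolding I by (simp only: power_one mult_1_right) algebra
  also have "\<dots> = lift rank_op"
    by (simp add: rank_op_def R_def lift_add lift_mult lift_diff lift_power lift_1 lift_numeral lift_z
        lift_XD lift_z_deriv del: fps_const_power)
  finally show ?thesis .
qed

text \<open>Substituting \<open>z q\<close> for \<open>z\<close> changes every part marked by
  \<open>z\<close> or \<open>1/z\<close> by 1. Raising all parts by 1 is therefore the combinatorial
  form of the shift on \<open>gf_zq\<close> and, read backwards, on \<open>gf_qz\<close>.\<close>

lemma card_partitions_image_Suc:
  "card {p \<in> partitions_of n. size p = s} = card {p \<in> partitions_of (n + s). 1 \<notin># p \<and> size p = s}"
proof (rule bij_betw_same_card[where f = "image_mset Suc"], rule bij_betwI[where g = "image_mset (\<lambda>k. k - 1)"])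
  show "image_mset Suc \<in> {p \<in> partitions_of n. size p = s} \<rightarrow> {p \<in> partitions_of (n + s). 1 \<notin># p \<and> size p = s}"
    by (auto simp: partitions_of_def sum_mset_image_Suc)
  have inv: "image_mset Suc (image_mset (\<lambda>k. k - 1) p) = p" if "0 \<notin># p" for p
    using that by (induction p) auto
  show "image_mset (\<lambda>k. k - 1) \<in> {p \<in> partitions_of (n + s). 1 \<notin># p \<and> size p = s} \<rightarrow> {p \<in> partitions_of n. size p = s}"
  proof
    fix p assume p: "p \<in> {p \<in> partitions_of (n + s). 1 \<notin># p \<and> size p = s}"
    then have "sum_mset (image_mset (\<lambda>k. k - 1) p) + s = n + s"
      using sum_mset_image_Suc[of "image_mset (\<lambda>k. k - 1) p"] inv[of p] by (simp add: partitions_of_def)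
    moreover have "0 \<notin># image_mset (\<lambda>k. k - 1) p"
    proof
      assume "0 \<in># image_mset (\<lambda>k. k - 1) p"
      then obtain k where "k \<in># p" "k - 1 = 0" by auto
      then have "k = 0 \<or> k = 1" by linarith
      with \<open>k \<in># p\<close> p show False by (auto simp: partitions_of_def)
    qed
    ultimately show "image_mset (\<lambda>k. k - 1) p \<in> {p \<in> partitions_of n. size p = s}"
      using p by (simp add: partitions_of_def)
  qed
  show "image_mset Suc (image_mset (\<lambda>k. k - 1) p) = p"
    if "p \<in> {p \<in> partitions_of (n + s). 1 \<notin># p \<and> size p = s}" for p
    using that by (intro inv) (auto simp: partitions_of_def)
qed (simp add: multiset.map_comp o_def)

lemma lift_part_gf_nth:
  "lift (part_gf (\<lambda>k. monom 1 (f k))) $ n $ a = real (card {p \<in> partitions_of n. (\<Sum>k\<in>#p. f k) = a})"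
  by (simp add: lift_nth_nth part_gf_nth prod_mset_monom coeff_sum sum.inter_filter[symmetric] finite_partitions_of)

lemma lift_part_gf_no_ones_nth:
  "lift (part_gf ((\<lambda>k. monom 1 (f k))(1 := 0))) $ n $ a =
     real (card {p \<in> partitions_of n. 1 \<notin># p \<and> (\<Sum>k\<in>#p. f k) = a})"
proof -
  have "(\<Prod>k\<in>#p. ((\<lambda>k. monom 1 (f k))(1 := 0)) k) = (if 1 \<in># p then 0 else monom (1::real) (\<Sum>k\<in>#p. f k))" for p
  proof (cases "1 \<in># p")
    case True
    then show ?thesis using prod_mset_image_eq_0[of 1 p "(\<lambda>k. monom 1 (f k))(1 := 0)"] by simp
  next
    case False
    then have "image_mset ((\<lambda>k. monom (1::real) (f k))(1 := 0)) p = image_mset (\<lambda>k. monom 1 (f k)) p"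
      by (intro image_mset_cong) auto
    with False show ?thesis by (simp only: prod_mset_monom if_False)
  qed
  then have "coeff (part_gf ((\<lambda>k. monom 1 (f k))(1 := 0)) $ n) a =
      (\<Sum>p\<in>partitions_of n. if 1 \<notin># p \<and> (\<Sum>k\<in>#p. f k) = a then 1 else (0::real))"
    unfolding part_gf_nth coeff_sum by (intro sum.cong refl) (simp del: fun_upd_apply)
  then show ?thesis
    by (simp add: lift_nth_nth sum.inter_filter[symmetric] finite_partitions_of del: fun_upd_apply)
qed

lemma sum_mset_Suc: "p \<in> partitions_of n \<Longrightarrow> (\<Sum>k\<in>#p. Suc k) = n + size p"
  by (simp add: partitions_of_def sum_mset_image_Suc)

lemma sum_mset_pred: "p \<in> partitions_of n \<Longrightarrow> (\<Sum>k\<in>#p. k - 1) = n - size p"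
proof -
  assume p: "p \<in> partitions_of n"
  then have "0 \<notin># p" by (simp add: partitions_of_def)
  then have "(\<Sum>k\<in>#p. k - 1) + size p = sum_mset p"
    by (induction p) auto
  with p show ?thesis by (simp add: partitions_of_def)
qed

text \<open>Each part is marked by \<open>z\<close> and grows by 1 under the substitution, so the
  product loses its first factor, the one with \<open>1 - z q = 1 - x^2 X\<close>.\<close>

lemma shift_gf_zq: "shift (lift gf_zq) = (1 - x_var ^ 2 * fps_X) * lift gf_zq" and
  shiftable_gf_zq: "shiftable (lift gf_zq)"
proof -
  have zq: "lift gf_zq $ n $ a = real (card {p \<in> partitions_of n. n + size p = a})" for n a
    unfolding gf_zq_def lift_part_gf_nth using sum_mset_Suc[of _ n]
    by (intro arg_cong[where f = real] arg_cong[where f = card]) auto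
  show "shiftable (lift gf_zq)"
    unfolding shiftable_def zq by (auto simp: card_eq_0_iff)
  have "z_fps ^ 2 = fps_const (monom 1 (Suc 1))"
    by (simp add: z_fps_def power2_eq_square mult_monom)
  then have "(1 - z_fps ^ 2 * fps_X) * gf_zq = part_gf ((\<lambda>k. monom 1 (Suc k))(1 := 0))"
    using part_gf_remove[of 1 "\<lambda>k. monom (1::real) (Suc k)"]
    by (simp add: gf_zq_def del: fun_upd_apply)
  then have "(1 - x_var ^ 2 * fps_X) * lift gf_zq = lift (part_gf ((\<lambda>k. monom 1 (Suc k))(1 := 0)))"
    by (simp only: lift_mult[symmetric] lift_diff[symmetric] lift_1[symmetric] lift_z[symmetric]
        lift_X[symmetric] lift_power[symmetric])
  moreover have "shift (lift gf_zq) $ n $ a = lift (part_gf ((\<lambda>k. monom 1 (Suc k))(1 := 0))) $ n $ a" for n a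
  proof -
    have "lift (part_gf ((\<lambda>k. monom 1 (Suc k))(1 := 0))) $ n $ a =
        real (card {p \<in> partitions_of n. 1 \<notin># p \<and> n + size p = a})"
      unfolding lift_part_gf_no_ones_nth using sum_mset_Suc[of _ n]
      by (intro arg_cong[where f = real] arg_cong[where f = card]) auto
    moreover have "shift (lift gf_zq) $ n $ a = real (card {p \<in> partitions_of n. 1 \<notin># p \<and> n + size p = a})"
    proof (cases "n \<le> a \<and> a \<le> 2 * n")
      case True
      then have "{p \<in> partitions_of (2 * n - a). 2 * n - a + size p = n} = {p \<in> partitions_of (2 * n - a). size p = a - n}"
        "{p \<in> partitions_of n. 1 \<notin># p \<and> n + size p = a} =
          {p \<in> partitions_of (2 * n - a + (a - n)). 1 \<notin># p \<and> size p = a - n}" by auto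
      with True card_partitions_image_Suc[of "2 * n - a" "a - n"] show ?thesis
        by (simp add: shift_nth zq)
    next
      case False
      have "{p \<in> partitions_of n. 1 \<notin># p \<and> n + size p = a} = {}"
        using False partitions_of_size_le[of _ n] by force
      moreover have "shift (lift gf_zq) $ n $ a = 0"
        using False by (auto simp: shift_nth zq card_eq_0_iff)
      ultimately show ?thesis by (simp only:) simp
    qed
    ultimately show ?thesis by simp
  qed
  ultimately show "shift (lift gf_zq) = (1 - x_var ^ 2 * fps_X) * lift gf_zq"
    by (intro fps_ext) simp
qed

text \<open>Each part is marked by \<open>1/z\<close> and shrinks by 1. A part 1 would lose its
  power of \<open>q\<close> altogether, so the factor \<open>1 - X\<close> removes it beforehand;
  then all parts are at least 2, which bounds the number of parts as \<open>shiftable\<close>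
  requires.\<close>

lemma shift_gf_qz: "shift ((1 - fps_X) * lift gf_qz) = lift gf_qz" and
  shiftable_gf_qz: "shiftable ((1 - fps_X) * lift gf_qz)"
proof -
  have "(1 - fps_X) * gf_qz = part_gf ((\<lambda>k. monom 1 (k - 1))(1 := 0))"
    using part_gf_remove[of 1 "\<lambda>k. monom (1::real) (k - 1)"]
    by (simp add: gf_qz_def monom_0 flip: one_pCons)
  then have "(1 - fps_X) * lift gf_qz = lift (part_gf ((\<lambda>k. monom 1 (k - 1))(1 := 0)))"
    by (simp only: lift_mult[symmetric] lift_diff[symmetric] lift_1[symmetric] lift_X[symmetric])
  moreover have "lift (part_gf ((\<lambda>k. monom 1 (k - 1))(1 := 0))) $ n $ a =
        real (card {p \<in> partitions_of n. 1 \<notin># p \<and> n - size p = a})" for n a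
    unfolding lift_part_gf_no_ones_nth using sum_mset_pred[of _ n]
    by (intro arg_cong[where f = real] arg_cong[where f = card]) auto
  ultimately have qz': "((1 - fps_X) * lift gf_qz) $ n $ a =
        real (card {p \<in> partitions_of n. 1 \<notin># p \<and> n - size p = a})" for n a by simp
  have qz: "lift gf_qz $ n $ a = real (card {p \<in> partitions_of n. n - size p = a})" for n a
    unfolding gf_qz_def lift_part_gf_nth using sum_mset_pred[of _ n]
    by (intro arg_cong[where f = real] arg_cong[where f = card]) auto
  have two: "2 * size p \<le> n" if p: "p \<in> partitions_of n" "1 \<notin># p" for p n
  proof -
    have "0 \<notin># p" using p(1) by (simp add: partitions_of_def)
    with p(2) have "2 * size p \<le> sum_mset p"
    proof (induction p)
      case (add k p)
      then have "k \<noteq> 0" "k \<noteq> 1" by auto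
      then have "k \<ge> 2" by linarith
      with add show ?case by simp
    qed simp
    with p show ?thesis by (simp add: partitions_of_def)
  qed
  show "shiftable ((1 - fps_X) * lift gf_qz)"
    unfolding shiftable_def qz' using two by (force simp: card_eq_0_iff)
  show "shift ((1 - fps_X) * lift gf_qz) = lift gf_qz"
  proof (rule fps_ext, rule fps_ext)
    fix n a
    show "shift ((1 - fps_X) * lift gf_qz) $ n $ a = lift gf_qz $ n $ a"
    proof (cases "a \<le> n")
      case True
      have "{p \<in> partitions_of n. n - size p = a} = {p \<in> partitions_of n. size p = n - a}"
        using True partitions_of_size_le[of _ n] by force
      moreover have "{p \<in> partitions_of (2 * n - a). 1 \<notin># p \<and> 2 * n - a - size p = n} =
          {p \<in> partitions_of (n + (n - a)). 1 \<notin># p \<and> size p = n - a}"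
      proof -
        have "2 * n - a = n + (n - a)" using True by simp
        then show ?thesis using partitions_of_size_le[of _ "n + (n - a)"] by force
      qed
      ultimately show ?thesis
        using True card_partitions_image_Suc[of n "n - a"] by (simp add: shift_nth qz qz')
    next
      case False
      then have "{p \<in> partitions_of n. n - size p = a} = {}" by auto
      moreover have "shift ((1 - fps_X) * lift gf_qz) $ n $ a = 0"
        using False by (auto simp: shift_nth qz' card_eq_0_iff)
      ultimately show ?thesis by (simp only: qz) simp
    qed
  qed
qed

text \<open>By \<open>crank_gf_product\<close> this is \<open>z (C gf_q / (1 - z))^3\<close>. Taking
  \<open>gf_zq * gf_qz\<close> in place of \<open>C\<close> leaves pure products, on which the shift
  acts factor by factor.\<close>

definition crank_cube :: "real fps fps" where
  "crank_cube = x_var * geom ^ 3 * (lift gf_zq * lift gf_qz) ^ 3"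

lemma shift_invariant_crank_cube: "shift_invariant crank_cube"
proof -
  let ?x = x_var
  define V E where "V = lift gf_zq * lift gf_qz" and "E = lift gf_zq * ((1 - fps_X) * lift gf_qz)"
  have E: "E = (1 - fps_X) * V" by (simp add: V_def E_def mult_ac)
  have good: "shiftable E"
    unfolding E_def by (intro shiftable_mult shiftable_gf_zq shiftable_gf_qz)
  have shift: "shift E = (1 - ?x ^ 2 * fps_X) * V"
    unfolding E_def V_def shift_mult[OF shiftable_gf_zq shiftable_gf_qz] shift_gf_zq shift_gf_qz
    by (simp only: mult_ac)
  have cube: "(1 - fps_X) ^ 3 * crank_cube = ?x * geom ^ 3 * E ^ 3"
    unfolding crank_cube_def V_def[symmetric] E by (simp only: power_mult_distrib mult_ac)
  have "shiftable (?x * geom ^ 3 * E ^ 3)"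
    by (intro shiftable_mult shiftable_power good shiftable_x shiftable_geom)
  moreover have "shift (?x * geom ^ 3 * E ^ 3) = ?x * fps_X * (1 - ?x) ^ 3 * crank_cube"
  proof -
    have "shift (?x * geom ^ 3 * E ^ 3) = ?x ^ 2 * fps_X * shift geom ^ 3 * ((1 - ?x ^ 2 * fps_X) * V) ^ 3"
      by (simp only: shift_mult shift_power shiftable_mult shiftable_power good shiftable_x shiftable_geom
          shift shift_x)
    also have "\<dots> = ?x ^ 2 * fps_X * ((1 - ?x ^ 2 * fps_X) * shift geom) ^ 3 * V ^ 3"
      by (simp only: power_mult_distrib mult_ac)
    also have "\<dots> = ?x ^ 2 * fps_X * ((1 - ?x) * geom) ^ 3 * V ^ 3"
      by (simp only: shift_geom geom_inverse)
    also have "\<dots> = ?x * fps_X * (1 - ?x) ^ 3 * crank_cube"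
      unfolding crank_cube_def V_def[symmetric] by (simp only: power_mult_distrib power2_eq_square mult_ac)
    finally show ?thesis .
  qed
  ultimately show ?thesis by (simp add: shift_invariant_def cube)
qed

lemma shift_gf_q: "shift (lift gf_q) = lift gf_q" and shiftable_gf_q: "shiftable (lift gf_q)"
proof -
  have q: "lift gf_q $ n $ a = (if a = n then real (card (partitions_of n)) else 0)" for n a
  proof -
    have "{p \<in> partitions_of n. (\<Sum>k\<in>#p. k) = a} = (if a = n then partitions_of n else {})"
      by (auto simp: partitions_of_def)
    then show ?thesis unfolding gf_q_def lift_part_gf_nth by simp
  qed
  show "shiftable (lift gf_q)"
    by (auto simp: shiftable_def q)
  show "shift (lift gf_q) = lift gf_q"
    by (rule fps_ext, rule fps_ext) (auto simp: shift_nth q)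
qed

section \<open>Comparison of the two sides at the pole\<close>

lemma poly_cube_dvd:
  fixes p :: "real poly"
  assumes "poly p 1 = 0" "poly (pderiv p) 1 = 0" "poly (pderiv (pderiv p)) 1 = 0"
  obtains r where "p = [:1, - 1:] ^ 3 * r"
proof -
  let ?u = "[:1, - 1:] :: real poly"
  have dvd: "\<exists>r. f = ?u * r" if "poly f 1 = 0" for f
  proof -
    from that have "[:- 1, 1:] dvd f" by (simp add: poly_eq_0_iff_dvd)
    then obtain r where "f = [:- 1, 1:] * r" by (rule dvdE)
    then have "f = ?u * (- r)" by simp
    then show ?thesis by blast
  qed
  have "pderiv ?u = - 1" by (simp add: pderiv_pCons one_pCons)
  then have d: "pderiv (?u * f) = ?u * pderiv f - f" for f
    by (simp only: pderiv_mult mult_minus_right mult_1_right diff_conv_add_uminus)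
  obtain p1 where p1: "p = ?u * p1" using dvd assms(1) by blast
  then have "poly p1 1 = 0" using assms(2) by (simp only: d) simp
  then obtain p2 where p2: "p1 = ?u * p2" using dvd by blast
  then have "poly p2 1 = 0"
    using assms(3) unfolding p1 by (simp only: d pderiv_diff) simp
  then obtain p3 where "p2 = ?u * p3" using dvd by blast
  with p1 p2 have "p = ?u ^ 3 * p3" by (simp only: power3_eq_cube mult.assoc)
  then show thesis by (rule that)
qed

theorem rank_crank_pde: "gf_q ^ 2 * rank_op = 2 * z_fps * crank_gf ^ 3"
proof -
  \<comment> \<open>The fifth power combines the \<open>gf_q ^ 2\<close> of the claim with the
    \<open>gf_q ^ 3\<close> contained in \<open>(gf_zq * gf_qz) ^ 3\<close>.\<close>
  define D where "D = gf_q ^ 5 * rank_op - 2 * z_fps * (gf_zq * gf_qz) ^ 3"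
  define f where "f = lift gf_q ^ 5 * rank_heat - 2 * crank_cube"
  have lift_D: "(1 - x_var) ^ 3 * f = lift D"
  proof -
    have "(1 - x_var) ^ 3 * f = lift gf_q ^ 5 * ((1 - x_var) ^ 3 * rank_heat) -
        2 * x_var * ((1 - x_var) * geom) ^ 3 * (lift gf_zq * lift gf_qz) ^ 3"
      unfolding f_def crank_cube_def by algebra
    also have "\<dots> = lift D"
      unfolding rank_heat_eq geom_inverse
      by (simp add: D_def lift_diff lift_mult lift_power lift_numeral lift_z)
    finally show ?thesis .
  qed
  have "shift_invariant f"
    unfolding f_def
  proof (intro shift_invariant_diff shift_invariant_mult shift_invariant_rank_heat shift_invariant_crank_cube)
    have [simp]: "shiftable 2" "shift 2 = 2"
      using shiftable_add[OF shiftable_1 shiftable_1] shift_add[of 1 1] by simp_all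
    show "shiftable 2" "shift 2 = 2" by simp_all
    show "shiftable (lift gf_q ^ 5)" "shift (lift gf_q ^ 5) = lift gf_q ^ 5"
      by (simp_all add: shiftable_power shift_power shiftable_gf_q shift_gf_q)
  qed
  \<comment> \<open>\<open>D\<close> vanishes to third order at \<open>z = 1\<close>, so dividing it
    by \<open>(1 - x)^3\<close> leaves a polynomial in \<open>x\<close> as the coefficient of each
    power of \<open>X\<close>.\<close>
  moreover have "\<exists>M. \<forall>m\<ge>M. zq_coeff f m n = 0" for n
  proof (cases "n \<ge> 0")
    case True
    define N where "N = nat n"
    let ?P = partition_gf
    have V: "gf_zq * gf_qz = crank_gf * gf_q" by (rule crank_gf_product[symmetric])
    have C: "at_1 crank_gf = ?P" "at_1 (z_deriv crank_gf) = 0"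
      "at_1 (z_deriv (z_deriv crank_gf)) = 2 * sigma_gf 1 * ?P"
      using moment_crank_gf_0 moment_crank_gf_odd[of 1] moment_crank_gf_Suc[of 1]
      by (simp_all add: moment_def numeral_2_eq_2)
    have R: "at_1 rank_gf = ?P" "at_1 (fps_XD rank_gf) = sigma_gf 1 * ?P"
      using moment_rank_gf_0 by (simp_all add: moment_def at_1_XD fps_XD_partition_gf)
    note simps = z_deriv_add z_deriv_diff z_deriv_mult power3_eq_cube power2_eq_square
    have q5: "z_deriv (gf_q ^ 5) = 0" by (simp add: eval_nat_numeral z_deriv_mult)
    have D0: "at_1 D = 0"
      by (simp add: D_def V rank_op_def C R) algebra
    \<comment> \<open>The first and second \<open>z\<close>-derivatives of \<open>rank_gf\<close>
      cancel at \<open>z = 1\<close>, in this order and in the next; only \<open>R(1) = P\<close>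
      and its \<open>q\<close>-derivative remain.\<close>
    have "at_1 (z_deriv rank_op) = 2 * ?P"
      by (simp add: rank_op_def simps R)
    then have D1: "at_1 (z_deriv D) = 0"
      by (simp add: D_def V simps q5 C) (simp add: eval_nat_numeral)
    \<comment> \<open>The first term is \<open>2 * 6\<close> times the \<open>q\<close>-derivative
      of \<open>P\<close>. It balances the second moment of the crank, which enters the cube three
      times.\<close>
    have "at_1 (z_deriv (z_deriv rank_op)) = 12 * sigma_gf 1 * ?P + 2 * ?P"
      by (simp add: rank_op_def simps R algebra_simps)
    then have D2: "at_1 (z_deriv (z_deriv D)) = 0"
      by (simp add: D_def V simps q5 C) (simp add: eval_nat_numeral algebra_simps)
    have "poly (D $ N) 1 = 0" using arg_cong[OF D0, of "\<lambda>f. f $ N"] by (simp add: at_1_nth)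
    moreover from this have "poly (pderiv (D $ N)) 1 = 0"
      using arg_cong[OF D1, of "\<lambda>f. f $ N"] by (simp add: at_1_nth z_deriv_nth poly_monom)
    moreover from calculation have "poly (pderiv (pderiv (D $ N))) 1 = 0"
      using arg_cong[OF D2, of "\<lambda>f. f $ N"]
      by (simp add: at_1_nth z_deriv_nth poly_monom pderiv_diff pderiv_mult pderiv_monom)
    ultimately obtain r where r: "D $ N = [:1, - 1:] ^ 3 * r" by (rule poly_cube_dvd)
    have "(1 - fps_X) ^ 3 * f $ N = fps_of_poly (D $ N)"
    proof -
      have "(1 - x_var) ^ 3 = fps_const ((1 - fps_X) ^ 3)"
        by (simp add: fps_const_power[symmetric] fps_const_sub[symmetric] del: fps_const_power fps_const_sub)
      with arg_cong[OF lift_D, of "\<lambda>f. f $ N"] show ?thesis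
        by (simp add: lift_nth del: fps_const_power)
    qed
    also have "\<dots> = (1 - fps_X) ^ 3 * fps_of_poly r"
      unfolding r by (simp add: fps_of_poly_mult fps_of_poly_power fps_of_poly_pCons)
    finally have "f $ N = fps_of_poly r"
      by (metis mult_left_cancel power_not_zero right_minus_eq fps_X_neq_one)
    then have "zq_coeff f m n = 0" if "m \<ge> int (degree r) + 1" for m
      using that True coeff_eq_0[of r "nat (n + m)"] by (simp add: zq_coeff_def N_def[symmetric])
    then show ?thesis by blast
  qed (auto simp: zq_coeff_def)
  ultimately have "f = 0" by (rule shift_invariant_unique)
  moreover have "lift 0 = 0" by (rule fps_ext) (simp add: lift_nth)
  ultimately have "lift D = lift 0" using lift_D by simp
  then have "D = 0" by (rule lift_inj)
  then have "gf_q ^ 3 * (gf_q ^ 2 * rank_op) = gf_q ^ 3 * (2 * z_fps * crank_gf ^ 3)"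
    unfolding D_def crank_gf_product[symmetric] by algebra
  moreover have "gf_q ^ 3 \<noteq> 0" using gf_q_nonzero by (rule power_not_zero)
  ultimately show ?thesis using mult_left_cancel by blast
qed

section \<open>Elimination\<close>

text \<open>Here the series are opaque elements of a field with a derivation, so
  \<open>algebra\<close> sees ordinary polynomials. \<open>D\<close> stands for
  \<open>q d/dq\<close>, \<open>S\<close> for the divisor series, and \<open>C\<close>,
  \<open>R\<close>, \<open>K\<close> for the moments of the crank, the rank and the cubed crank
  series. The constants in \<open>K_j\<close> are three times those in \<open>C_j\<close>, because
  cubing triples the logarithmic derivative.\<close>

locale moment_algebra =
  fixes D :: "'a::field_char_0 \<Rightarrow> 'a" and P :: 'a and S C R K :: "nat \<Rightarrow> 'a"
  assumes D_add: "D (f + g) = D f + D g"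
    and D_mult: "D (f * g) = D f * g + f * D g"
    and P_nonzero: "P \<noteq> 0"
    and D_P: "D P = S 1 * P"
    and C_0: "C 0 = P" and K_0: "K 0 = P ^ 3" and R_0: "R 0 = P"
    and S_7: "120 * (S 3 * S 3) = S 7 - S 3"
    and conv_2: "6 * D (S 1) = 5 * S 3 + S 1 - 12 * (S 1 * S 1)"
    and conv_4: "30 * D (S 3) = 21 * S 5 - S 1 + 10 * S 3 - 240 * (S 1 * S 3)"
    and conv_6: "42 * D (S 5) = 27 * S 7 + S 1 - 7 * S 3 + 21 * S 5 - 504 * (S 1 * S 5) - 840 * (S 3 *
     S 3)"
    and conv_8: "90 * D (S 7) = 55 * S 9 - 3 * S 1 + 20 * S 3 - 42 * S 5 + 60 * S 7 - 1440 * (S 1 * S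
     7) - 10080 * (S 3 * S 5)"
    and conv_10: "66 * D (S 9) = 39 * S 11 + 5 * S 1 - 33 * S 3 + 66 * S 5 - 66 * S 7 + 55 * S 9 - 1320
     * (S 1 * S 9) - 15840 * (S 3 * S 7) - 16632 * (S 5 * S 5)"
    and conv_12: "2730 * D (S 11) = 1575 * S 13 - 691 * S 1 + 4550 * S 3 - 9009 * S 5 + 8580 * S 7 -
     5005 * S 9 + 2730 * S 11 - 65520 * (S 1 * S 11) - 1201200 * (S 3 * S 9) - 4324320 * (S 5 * S 7)"
    and C_2: "C 2 = 2 * (S 1 * C 0)"
    and C_4: "C 4 = 2 * (S 3 * C 0) + 6 * (S 1 * C 2)"
    and C_6: "C 6 = 2 * (S 5 * C 0) + 20 * (S 3 * C 2) + 10 * (S 1 * C 4)"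
    and C_8: "C 8 = 2 * (S 7 * C 0) + 42 * (S 5 * C 2) + 70 * (S 3 * C 4) + 14 * (S 1 * C 6)"
    and C_10: "C 10 = 2 * (S 9 * C 0) + 72 * (S 7 * C 2) + 252 * (S 5 * C 4) + 168 * (S 3 * C 6) + 18 * (S
     1 * C 8)"
    and C_12: "C 12 = 2 * (S 11 * C 0) + 110 * (S 9 * C 2) + 660 * (S 7 * C 4) + 924 * (S 5 * C 6) + 330 *
     (S 3 * C 8) + 22 * (S 1 * C 10)"
    and C_14: "C 14 = 2 * (S 13 * C 0) + 156 * (S 11 * C 2) + 1430 * (S 9 * C 4) + 3432 * (S 7 * C 6) +
     2574 * (S 5 * C 8) + 572 * (S 3 * C 10) + 26 * (S 1 * C 12)"
    and K_2: "K 2 = 6 * (S 1 * K 0)"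
    and K_4: "K 4 = 6 * (S 3 * K 0) + 18 * (S 1 * K 2)"
    and K_6: "K 6 = 6 * (S 5 * K 0) + 60 * (S 3 * K 2) + 30 * (S 1 * K 4)"
    and K_8: "K 8 = 6 * (S 7 * K 0) + 126 * (S 5 * K 2) + 210 * (S 3 * K 4) + 42 * (S 1 * K 6)"
    and K_10: "K 10 = 6 * (S 9 * K 0) + 216 * (S 7 * K 2) + 756 * (S 5 * K 4) + 504 * (S 3 * K 6) + 54 *
     (S 1 * K 8)"
    and K_12: "K 12 = 6 * (S 11 * K 0) + 330 * (S 9 * K 2) + 1980 * (S 7 * K 4) + 2772 * (S 5 * K 6) + 990
     * (S 3 * K 8) + 66 * (S 1 * K 10)"
    and K_14: "K 14 = 6 * (S 13 * K 0) + 468 * (S 11 * K 2) + 4290 * (S 9 * K 4) + 10296 * (S 7 * K 6) +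
     7722 * (S 5 * K 8) + 1716 * (S 3 * K 10) + 78 * (S 1 * K 12)"
    and W_4: "P ^ 2 * (3 * R 4 - 3 * R 2 + 36 * D (R 2) + 6 * D (R 0)) = K 4"
    and W_6: "P ^ 2 * (10 * R 6 - 5 * R 4 - 5 * R 2 + 90 * D (R 4) + 90 * D (R 2) + 6 * D (R 0)) = K 6"
    and W_8: "P ^ 2 * (21 * R 8 + 14 * R 6 - 28 * R 4 - 7 * R 2 + 168 * D (R 6) + 420 * D (R 4) + 168 * D
     (R 2) + 6 * D (R 0)) = K 8"
    and W_10: "P ^ 2 * (36 * R 10 + 90 * R 8 - 42 * R 6 - 75 * R 4 - 9 * R 2 + 270 * D (R 8) + 1260 * D (R
     6) + 1260 * D (R 4) + 270 * D (R 2) + 6 * D (R 0)) = K 10"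
    and W_12: "P ^ 2 * (55 * R 12 + 275 * R 10 + 132 * R 8 - 297 * R 6 - 154 * R 4 - 11 * R 2 + 396 * D (R
     10) + 2970 * D (R 8) + 5544 * D (R 6) + 2970 * D (R 4) + 396 * D (R 2) + 6 * D (R 0)) = K 12"
    and W_14: "P ^ 2 * (78 * R 14 + 637 * R 12 + 1001 * R 10 - 429 * R 8 - 1001 * R 6 - 273 * R 4 - 13 * R
     2 + 546 * D (R 12) + 6006 * D (R 10) + 18018 * D (R 8) + 18018 * D (R 6) + 6006 * D (R 4) + 546 * D
     (R 2) + 6 * D (R 0)) = K 14"
begin

abbreviation "p \<equiv> S 1"
abbreviation "r \<equiv> S 3"
abbreviation "s \<equiv> S 5"

lemma D_minus: "D (- f) = - D f"
proof -
  have "D 0 = 0" using D_add[of 0 0] by simp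
  then show ?thesis using D_add[of f "- f"] minus_unique[of "D f" "D (- f)"] by simp
qed

lemma D_diff: "D (f - g) = D f - D g"
  using D_add[of f "- g"] by (simp add: D_minus)

lemma D_one: "D 1 = 0"
  using D_mult[of 1 1] by simp

lemma D_numeral: "D (numeral k) = 0"
proof -
  have "D (of_nat m) = 0" for m
    using D_add[of 0 0] by (induction m) (simp_all add: D_add D_one)
  from this[of "numeral k"] show ?thesis by simp
qed

lemma D_power: "D (f ^ numeral k) = numeral k * f ^ pred_numeral k * D f"
proof -
  have "D (f ^ Suc m) = of_nat (Suc m) * f ^ m * D f" for m
    by (induction m) (simp_all add: D_mult algebra_simps)
  moreover have "Suc (pred_numeral k) = numeral k" by (simp add: numeral_eq_Suc)
  ultimately show ?thesis by (metis of_nat_numeral)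
qed

lemma D_divide: "D (f / numeral k) = D f / numeral k"
proof -
  have "numeral k * D (f / numeral k) = D f"
    using D_mult[of "numeral k" "f / numeral k"] by (simp add: D_numeral)
  then show ?thesis by (simp add: field_simps)
qed

lemmas D_rules = D_add D_diff D_minus D_mult D_P D_power D_divide D_numeral D_one
  pred_numeral_simps BitM.simps Num.numeral_One power_one_right

lemma cancel: "m * f = m * g \<Longrightarrow> m \<noteq> 0 \<Longrightarrow> f = g" for m f g :: 'a
  by simp

text \<open>With \<open>E_2 = 1 - 24 p\<close>, \<open>E_4 = 1 + 240 r\<close>,
  \<open>E_6 = 1 - 504 s\<close>, this together with \<open>D_r\<close> and \<open>D_s\<close> is
  Ramanujan's system. It makes the polynomials in \<open>p\<close>, \<open>r\<close>,
  \<open>s\<close> closed under \<open>D\<close>.\<close>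

lemma D_p: "D p = ((5*r + p - 12*p^2) / 6)"
  by (rule cancel[of 6]) (unfold conv_2, algebra, simp)

lemma D_r: "D r = ((21*s + 10*r - p - 240*p*r) / 30)"
  by (rule cancel[of 30]) (unfold conv_4, algebra, simp)

lemma S_7': "S 7 = (r + 120*r^2)"
  using S_7 by (simp add: algebra_simps power2_eq_square)

lemma D_s: "D s = ((21*s + 20*r + 2400*r^2 + p - 504*p*s) / 42)"
  by (rule cancel[of 42]) (unfold conv_6 S_7', algebra, simp)

text \<open>The product rule gives \<open>D (S 7)\<close> from the polynomial for
  \<open>S 7\<close>, while \<open>conv_8\<close> expresses it through \<open>S 9\<close>.
  Comparison yields \<open>S 9\<close>; \<open>S 11\<close> and \<open>S 13\<close> are found in the
  same way.\<close>

lemma D_S_7: "D (S 7) = ((21*s + 10*r + 5040*r*s + 2400*r^2 - p - 480*p*r - 57600*p*r^2) / 30)"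
  unfolding S_7' by (simp only: D_rules D_p D_r D_s) algebra

text \<open>Equivalent to \<open>E_10 = E_4 E_6\<close>.\<close>

lemma S_9: "S 9 = ((21*s - 10*r + 5040*r*s) / 11)"
proof (rule cancel[of 55])
  have "55 * S 9 = 90 * D (S 7) - (- 3 * S 1 + 20 * S 3 - 42 * S 5 + 60 * S 7 - 1440 * (S 1 * S 7) -
     10080 * (S 3 * S 5))"
    using conv_8 by simp
  then show "55 * S 9 = 55 * ((21*s - 10*r + 5040*r*s) / 11)"
    unfolding D_S_7 unfolding S_7' by algebra
qed simp

lemma D_S_9: "D (S 9) = ((21*s + 21168*s^2 + 40*r + 25200*r*s + 21600*r^2 + 1728000*r^3 + 5*p -
     2520*p*s + 1200*p*r - 604800*p*r*s) / 66)"
  unfolding S_9 by (simp only: D_rules D_p D_r D_s) algebra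

text \<open>Equivalent to \<open>691 E_12 = 441 E_4^3 + 250 E_6^2\<close>.\<close>

lemma S_11: "S 11 = ((-50*s + 12600*s^2 + 63*r + 15120*r^2 + 1209600*r^3) / 13)"
proof (rule cancel[of 39])
  have "39 * S 11 = 66 * D (S 9) - (5 * S 1 - 33 * S 3 + 66 * S 5 - 66 * S 7 + 55 * S 9 - 1320 * (S 1 * S
     9) - 15840 * (S 3 * S 7) - 16632 * (S 5 * S 5))"
    using conv_10 by simp
  then show "39 * S 11 = 39 * ((-50*s + 12600*s^2 + 63*r + 15120*r^2 + 1209600*r^3) / 13)"
    unfolding D_S_9 unfolding S_7' S_9 by algebra
qed simp

lemma D_S_11: "D (S 11) = ((4011*s + 2646000*s^2 - 590*r + 6965280*r*s + 1516800*r^2 + 835833600*r^2*s +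
     254016000*r^3 - 691*p + 252000*p*s - 63504000*p*s^2 - 317520*p*r - 76204800*p*r^2 -
     6096384000*p*r^3) / 2730)"
  unfolding S_11 by (simp only: D_rules D_p D_r D_s) algebra

text \<open>Equivalent to \<open>E_14 = E_4^2 E_6\<close>.\<close>

lemma S_13: "S 13 = (21*s - 20*r + 10080*r*s - 2400*r^2 + 1209600*r^2*s)"
proof (rule cancel[of 1575])
  have "1575 * S 13 = 2730 * D (S 11) - (- 691 * S 1 + 4550 * S 3 - 9009 * S 5 + 8580 * S 7 - 5005 * S 9
     + 2730 * S 11 - 65520 * (S 1 * S 11) - 1201200 * (S 3 * S 9) - 4324320 * (S 5 * S 7))"
    using conv_12 by simp
  then show "1575 * S 13 = 1575 * (21*s - 20*r + 10080*r*s - 2400*r^2 + 1209600*r^2*s)"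
    unfolding D_S_11 unfolding S_7' S_9 S_11 by algebra
qed simp

section \<open>Crank moments as polynomials in the divisor series\<close>

lemma C_2': "C 2 = P * (2*p)"
  unfolding C_2 C_0 S_7' S_9 S_11 S_13 by algebra

lemma C_4': "C 4 = P * (2*r + 12*p^2)"
  unfolding C_4 C_0 C_2' S_7' S_9 S_11 S_13 by algebra

lemma C_6': "C 6 = P * (2*s + 60*p*r + 120*p^3)"
  unfolding C_6 C_0 C_2' C_4' S_7' S_9 S_11 S_13 by algebra

lemma C_8': "C 8 = P * (2*r + 380*r^2 + 112*p*s + 1680*p^2*r + 1680*p^4)"
  unfolding C_8 C_0 C_2' C_4' C_6' S_7' S_9 S_11 S_13 by algebra

lemma C_10': "C 10 = P * ((42*s - 20*r + 19320*r*s + 1980*p*r + 376200*p*r^2 + 55440*p^2*s +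
     554400*p^3*r + 332640*p^5) / 11)"
  unfolding C_10 C_0 C_2' C_4' C_6' C_8' S_7' S_9 S_11 S_13 by algebra

lemma C_12': "C 12 = P * ((-100*s + 49224*s^2 + 126*r + 55980*r^2 + 6108600*r^3 + 6552*p*s - 3120*p*r +
     3013920*p*r*s + 154440*p^2*r + 29343600*p^2*r^2 + 2882880*p^3*s + 21621600*p^4*r + 8648640*p^6) /
     13)"
  unfolding C_12 C_0 C_2' C_4' C_6' C_8' C_10' S_7' S_9 S_11 S_13 by algebra

lemma C_14': "C 14 = P * (42*s - 40*r + 39816*r*s - 8440*r^2 + 6536040*r^2*s - 1400*p*s + 689136*p*s^2
     + 1764*p*r + 783720*p*r^2 + 85520400*p*r^3 + 45864*p^2*s - 21840*p^2*r + 21097440*p^2*r*s +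
     720720*p^3*r + 136936800*p^3*r^2 + 10090080*p^4*s + 60540480*p^5*r + 17297280*p^7)"
  unfolding C_14 C_0 C_2' C_4' C_6' C_8' C_10' C_12' S_7' S_9 S_11 S_13 by algebra

lemma K_2': "K 2 = P ^ 3 * (6*p)"
  unfolding K_2 K_0 S_7' S_9 S_11 S_13 by algebra

lemma K_4': "K 4 = P ^ 3 * (6*r + 108*p^2)"
  unfolding K_4 K_0 K_2' S_7' S_9 S_11 S_13 by algebra

lemma K_6': "K 6 = P ^ 3 * (6*s + 540*p*r + 3240*p^3)"
  unfolding K_6 K_0 K_2' K_4' S_7' S_9 S_11 S_13 by algebra

lemma K_8': "K 8 = P ^ 3 * (6*r + 1980*r^2 + 1008*p*s + 45360*p^2*r + 136080*p^4)"
  unfolding K_8 K_0 K_2' K_4' K_6' S_7' S_9 S_11 S_13 by algebra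

lemma K_10': "K 10 = P ^ 3 * ((126*s - 60*r + 113400*r*s + 17820*p*r + 5880600*p*r^2 + 1496880*p^2*s +
     44906400*p^3*r + 80831520*p^5) / 11)"
  unfolding K_10 K_0 K_2' K_4' K_6' K_8' S_7' S_9 S_11 S_13 by algebra

lemma K_12': "K 12 = P ^ 3 * ((-300*s + 291816*s^2 + 378*r + 322380*r^2 + 51273000*r^3 + 58968*p*s -
     28080*p*r + 53071200*p*r*s + 4169880*p^2*r + 1376060400*p^2*r^2 + 233513280*p^3*s + 5254048800*p^4*r
     + 6304858560*p^6) / 13)"
  unfolding K_12 K_0 K_2' K_4' K_6' K_8' K_10' S_7' S_9 S_11 S_13 by algebra

lemma K_14': "K 14 = P ^ 3 * (126*s - 120*r + 237384*r*s - 47160*r^2 + 59444280*r^2*s - 12600*p*s +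
     12256272*p*s^2 + 15876*p*r + 13539960*p*r^2 + 2153466000*p*r^3 + 1238328*p^2*s - 589680*p^2*r +
     1114495200*p^2*r*s + 58378320*p^3*r + 19264845600*p^3*r^2 + 2451889440*p^4*s + 44134009920*p^5*r +
     37829151360*p^7)"
  unfolding K_14 K_0 K_2' K_4' K_6' K_8' K_10' K_12' S_7' S_9 S_11 S_13 by algebra

text \<open>\<open>W_4\<close> is solved for \<open>R 4\<close> after cancelling
  \<open>P ^ 2\<close>. Continuing upwards, each \<open>R j\<close> becomes \<open>P\<close> times a
  polynomial in \<open>p\<close>, \<open>r\<close>, \<open>s\<close> plus a combination of iterated
  derivatives of \<open>R 2\<close>. The multiplier 3 is the value of
  \<open>(j - 1) (j - 2) / 2\<close> at \<open>j = 4\<close>.\<close>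

lemma R_4: "R 4 = P * (2*r - 2*p + 36*p^2) + R 2 - 12 * D (R 2)"
  (is "_ = ?r")
proof (rule cancel[of 3])
  have "3 * R 4 + (- 3 * R 2 + 36 * D (R 2) + 6 * D (R 0)) = P * (6*r + 108*p^2)"
    (is "?l + ?rest = ?k")
  proof (rule cancel[of "P ^ 2"])
    have "P ^ 2 * (?l + ?rest) = K 4"
      unfolding W_4[symmetric] by algebra
    also have "\<dots> = P ^ 2 * ?k"
      unfolding K_4' by algebra
    finally show "P ^ 2 * (?l + ?rest) = P ^ 2 * ?k" .
  qed (simp add: P_nonzero)
  then have "?l = ?k - ?rest"
    by (simp only: eq_diff_eq)
  also have "\<dots> = 3 * ?r"
    unfolding R_0 D_P by algebra
  finally show "?l = 3 * ?r" .
qed simp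

lemma D_R_4: "D (R 4) = P * ((7*s - 5*r - 2*p + 230*p*r + 70*p^2 - 540*p^3) / 5) + D (R 2) - 12 * D (D
     (R 2))"
  unfolding R_4 by (simp only: D_rules D_p D_r D_s) algebra

lemma R_6: "R 6 = P * (-12*s + 10*r + 2*p - 360*p*r - 108*p^2 + 1296*p^3) + R 2 - 24 * D (R 2) + 108
     * D (D (R 2))"
  (is "_ = ?r")
proof (rule cancel[of 10])
  have "10 * R 6 + (- 5 * R 4 - 5 * R 2 + 90 * D (R 4) + 90 * D (R 2) + 6 * D (R 0)) = P * (6*s + 540*p*r
     + 3240*p^3)"
    (is "?l + ?rest = ?k")
  proof (rule cancel[of "P ^ 2"])
    have "P ^ 2 * (?l + ?rest) = K 6"
      unfolding W_6[symmetric] by algebra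
    also have "\<dots> = P ^ 2 * ?k"
      unfolding K_6' by algebra
    finally show "P ^ 2 * (?l + ?rest) = P ^ 2 * ?k" .
  qed (simp add: P_nonzero)
  then have "?l = ?k - ?rest"
    by (simp only: eq_diff_eq)
  also have "\<dots> = 10 * ?r"
    unfolding R_0 D_P D_R_4 unfolding R_4 by algebra
  finally show "?l = 10 * ?r" .
qed simp

lemma D_R_6: "D (R 6) = P * ((7*s - 5*r - 6900*r^2 - 2*p - 840*p*s - 3010*p*r - 182*p^2 + 45360*p^2*r +
     6804*p^3 - 45360*p^4) / 7) + D (R 2) - 24 * D (D (R 2)) + 108 * D (D (D (R 2)))"
  unfolding R_6 by (simp only: D_rules D_p D_r D_s) algebra

lemma R_8: "R 8 = P * (-28*s + 22*r + 7980*r^2 + 6*p + 1008*p*s + 2760*p*r + 48*p^2 - 49680*p^2*r -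
     6480*p^3 + 58320*p^4) + R 2 - 36 * D (R 2) + 360 * D (D (R 2)) - 864 * D (D (D (R 2)))"
  (is "_ = ?r")
proof (rule cancel[of 21])
  have "21 * R 8 + (14 * R 6 - 28 * R 4 - 7 * R 2 + 168 * D (R 6) + 420 * D (R 4) + 168 * D (R 2) + 6 * D
     (R 0)) = P * (6*r + 1980*r^2 + 1008*p*s + 45360*p^2*r + 136080*p^4)"
    (is "?l + ?rest = ?k")
  proof (rule cancel[of "P ^ 2"])
    have "P ^ 2 * (?l + ?rest) = K 8"
      unfolding W_8[symmetric] by algebra
    also have "\<dots> = P ^ 2 * ?k"
      unfolding K_8' by algebra
    finally show "P ^ 2 * (?l + ?rest) = P ^ 2 * ?k" .
  qed (simp add: P_nonzero)
  then have "?l = ?k - ?rest"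
    by (simp only: eq_diff_eq)
  also have "\<dots> = 21 * ?r"
    unfolding R_0 D_P D_R_4 D_R_6 unfolding R_4 R_6 by algebra
  finally show "?l = 21 * ?r" .
qed simp

lemma D_R_8: "D (R 8) = P * ((7*s - 5*r + 60060*r*s + 30100*r^2 - 2*p + 14560*p*s + 6270*p*r -
     724500*p*r^2 - 290*p^2 - 239400*p^2*s - 370800*p^2*r - 8640*p^3 + 3704400*p^3*r + 356400*p^4 -
     2041200*p^5) / 5) + D (R 2) - 36 * D (D (R 2)) + 360 * D (D (D (R 2))) - 864 * D (D (D (D (R 2))))"
  unfolding R_8 by (simp only: D_rules D_p D_r D_s) algebra

lemma R_10: "R 10 = P * ((-420*s + 310*r - 987840*r*s - 336600*r^2 + 110*p - 221760*p*s - 35640*p*r +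
     12117600*p*r^2 + 7524*p^2 + 3991680*p^2*s + 4989600*p^2*r + 4752*p^3 - 59875200*p^3*r - 4989600*p^4
     + 35925120*p^5) / 11) + R 2 - 48 * D (R 2) + 756 * D (D (R 2)) - 4320 * D (D (D (R 2))) + 6480 * D
     (D (D (D (R 2))))"
  (is "_ = ?r")
proof (rule cancel[of 36])
  have "36 * R 10 + (90 * R 8 - 42 * R 6 - 75 * R 4 - 9 * R 2 + 270 * D (R 8) + 1260 * D (R 6) + 1260 * D
     (R 4) + 270 * D (R 2) + 6 * D (R 0)) = P * ((126*s - 60*r + 113400*r*s + 17820*p*r + 5880600*p*r^2 +
     1496880*p^2*s + 44906400*p^3*r + 80831520*p^5) / 11)"
    (is "?l + ?rest = ?k")
  proof (rule cancel[of "P ^ 2"])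
    have "P ^ 2 * (?l + ?rest) = K 10"
      unfolding W_10[symmetric] by algebra
    also have "\<dots> = P ^ 2 * ?k"
      unfolding K_10' by algebra
    finally show "P ^ 2 * (?l + ?rest) = P ^ 2 * ?k" .
  qed (simp add: P_nonzero)
  then have "?l = ?k - ?rest"
    by (simp only: eq_diff_eq)
  also have "\<dots> = 36 * ?r"
    unfolding R_0 D_P D_R_4 D_R_6 D_R_8 unfolding R_4 R_6 R_8 by algebra
  finally show "?l = 36 * ?r" .
qed simp

lemma D_R_10: "D (R 10) = P * ((7*s - 691488*s^2 - 5*r - 1479240*r*s - 748500*r^2 - 46350000*r^3 - 2*p -
     135240*p*s - 114130*p*r + 42386400*p*r*s + 10791000*p*r^2 - 1694*p^2 + 9702000*p^2*s + 4752000*p^2*r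
     - 127591200*p^2*r^2 - 91476*p^3 - 101787840*p^3*s - 121413600*p^3*r - 1354320*p^4 + 928065600*p^4*r
     + 64864800*p^5 - 323326080*p^6) / 11) + D (R 2) - 48 * D (D (R 2)) + 756 * D (D (D (R 2))) - 4320 *
     D (D (D (D (R 2)))) + 6480 * D (D (D (D (D (R 2)))))"
  unfolding R_10 by (simp only: D_rules D_p D_r D_s) algebra

lemma R_12: "R 12 = P * ((-828*s + 5889240*s^2 + 646*r + 9991800*r*s + 5180580*r^2 + 395328600*r^3 +
     182*p + 543816*p*s + 720720*p*r - 359704800*p*r*s - 61705800*p*r^2 + 27144*p^2 - 72530640*p^2*s -
     24724440*p^2*r + 1110704400*p^2*r^2 + 1058616*p^3 + 870367680*p^3*s + 866829600*p^3*r - 2358720*p^4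
     - 7801466400*p^4*r - 477640800*p^5 + 2865844800*p^6) / 13) + R 2 - 60 * D (R 2) + 1296 * D (D (R 2))
     - 12096 * D (D (D (R 2))) + 45360 * D (D (D (D (R 2)))) - 46656 * D (D (D (D (D (R 2)))))"
  (is "_ = ?r")
proof (rule cancel[of 55])
  have "55 * R 12 + (275 * R 10 + 132 * R 8 - 297 * R 6 - 154 * R 4 - 11 * R 2 + 396 * D (R 10) + 2970 *
     D (R 8) + 5544 * D (R 6) + 2970 * D (R 4) + 396 * D (R 2) + 6 * D (R 0)) = P * ((-300*s + 291816*s^2
     + 378*r + 322380*r^2 + 51273000*r^3 + 58968*p*s - 28080*p*r + 53071200*p*r*s + 4169880*p^2*r +
     1376060400*p^2*r^2 + 233513280*p^3*s + 5254048800*p^4*r + 6304858560*p^6) / 13)"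
    (is "?l + ?rest = ?k")
  proof (rule cancel[of "P ^ 2"])
    have "P ^ 2 * (?l + ?rest) = K 12"
      unfolding W_12[symmetric] by algebra
    also have "\<dots> = P ^ 2 * ?k"
      unfolding K_12' by algebra
    finally show "P ^ 2 * (?l + ?rest) = P ^ 2 * ?k" .
  qed (simp add: P_nonzero)
  then have "?l = ?k - ?rest"
    by (simp only: eq_diff_eq)
  also have "\<dots> = 55 * ?r"
    unfolding R_0 D_P D_R_4 D_R_6 D_R_8 D_R_10 unfolding R_4 R_6 R_8 R_10 by algebra
  finally show "?l = 55 * ?r" .
qed simp

lemma D_R_12: "D (R 12) = P * ((1337*s + 450922500*s^2 - 955*r + 757445220*r*s + 306775200*r^2 +
     42122222100*r^2*s + 32020348500*r^3 - 382*p + 28823760*p*s - 13553605800*p*s^2 + 19339810*p*r -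
     26488753200*p*r*s - 12252914100*p*r^2 - 972858033000*p*r^3 - 77350*p^2 - 2549006460*p^2*s -
     2075919300*p^2*r + 394964715600*p^2*r*s + 6375915000*p^2*r^2 - 15921360*p^3 + 89778780000*p^3*s +
     46440739800*p^3*r + 91945854000*p^3*r^2 - 526289400*p^4 - 709004696400*p^4*s - 737114742000*p^4*r -
     4251592800*p^5 + 4597292700000*p^5*r + 250761420000*p^6 - 1103350248000*p^7) / 455) + D (R 2) - 60 *
     D (D (R 2)) + 1296 * D (D (D (R 2))) - 12096 * D (D (D (D (R 2)))) + 45360 * D (D (D (D (D (R 2)))))
     - 46656 * D (D (D (D (D (D (R 2))))))"
  unfolding R_12 by (simp only: D_rules D_p D_r D_s) algebra

lemma R_14: "R 14 = P * (-28*s - 5796504*s^2 + 10*r - 9194472*r*s - 3461520*r^2 - 647272080*r^2*s -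
     416518200*r^3 + 18*p - 219240*p*s + 208674144*p*s^2 - 92928*p*r + 336782880*p*r*s + 171241560*p*r^2
     + 14994655200*p*r^3 + 4548*p^2 + 23284800*p^2*s + 23737320*p^2*r - 6062091840*p^2*r*s +
     97297200*p^2*r^2 + 378648*p^3 - 1215466560*p^3*s - 509664960*p^3*r - 1167566400*p^3*r^2 +
     10231920*p^4 + 10939199040*p^4*s + 9744688800*p^4*r - 36197280*p^5 - 70161759360*p^5*r -
     3394923840*p^6 + 17459608320*p^7) + R 2 - 72 * D (R 2) + 1980 * D (D (R 2)) - 25920 * D (D (D (R
     2))) + 163296 * D (D (D (D (R 2)))) - 435456 * D (D (D (D (D (R 2))))) + 326592 * D (D (D (D (D (D
     (R 2))))))"
  (is "_ = ?r")
proof (rule cancel[of 78])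
  have "78 * R 14 + (637 * R 12 + 1001 * R 10 - 429 * R 8 - 1001 * R 6 - 273 * R 4 - 13 * R 2 + 546 * D
     (R 12) + 6006 * D (R 10) + 18018 * D (R 8) + 18018 * D (R 6) + 6006 * D (R 4) + 546 * D (R 2) + 6 *
     D (R 0)) = P * (126*s - 120*r + 237384*r*s - 47160*r^2 + 59444280*r^2*s - 12600*p*s + 12256272*p*s^2
     + 15876*p*r + 13539960*p*r^2 + 2153466000*p*r^3 + 1238328*p^2*s - 589680*p^2*r + 1114495200*p^2*r*s
     + 58378320*p^3*r + 19264845600*p^3*r^2 + 2451889440*p^4*s + 44134009920*p^5*r + 37829151360*p^7)"
    (is "?l + ?rest = ?k")
  proof (rule cancel[of "P ^ 2"])
    have "P ^ 2 * (?l + ?rest) = K 14"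
      unfolding W_14[symmetric] by algebra
    also have "\<dots> = P ^ 2 * ?k"
      unfolding K_14' by algebra
    finally show "P ^ 2 * (?l + ?rest) = P ^ 2 * ?k" .
  qed (simp add: P_nonzero)
  then have "?l = ?k - ?rest"
    by (simp only: eq_diff_eq)
  also have "\<dots> = 78 * ?r"
    unfolding R_0 D_P D_R_4 D_R_6 D_R_8 D_R_10 D_R_12 unfolding R_4 R_6 R_8 R_10 R_12 by algebra
  finally show "?l = 78 * ?r" .
qed simp

text \<open>All denominators below divide a power of 30030. Working with an opaque inverse of 30030
  turns the remaining computations into identities between polynomials with integer coefficients.\<close>

definition w :: 'a where "w = 1 / 30030"

lemma w_inverse: "30030 * w = 1"
  by (simp add: w_def)

lemma D_w: "D w = 0"
  using D_divide[of 1] by (simp add: w_def D_one)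

lemma D_P_w: "D P = 30030 * w * p * P"
  by (simp add: w_inverse D_P)

lemma D_p_w: "D p = (25025*r + 5005*p - 60060*p^2) * w"
  unfolding D_p by (simp add: w_def field_simps)

lemma D_r_w: "D r = (21021*s + 10010*r - 1001*p - 240240*p*r) * w"
  unfolding D_r by (simp add: w_def field_simps)

lemma D_s_w: "D s = (15015*s + 14300*r + 1716000*r^2 + 715*p - 360360*p*s) * w"
  unfolding D_s by (simp add: w_def field_simps)

lemmas D_w_rules = D_add D_diff D_minus D_mult D_P_w D_p_w D_r_w D_s_w D_w D_power D_numeral D_one
  pred_numeral_simps BitM.simps Num.numeral_One power_one_right

lemma C_10_w: "C 10 = P * ((114660*s - 54600*r + 52743600*r*s + 5405400*p*r + 1027026000*p*r^2 +
     151351200*p^2*s + 1513512000*p^3*r + 908107200*p^5) * w)"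
  unfolding C_10' by (simp add: w_def field_simps)

lemma C_12_w: "C 12 = P * ((-231000*s + 113707440*s^2 + 291060*r + 129313800*r^2 + 14110866000*r^3 +
     15135120*p*s - 7207200*p*r + 6962155200*p*r*s + 356756400*p^2*r + 67783716000*p^2*r^2 +
     6659452800*p^3*s + 49945896000*p^4*r + 19978358400*p^6) * w)"
  unfolding C_12' by (simp add: w_def field_simps)

lemma R_10_w: "R 10 = P * ((-1146600*s + 846300*r - 2696803200*r*s - 918918000*r^2 + 300300*p -
     605404800*p*s - 97297200*p*r + 33081048000*p*r^2 + 20540520*p^2 + 10897286400*p^2*s +
     13621608000*p^2*r + 12972960*p^3 - 163459296000*p^3*r - 13621608000*p^4 + 98075577600*p^5) * w) + (R
     2 - 48 * D (R 2) + 756 * D (D (R 2)) - 4320 * D (D (D (R 2))) + 6480 * D (D (D (D (R 2))))) * (30030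
     * w)"
  unfolding R_10 by (simp add: w_def field_simps)

lemma R_12_w: "R 12 = P * ((-1912680*s + 13604144400*s^2 + 1492260*r + 23081058000*r*s + 11967139800*r^2
     + 913209066000*r^3 + 420420*p + 1256214960*p*s + 1664863200*p*r - 830918088000*p*r*s -
     142540398000*p*r^2 + 62702640*p^2 - 167545778400*p^2*s - 57113456400*p^2*r + 2565727164000*p^2*r^2 +
     2445402960*p^3 + 2010549340800*p^3*s + 2002376376000*p^3*r - 5448643200*p^4 - 18021387384000*p^4*r -
     1103350248000*p^5 + 6620101488000*p^6) * w) + (R 2 - 60 * D (R 2) + 1296 * D (D (R 2)) - 12096 * D
     (D (D (R 2))) + 45360 * D (D (D (D (R 2)))) - 46656 * D (D (D (D (D (R 2)))))) * (30030 * w)"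
  unfolding R_12 by (simp add: w_def field_simps)

lemma D_R_12_w: "D (R 12) = P * ((2649907260*s + 893719376550000*s^2 - 1892790900*r +
     1501241277135600*r*s + 608022310896000*r^2 + 83485401757758000*r^2*s + 63463690320030000*r^3 -
     757116360*p + 57128115844800*p*s - 26862975623484000*p*s^2 + 38331116623800*p*r -
     52500179067336000*p*r*s - 24285030687918000*p*r^2 - 1928185164245340000*p*r^3 - 153306153000*p^2 -
     5052079823590800*p^2*s - 4114430534214000*p^2*r + 782812167024888000*p^2*r*s +
     12636936011700000*p^2*r^2 - 31555817092800*p^3 + 177939746384400000*p^3*s + 92044617468804000*p^3*r
     + 182234843710920000*p^3*r^2 - 1043095065012000*p^4 - 1405233128170872000*p^4*s -
     1460946676349160000*p^4*r - 8426571897744000*p^5 + 9111742185546000000*p^5*r +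
     497004119211600000*p^6 - 2186818124531040000*p^7) * w ^ 2) + (D (R 2) - 60 * D (D (R 2)) + 1296 * D
     (D (D (R 2))) - 12096 * D (D (D (D (R 2)))) + 45360 * D (D (D (D (D (R 2))))) - 46656 * D (D (D (D
     (D (D (R 2))))))) * (30030 * w) ^ 2"
  (is "_ = ?q + ?d * _ ^ 2")
proof -
  have "D (R 12) = ?q + ?d * (30030 * w)"
    unfolding R_12_w by (simp only: D_w_rules) algebra
  then show ?thesis by (simp only: w_inverse power_one)
qed

lemma D1_C_2: "D (C 2) = P * ((50050*r + 10010*p - 60060*p^2) * w)"
  unfolding C_2' by (simp only: D_w_rules) algebra

lemma D2_C_2: "D (D (C 2)) = P * ((1052101050*s + 751500750*r - 13527013500*p*r - 901800900*p^2 +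
     5410805400*p^3) * w ^ 2)"
  unfolding D1_C_2 by (simp only: D_w_rules) algebra

lemma D3_C_2: "D (D (D (C 2))) = P * ((31594594531500*s + 22567567522500*r + 1466891888962500*r^2 -
     631891890630000*p*s - 406216215405000*p*r + 4513513504500*p^2 + 4062162154050000*p^2*r +
     162486486162000*p^3 - 812432430810000*p^4) * w ^ 3)"
  unfolding D2_C_2 by (simp only: D_w_rules) algebra

lemma D4_C_2: "D (D (D (D (C 2)))) = P * ((948785673780945000*s + 677704052700675000*r +
     45857974232745675000*r*s + 73417939042573125000*r^2 - 31626189126031500000*p*s -
     22590135090022500000*p*r - 1541776719894035625000*p*r^2 + 332074985823330750000*p^2*s +
     203311215810202500000*p^2*r - 2033112158102025000*p^3 - 1423178510671417500000*p^3*r -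
     40662243162040500000*p^4 + 170781421280570100000*p^5) * w ^ 4)"
  unfolding D3_C_2 by (simp only: D_w_rules) algebra

lemma D5_C_2: "D (D (D (D (D (C 2))))) = P * ((28492033783641778350000*s + 963980476346546834175000*s^2
     + 20351452702601270250000*r + 3442787415523381550625000*r*s + 3188394256740865672500000*r^2 +
     40109321368043336784375000*r^3 - 1467339739857551585025000*p*s - 1048099814183965417875000*p*r -
     74364208175305041493500000*p*r*s - 115748887246044724546875000*p*r^2 +
     24930529560686556056250000*p^2*s + 17858399746532614644375000*p^2*r +
     1250087982257283025106250000*p^2*r^2 + 3391908783766878375000*p^3 -
     179499812836943203605000000*p^3*s - 106845126688656668812500000*p^3*r + 915815371617057161250000*p^4
     + 576963684118746011587500000*p^4*r + 12821415202638800257500000*p^5 -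
     46157094729499680927000000*p^6) * w ^ 5)"
  unfolding D4_C_2 by (simp only: D_w_rules) algebra

lemma D6_C_2: "D (D (D (D (D (D (C 2)))))) = P * ((855615774522762603850500000*s +
     101319167966403805005963375000*s^2 + 611154124659116145607500000*r +
     211051891048948108949790000000*r*s + 135727145184712044003665625000*r^2 +
     3976830818667257019146803125000*r^2*s + 4215690222388194912721734375000*r^3 -
     62887759427423051383011750000*p*s - 2229021695260883710131194250000*p*s^2 -
     44919828162445036702151250000*p*r - 7816050100265436386174317500000*p*r*s -
     7140826651537889564635631250000*p*r^2 - 92745184892540288079878156250000*p*r^3 +
     1646561256754513067559966375000*p^2*s + 1176115183396080762542833125000*p^2*r +
     85976551102919800247917492500000*p^2*r*s + 131390497375151732353792406250000*p^2*r^2 -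
     18866327828226915414903525000000*p^3*s - 13550814829004252738482293750000*p^3*r -
     963530314084446037261144312500000*p^3*r^2 - 3565065727178177516043750000*p^4 +
     103764803055248034781969387500000*p^4*s + 60641768019300799547904187500000*p^4*r -
     449198281624450367021512500000*p^5 - 266823779284923518010778425000000*p^5*r -
     4851341441544063963832335000000*p^6 + 15247073101995629600615910000000*p^7) * w ^ 6)"
  unfolding D5_C_2 by (simp only: D_w_rules) algebra

lemma D1_C_4: "D (C 4) = P * ((42042*s + 20020*r - 2002*p + 180180*p*r + 120120*p^2 - 1081080*p^3) * w)"
  unfolding C_4' by (simp only: D_w_rules) algebra

lemma D2_C_4: "D (D (C 4)) = P * ((1052101050*s + 751500750*r + 76653076500*r^2 - 10100170080*p*s +
     4509004500*p*r + 1082161080*p^2 - 129859329600*p^2*r - 27054027000*p^3 + 162324162000*p^4) * w ^ 2)"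
  unfolding D1_C_4 by (simp only: D_w_rules) algebra

lemma D3_C_4: "D (D (D (C 4))) = P * ((31594594531500*s + 22567567522500*r + 2969891885961000*r*s +
     3452837830942500*r^2 - 454962161253600*p*s - 333999999333000*p*r - 58359729613185000*p*r^2 -
     902702700900*p^2 + 1213232430009600*p^2*s - 5849513501832000*p^2*r - 373718918172600*p^3 +
     59145080962968000*p^3*r + 7311891877290000*p^4 - 34122162094020000*p^5) * w ^ 3)"
  unfolding D2_C_4 by (simp only: D_w_rules) algebra

lemma D4_C_4: "D (D (D (D (C 4)))) = P * ((948785673780945000*s + 62430097334786181000*s^2 +
     677704052700675000*r + 208100324449287270000*r*s + 157453241577456825000*r^2 +
     3635882242739121375000*r^3 - 29538860643713421000*p*s - 21099186174081015000*p*r -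
     4087368682648311060000*p*r*s - 4089266253995872950000*p*r^2 + 85011196370772672000*p^2*s +
     79291374165978975000*p^2*r + 36315449368018370550000*p^2*r^2 + 1192759132753188000*p^3 +
     696788198824726008000*p^3*s + 4144295823075167760000*p^3*r + 143293744903030722000*p^4 -
     27359183689147330020000*p^4*r - 2390939897927981400000*p^5 + 9222196749150785400000*p^6) * w ^ 4)"
  unfolding D3_C_4 by (simp only: D_w_rules) algebra

lemma D5_C_4: "D (D (D (D (D (C 4))))) = P * ((28492033783641778350000*s + 6249252743212096718100000*s^2
     + 20351452702601270250000*r + 12873650597908810184475000*r*s + 7228157618207217817125000*r^2 +
     341263334643569400187125000*r^2*s + 363951812498186049637500000*r^3 - 1467339739857551585025000*p*s
     - 129040421006113614147150000*p*s^2 - 1048099814183965417875000*p*r -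
     409145605133095937106000000*p*r*s - 289346778799233559779375000*p*r^2 -
     7707603924792666075431250000*p*r^3 + 19417321023551871945525000*p^2*s +
     13859339290471465040250000*p^2*r + 4156702808695499043481500000*p^2*r*s +
     3635176481738638892055000000*p^2*r^2 - 678381756753375675000*p^3 + 69748498702355073400800000*p^3*s
     + 29122928817422417727750000*p^3*r - 22263471684010659589987500000*p^3*r^2 -
     960588567562779955800000*p^4 - 930834743711576898694500000*p^4*s -
     2738654287283647735002000000*p^4*r - 62568506188877345256600000*p^5 +
     13708657134661405235319000000*p^5*r + 923141894589993618540000000*p^6 -
     3046368252146978941182000000*p^7) * w ^ 5)"
  unfolding D4_C_4 by (simp only: D_w_rules) algebra

lemma D1_C_6: "D (C 6) = P * ((30030*s + 28600*r + 4933500*r^2 + 1430*p + 600600*p*s + 900900*p*r -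
     60060*p^2 - 7207200*p^2*r + 1801800*p^3 - 18018000*p^4) * w)"
  unfolding C_6' by (simp only: D_w_rules) algebra

lemma D2_C_6: "D (D (C 6)) = P * ((1052101050*s + 751500750*r + 222444222000*r*s + 172845172500*r^2 +
     21042021000*p*s + 3220717500*p*r - 1552385835000*p*r^2 - 1116515400*p^2 - 385970785200*p^2*s -
     252504252000*p^2*r + 39679239600*p^3 + 577152576000*p^3*r - 631260630000*p^4 + 3787563780000*p^5) *
     w ^ 2)"
  unfolding D1_C_6 by (simp only: D_w_rules) algebra

lemma D3_C_6: "D (D (D (C 6))) = P * ((31594594531500*s + 4675999990662000*s^2 + 22567567522500*r +
     13359999973320000*r*s + 8527316585287500*r^2 + 342865829431125000*r^3 - 81243243081000*p*s -
     51583011480000*p*r - 211503242820870000*p*r*s - 93236293250100000*p*r^2 + 644787643500*p^2 -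
     23181405359112000*p^2*s - 5358185317485000*p^2*r + 173512354865850000*p^2*r^2 + 673158299814000*p^3
     + 185992864493436000*p^3*s + 34663783714560000*p^3*r - 19173405367116000*p^4 +
     248604323827860000*p^4*r + 227481080626800000*p^5 - 1023664862820600000*p^6) * w ^ 3)"
  unfolding D2_C_6 by (simp only: D_w_rules) algebra

lemma D4_C_6: "D (D (D (D (C 6)))) = P * ((948785673780945000*s + 421260839158739580000*s^2 +
     677704052700675000*r + 824539930785821250000*r*s + 414690337009698750000*r^2 +
     32377311117774748125000*r^2*s + 30888782573450051250000*r^3 - 19834138609039755000*p*s -
     7675676100887845050000*p*s^2 - 14167241863599825000*p*r - 19054327145732178300000*p*r*s -
     10636081032813736500000*p*r^2 - 591069271049360853750000*p*r^3 - 449317786940547525000*p^2*s -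
     338852026350337500000*p^2*r + 154638510745240021500000*p^2*r*s + 15631728049864426500000*p^2*r^2 -
     1161778376058300000*p^3 + 16756097162213649240000*p^3*s + 3030498893948075550000*p^3*r +
     245048103970096927500000*p^3*r^2 - 386639843552202240000*p^4 - 89725305761358567300000*p^4*s +
     22396763533651907400000*p^4*r + 9474302656755436500000*p^5 - 265687096820772627000000*p^5*r -
     92221967491507854000000*p^6 + 338147214135528798000000*p^7) * w ^ 4)"
  unfolding D3_C_6 by (simp only: D_w_rules) algebra

lemma D1_C_8: "D (C 8) = P * ((42042*s + 20020*r + 18778760*r*s + 7607600*r^2 - 2002*p + 2242240*p*s +
     420420*p*r + 105105000*p*r^2 + 80080*p^2 - 8408400*p^2*s + 33633600*p^2*r - 1681680*p^3 -
     386786400*p^3*r + 33633600*p^4 - 353152800*p^5) * w)"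
  unfolding C_8' by (simp only: D_w_rules) algebra

lemma D2_C_8: "D (D (C 8)) = P * ((1052101050*s + 394748313960*s^2 + 751500750*r + 845889244200*r*s +
     503505502500*r^2 + 34854604785000*r^3 + 21042021000*p*s + 36372636300*p*r - 6716613103200*p*r*s +
     4734454725000*p*r^2 + 2044082040*p^2 - 378756378000*p^2*s + 102805302600*p^2*r -
     97123956930000*p^2*r^2 - 72144072000*p^3 - 4343073134400*p^3*s - 17422793388000*p^3*r +
     1313022110400*p^4 + 106809298596000*p^4*r - 15907767876000*p^5 + 95446607256000*p^6) * w ^ 2)"
  unfolding D1_C_8 by (simp only: D_w_rules) algebra

lemma D3_C_8: "D (D (D (C 8))) = P * ((31594594531500*s + 29635729670547000*s^2 + 22567567522500*r +
     54153135026991000*r*s + 24892026977317500*r^2 + 3384728912159595000*r^2*s + 2616709454233875000*r^3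
     + 556064863754400*p*s - 413838637011399600*p*s^2 + 388162161387000*p*r - 504249728722740000*p*r*s -
     267786756221985000*p*r^2 - 40460489108389350000*p*r^3 - 902702700900*p^2 - 8808572955382200*p^2*s -
     32885459393787000*p^2*r - 173643891545124000*p^2*r*s - 7291581066519750000*p^2*r^2 -
     1641113510236200*p^3 - 326056215565080000*p^3*s - 206195350939578000*p^3*r +
     58654913396379300000*p^3*r^2 + 51454053951300000*p^4 + 4462420531629060000*p^4*s +
     8018708092094700000*p^4*r - 781018376818680000*p^5 - 33780940473079800000*p^5*r +
     7165654039744200000*p^6 - 31528877774874480000*p^7) * w ^ 3)"
  unfolding D2_C_8 by (simp only: D_w_rules) algebra

lemma D1_C_10: "D (C 10) = P * ((573873300*s + 1108723215600*s^2 + 1093092000*r + 1319908590000*r*s +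
     1086260175000*r^2 + 116209343250000*r^3 + 136636500*p + 22954932000*p*s + 130351221000*p*r +
     20659438800000*p*r*s + 25701325650000*p*r^2 - 5410805400*p^2 + 3787563780000*p^2*s -
     1352701350000*p^2*r - 150961470660000*p^2*r^2 + 108216108000*p^3 - 36360612288000*p^3*s +
     37875637800000*p^3*r - 1515025512000*p^4 - 477233036280000*p^4*r + 22725382680000*p^5 -
     245434132944000*p^6) * w ^ 2)"
  unfolding C_10_w by (simp only: D_w_rules) algebra

lemma D2_C_10: "D (D (C 10)) = P * ((31594594531500*s + 61040756634858000*s^2 + 22567567522500*r +
     110983193881560000*r*s + 44868427428825000*r^2 + 11650650345283950000*r^2*s +
     6397905392628750000*r^3 + 3274348887810000*p*s - 331501974767964000*p*s^2 + 553931202825000*p*r +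
     1137405403134000000*p*r*s + 72011056367250000*p*r^2 - 52368655915075500000*p*r^3 -
     172334151990000*p^2 + 36707174373870000*p^2*s - 36707174373870000*p^2*r -
     22104957007453320000*p^2*r*s - 8311183767186300000*p^2*r^2 + 6174486474156000*p^3 -
     2001833509515840000*p^3*s + 1025289727682220000*p^3*r - 24031751303359800000*p^3*r^2 -
     110490810590160000*p^4 + 8530540523505000000*p^4*s - 26274064812395400000*p^4*r +
     1364886483760800000*p^5 + 178117686130784400000*p^5*r - 13512376189231920000*p^6 +
     81074257135391520000*p^7) * w ^ 3)"
  unfolding D1_C_10 by (simp only: D_w_rules) algebra

lemma D1_C_12: "D (C 12) = P * ((2649907260*s + 3414634423200*s^2 - 389789400*r + 9067399941600*r*s +
     2012106096000*r^2 + 1454345410518000*r^2*s + 423749305980000*r^3 - 456516060*p + 390410420400*p*s +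
     67814872725600*p*s^2 - 211853842200*p*r + 209073520656000*p*r*s + 42762011292000*p*r^2 +
     5593399271460000*p*r^3 + 18036018000*p^2 - 5378340567600*p^2*s + 14068094040000*p^2*r -
     1040822526744000*p^2*r*s + 2035544991480000*p^2*r^2 - 357113156400*p^3 + 199983367584000*p^3*s -
     158320166004000*p^3*r - 22248149643720000*p^3*r^2 + 4761508752000*p^4 - 2349804569112000*p^4*s +
     1499875256880000*p^4*r - 49995841896000*p^5 - 19498378339440000*p^5*r + 599950102752000*p^6 -
     6599451130272000*p^7) * w ^ 2)"
  unfolding C_12_w by (simp only: D_w_rules) algebra

text \<open>Both sides expand into monomials in \<open>p\<close>, \<open>r\<close>, \<open>s\<close>
  times \<open>P\<close> and into derivatives of \<open>R 2\<close>, and the coefficients match.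
  Applying \<open>D\<close> multiplies the coefficient of \<open>q^n\<close> by \<open>n\<close>, so
  this is the first identity times 3.\<close>

lemma rank_relation_4: "3 * R 4 = - 6 * D (C 2) - 2 * C 2 + 8 * C 4 - 36 * D (R 2) + 3 * R 2"
proof -
  \<comment> \<open>Factors \<open>30030 * w\<close>, equal to 1, bring every term to the same power
    of \<open>w\<close>. The equation then holds identically in \<open>w\<close>, and
    \<open>algebra\<close> can treat \<open>w\<close> as a free variable.\<close>
  have "3 * R 4 * (30030 * w) ^ 1 = - 6 * D (C 2) - 2 * C 2 * (30030 * w) ^ 1 + 8 * C 4 * (30030 * w) ^ 1
     - 36 * D (R 2) * (30030 * w) ^ 1 + 3 * R 2 * (30030 * w) ^ 1"
    unfolding R_4 unfolding D1_C_2 unfolding C_2' C_4' by algebra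
  then show ?thesis by (simp only: w_inverse power_one mult_1_right)
qed

lemma rank_relation_6: "33 * R 6 = 648 * D (D (C 2)) + 138 * D (C 2) - 20 * C 2 - 900 * D (C 4) + 80 * C
     4 + 54 * C 6 + 3564 * D (D (R 2)) - 792 * D (R 2) + 33 * R 2"
proof -
  have "33 * R 6 * (30030 * w) ^ 2 = 648 * D (D (C 2)) + 138 * D (C 2) * (30030 * w) ^ 1 - 20 * C 2 *
     (30030 * w) ^ 2 - 900 * D (C 4) * (30030 * w) ^ 1 + 80 * C 4 * (30030 * w) ^ 2 + 54 * C 6 * (30030 *
     w) ^ 2 + 3564 * D (D (R 2)) * (30030 * w) ^ 2 - 792 * D (R 2) * (30030 * w) ^ 2 + 33 * R 2 * (30030
     * w) ^ 2"
    unfolding R_6 unfolding D2_C_2 unfolding D1_C_2 D1_C_4 unfolding C_2' C_4' C_6' by algebra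
  then show ?thesis by (simp only: w_inverse power_one mult_1_right)
qed

lemma rank_relation_8: "913 * R 8 = - 145944 * D (D (D (C 2))) - 3456 * D (D (C 2)) + 11334 * D (C 2) -
     578 * C 2 + 204960 * D (D (C 4)) - 54600 * D (C 4) + 2240 * C 4 - 16464 * D (C 6) + 1260 * C 6 +
     1248 * C 8 - 788832 * D (D (D (R 2))) + 328680 * D (D (R 2)) - 32868 * D (R 2) + 913 * R 2"
proof -
  have "913 * R 8 * (30030 * w) ^ 3 = - 145944 * D (D (D (C 2))) - 3456 * D (D (C 2)) * (30030 * w) ^ 1 +
     11334 * D (C 2) * (30030 * w) ^ 2 - 578 * C 2 * (30030 * w) ^ 3 + 204960 * D (D (C 4)) * (30030 * w)
     ^ 1 - 54600 * D (C 4) * (30030 * w) ^ 2 + 2240 * C 4 * (30030 * w) ^ 3 - 16464 * D (C 6) * (30030 *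
     w) ^ 2 + 1260 * C 6 * (30030 * w) ^ 3 + 1248 * C 8 * (30030 * w) ^ 3 - 788832 * D (D (D (R 2))) *
     (30030 * w) ^ 3 + 328680 * D (D (R 2)) * (30030 * w) ^ 3 - 32868 * D (R 2) * (30030 * w) ^ 3 + 913 *
     R 2 * (30030 * w) ^ 3"
    unfolding R_8 unfolding D3_C_2 unfolding D2_C_2 D2_C_4 unfolding D1_C_2 D1_C_4 D1_C_6 unfolding C_2' C_4' C_6' C_8' by algebra
  then show ?thesis by (simp only: w_inverse power_one mult_1_right)
qed

lemma rank_relation_10: "5951847 * R 10 = 7176288960 * D (D (D (D (C 2)))) - 1610917200 * D (D (D (C 2)))
     - 796014216 * D (D (C 2)) + 112515294 * D (C 2) - 3589184 * C 2 - 10117850400 * D (D (D (C 4))) +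
     5155768800 * D (D (C 4)) - 507534300 * D (C 4) + 14560280 * C 4 + 895572720 * D (D (C 6)) -
     239868720 * D (C 6) + 8516970 * C 6 - 101676600 * D (C 8) + 6766560 * C 8 + 7461036 * C 10 +
     38567968560 * D (D (D (D (R 2)))) - 25711979040 * D (D (D (R 2))) + 4499596332 * D (D (R 2)) -
     285688656 * D (R 2) + 5951847 * R 2"
proof -
  have "5951847 * R 10 * (30030 * w) ^ 3 = 7176288960 * D (D (D (D (C 2)))) - 1610917200 * D (D (D (C
     2))) * (30030 * w) ^ 1 - 796014216 * D (D (C 2)) * (30030 * w) ^ 2 + 112515294 * D (C 2) * (30030 *
     w) ^ 3 - 3589184 * C 2 * (30030 * w) ^ 4 - 10117850400 * D (D (D (C 4))) * (30030 * w) ^ 1 +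
     5155768800 * D (D (C 4)) * (30030 * w) ^ 2 - 507534300 * D (C 4) * (30030 * w) ^ 3 + 14560280 * C 4
     * (30030 * w) ^ 4 + 895572720 * D (D (C 6)) * (30030 * w) ^ 2 - 239868720 * D (C 6) * (30030 * w) ^
     3 + 8516970 * C 6 * (30030 * w) ^ 4 - 101676600 * D (C 8) * (30030 * w) ^ 3 + 6766560 * C 8 * (30030
     * w) ^ 4 + 7461036 * C 10 * (30030 * w) ^ 3 + 38567968560 * D (D (D (D (R 2)))) * (30030 * w) ^ 4 -
     25711979040 * D (D (D (R 2))) * (30030 * w) ^ 4 + 4499596332 * D (D (R 2)) * (30030 * w) ^ 4 -
     285688656 * D (R 2) * (30030 * w) ^ 4 + 5951847 * R 2 * (30030 * w) ^ 4"
    unfolding R_10_w unfolding D4_C_2 unfolding D3_C_2 D3_C_4 unfolding D2_C_2 D2_C_4 D2_C_6 unfolding D1_C_2 D1_C_4 D1_C_6 D1_C_8 unfolding C_2' C_4' C_6' C_8' C_10_w by algebra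
  then show ?thesis by (simp only: w_inverse power_one mult_1_right)
qed

lemma rank_relation_14: "9010066646264994 * R 14 = - 1311837694033500708480 * D (D (D (D (D (D (C 2))))))
     + 1168208879531966848800 * D (D (D (D (D (C 2))))) - 176387821175379860928 * D (D (D (D (C 2)))) -
     102511971379212634728 * D (D (D (C 2))) + 25778439362977025688 * D (D (C 2)) - 2067143616138639774 *
     D (C 2) + 46865313122984114 * C 2 + 1852043945374227346560 * D (D (D (D (D (C 4))))) -
     2173829803797105417600 * D (D (D (D (C 4)))) + 897684855653873196000 * D (D (D (C 4))) -
     135017865206460905760 * D (D (C 4)) + 8826824195512071840 * D (C 4) - 167162419676559944 * C 4 -
     169470153504814518720 * D (D (D (D (C 6)))) + 154384921434444180480 * D (D (D (C 6))) -
     47985814895466062160 * D (D (C 6)) + 3069393854677585344 * D (C 6) - 96106166313773616 * C 6 +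
     21802660152724825920 * D (D (D (C 8))) - 14313249753417014400 * D (D (C 8)) + 3041982993529738440 *
     D (C 8) - 83695528881396432 * C 8 - 2269008821298963744 * D (D (C 10)) + 1210454964090852480 * D (C
     10) - 72148624018402932 * C 10 + 82422977302306368 * D (C 12) - 82422977302306368 * C 12 +
     10416090538203552 * C 14 - 7036689684240596983680 * D (D (D (D (D (D (R 2)))))) +
     9382252912320795978240 * D (D (D (D (D (R 2))))) - 4619456468635725242064 * D (D (D (D (R 2)))) +
     977938531072590903552 * D (D (D (R 2))) - 95094593836849337544 * D (D (R 2)) + 4199474541215684160 *
     D (R 2) - 68228403227151585 * R 2 - 213891147341768988 * D (R 12) + 77238469873416579 * R 12"
proof -
  have "9010066646264994 * R 14 * (30030 * w) ^ 6 = - 1311837694033500708480 * D (D (D (D (D (D (C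
     2)))))) + 1168208879531966848800 * D (D (D (D (D (C 2))))) * (30030 * w) ^ 1 - 176387821175379860928
     * D (D (D (D (C 2)))) * (30030 * w) ^ 2 - 102511971379212634728 * D (D (D (C 2))) * (30030 * w) ^ 3
     + 25778439362977025688 * D (D (C 2)) * (30030 * w) ^ 4 - 2067143616138639774 * D (C 2) * (30030 * w)
     ^ 5 + 46865313122984114 * C 2 * (30030 * w) ^ 6 + 1852043945374227346560 * D (D (D (D (D (C 4))))) *
     (30030 * w) ^ 1 - 2173829803797105417600 * D (D (D (D (C 4)))) * (30030 * w) ^ 2 +
     897684855653873196000 * D (D (D (C 4))) * (30030 * w) ^ 3 - 135017865206460905760 * D (D (C 4)) *
     (30030 * w) ^ 4 + 8826824195512071840 * D (C 4) * (30030 * w) ^ 5 - 167162419676559944 * C 4 *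
     (30030 * w) ^ 6 - 169470153504814518720 * D (D (D (D (C 6)))) * (30030 * w) ^ 2 +
     154384921434444180480 * D (D (D (C 6))) * (30030 * w) ^ 3 - 47985814895466062160 * D (D (C 6)) *
     (30030 * w) ^ 4 + 3069393854677585344 * D (C 6) * (30030 * w) ^ 5 - 96106166313773616 * C 6 * (30030
     * w) ^ 6 + 21802660152724825920 * D (D (D (C 8))) * (30030 * w) ^ 3 - 14313249753417014400 * D (D (C
     8)) * (30030 * w) ^ 4 + 3041982993529738440 * D (C 8) * (30030 * w) ^ 5 - 83695528881396432 * C 8 *
     (30030 * w) ^ 6 - 2269008821298963744 * D (D (C 10)) * (30030 * w) ^ 3 + 1210454964090852480 * D (C
     10) * (30030 * w) ^ 4 - 72148624018402932 * C 10 * (30030 * w) ^ 5 + 82422977302306368 * D (C 12) *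
     (30030 * w) ^ 4 - 82422977302306368 * C 12 * (30030 * w) ^ 5 + 10416090538203552 * C 14 * (30030 *
     w) ^ 6 - 7036689684240596983680 * D (D (D (D (D (D (R 2)))))) * (30030 * w) ^ 6 +
     9382252912320795978240 * D (D (D (D (D (R 2))))) * (30030 * w) ^ 6 - 4619456468635725242064 * D (D
     (D (D (R 2)))) * (30030 * w) ^ 6 + 977938531072590903552 * D (D (D (R 2))) * (30030 * w) ^ 6 -
     95094593836849337544 * D (D (R 2)) * (30030 * w) ^ 6 + 4199474541215684160 * D (R 2) * (30030 * w) ^
     6 - 68228403227151585 * R 2 * (30030 * w) ^ 6 - 213891147341768988 * D (R 12) * (30030 * w) ^ 4 +
     77238469873416579 * R 12 * (30030 * w) ^ 5"
    unfolding R_14 D_R_12_w unfolding R_12_w unfolding D6_C_2 unfolding D5_C_2 D5_C_4 unfolding D4_C_2 D4_C_4 D4_C_6 unfolding D3_C_2 D3_C_4 D3_C_6 D3_C_8 unfolding D2_C_2 D2_C_4 D2_C_6 D2_C_8 D2_C_10 unfolding D1_C_2 D1_C_4 D1_C_6 D1_C_8 D1_C_10 D1_C_12 unfolding C_2' C_4' C_6' C_8' C_10_w C_12_w C_14' by algebra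
  then show ?thesis by (simp only: w_inverse power_one mult_1_right)
qed

end

text \<open>Multiplying by a common denominator \<open>N\<close> of the Faulhaber coefficients
  leaves integers \<open>c i\<close>, which can be given as an explicit list.\<close>

lemma sigma_gf_convolution_int:
  fixes k N :: nat and c :: "nat \<Rightarrow> int"
  assumes "k \<ge> 1" "N \<ge> 1"
    and P: "\<And>d. real N * (2 * (\<Sum>a\<in>{1..<d}. real a ^ (2 * k)) + real d ^ (2 * k)) =
      (\<Sum>i\<le>k. of_int (c i) * real d ^ (2 * i + 1))"
  shows "2 * of_nat N * fps_XD (sigma_gf (2 * k - 1)) =
    of_nat N * sigma_gf (2 * k + 1) + (\<Sum>i\<le>k. of_int (c i) * sigma_gf (2 * i + 1)) -
    2 * of_nat N * (\<Sum>i<k. of_nat (2 * k choose (2 * i + 1)) * sigma_gf (2 * i + 1) * sigma_gf (2 * k - (2 * i + 1)))"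
proof -
  have "2 * (\<Sum>a\<in>{1..<d}. real a ^ (2 * k)) + real d ^ (2 * k) =
      (\<Sum>i\<le>k. of_int (c i) / real N * real d ^ (2 * i + 1))" for d
    using P[of d] \<open>N \<ge> 1\<close> by (simp add: field_simps flip: sum_divide_distrib)
  from sigma_gf_convolution[OF assms(1) this]
  have "of_nat N * (2 * (\<Sum>i<k. of_nat (2 * k choose (2 * i + 1)) * sigma_gf (2 * i + 1) * sigma_gf (2 * k - (2 * i + 1)))) =
    of_nat N * (sigma_gf (2 * k + 1) + (\<Sum>i\<le>k. fps_const (of_int (c i) / real N) * sigma_gf (2 * i + 1))
      - 2 * fps_XD (sigma_gf (2 * k - 1)))" by simp
  moreover have "of_nat N * (\<Sum>i\<le>k. fps_const (of_int (c i) / real N) * sigma_gf (2 * i + 1)) =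
      (\<Sum>i\<le>k. of_int (c i) * sigma_gf (2 * i + 1))"
  proof -
    have "of_nat N * (fps_const (of_int (c i) / real N) * f) = of_int (c i) * f" for i and f :: "real fps"
      using \<open>N \<ge> 1\<close> by (intro fps_ext) simp
    then show ?thesis by (simp only: sum_distrib_left)
  qed
  ultimately show ?thesis
    by (simp only: right_diff_distrib distrib_left mult.assoc mult.left_commute[of 2] eq_diff_eq diff_eq_eq add.commute)
qed

lemmas expand_sums = lessThan_nat_numeral atMost_nat_numeral lessThan_0 atMost_0 pred_numeral_simps

lemma binomials:
  "(3 choose 2) = 3"
  "(4 choose 2) = 6"
  "(4 choose 3) = 4"
  "(5 choose 2) = 10"
  "(5 choose 3) = 10"
  "(5 choose 4) = 5"
  "(6 choose 2) = 15"
  "(6 choose 3) = 20"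
  "(6 choose 4) = 15"
  "(6 choose 5) = 6"
  "(7 choose 2) = 21"
  "(7 choose 3) = 35"
  "(7 choose 4) = 35"
  "(7 choose 5) = 21"
  "(7 choose 6) = 7"
  "(8 choose 2) = 28"
  "(8 choose 3) = 56"
  "(8 choose 4) = 70"
  "(8 choose 5) = 56"
  "(8 choose 6) = 28"
  "(8 choose 7) = 8"
  "(9 choose 2) = 36"
  "(9 choose 3) = 84"
  "(9 choose 4) = 126"
  "(9 choose 5) = 126"
  "(9 choose 6) = 84"
  "(9 choose 7) = 36"
  "(9 choose 8) = 9"
  "(10 choose 2) = 45"
  "(10 choose 3) = 120"
  "(10 choose 4) = 210"
  "(10 choose 5) = 252"
  "(10 choose 6) = 210"
  "(10 choose 7) = 120"
  "(10 choose 8) = 45"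
  "(10 choose 9) = 10"
  "(11 choose 2) = 55"
  "(11 choose 3) = 165"
  "(11 choose 4) = 330"
  "(11 choose 5) = 462"
  "(11 choose 6) = 462"
  "(11 choose 7) = 330"
  "(11 choose 8) = 165"
  "(11 choose 9) = 55"
  "(11 choose 10) = 11"
  "(12 choose 2) = 66"
  "(12 choose 3) = 220"
  "(12 choose 4) = 495"
  "(12 choose 5) = 792"
  "(12 choose 6) = 924"
  "(12 choose 7) = 792"
  "(12 choose 8) = 495"
  "(12 choose 9) = 220"
  "(12 choose 10) = 66"
  "(12 choose 11) = 12"
  "(13 choose 2) = 78"
  "(13 choose 3) = 286"
  "(13 choose 4) = 715"
  "(13 choose 5) = 1287"
  "(13 choose 6) = 1716"
  "(13 choose 7) = 1716"
  "(13 choose 8) = 1287"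
  "(13 choose 9) = 715"
  "(13 choose 10) = 286"
  "(13 choose 11) = 78"
  "(13 choose 12) = 13"
  "(14 choose 2) = 91"
  "(14 choose 3) = 364"
  "(14 choose 4) = 1001"
  "(14 choose 5) = 2002"
  "(14 choose 6) = 3003"
  "(14 choose 7) = 3432"
  "(14 choose 8) = 3003"
  "(14 choose 9) = 2002"
  "(14 choose 10) = 1001"
  "(14 choose 11) = 364"
  "(14 choose 12) = 91"
  "(14 choose 13) = 14"
  by (simp_all add: numeral_eq_Suc)

section \<open>The convolution identities and moment recursions in explicit form\<close>

lemma sigma_convolution_2: "6 * fps_XD (sigma_gf 1) = 5 * sigma_gf 3 + sigma_gf 1 - 12 * (sigma_gf 1 *
     sigma_gf 1)"
proof -
  \<comment> \<open>3 is the common denominator in the Faulhaber formula for squares; the list holds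
    the coefficients of \<open>d\<close>, \<open>d^3\<close>. The later cases follow the same
    pattern.\<close>
  have "real 3 * (2 * (\<Sum>a\<in>{1..<d}. real a ^ (2 * 1)) + real d ^ (2 * 1)) =
      (\<Sum>i\<le>1. of_int ([1, 2] ! i) * real d ^ (2 * i + 1))" (is "?l = ?r") for d
  proof -
    have "?l = 2 * real d ^ 3 + real d ^ 1"
      using sum_powers(1)[of d] by (simp add: eval_nat_numeral algebra_simps)
    also have "\<dots> = ?r"
      by (simp add: expand_sums) algebra
    finally show ?thesis .
  qed
  from sigma_gf_convolution_int[OF _ _ this]
  show ?thesis by (simp add: expand_sums binomials) (simp add: algebra_simps)?
qed

lemma sigma_convolution_4: "30 * fps_XD (sigma_gf 3) = 21 * sigma_gf 5 - sigma_gf 1 + 10 * sigma_gf 3 -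
     240 * (sigma_gf 1 * sigma_gf 3)"
proof -
  have "real 15 * (2 * (\<Sum>a\<in>{1..<d}. real a ^ (2 * 2)) + real d ^ (2 * 2)) =
      (\<Sum>i\<le>2. of_int ([- 1, 10, 6] ! i) * real d ^ (2 * i + 1))" (is "?l = ?r") for d
  proof -
    have "?l = 6 * real d ^ 5 + 10 * real d ^ 3 - real d ^ 1"
      using sum_powers(3)[of d] by (simp add: algebra_simps)
    also have "\<dots> = ?r"
      by (simp add: expand_sums) algebra
    finally show ?thesis .
  qed
  from sigma_gf_convolution_int[OF _ _ this]
  show ?thesis by (simp add: expand_sums binomials) (simp add: algebra_simps)?
qed

lemma sigma_convolution_6: "42 * fps_XD (sigma_gf 5) = 27 * sigma_gf 7 + sigma_gf 1 - 7 * sigma_gf 3 +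
     21 * sigma_gf 5 - 504 * (sigma_gf 1 * sigma_gf 5) - 840 * (sigma_gf 3 * sigma_gf 3)"
proof -
  have "real 21 * (2 * (\<Sum>a\<in>{1..<d}. real a ^ (2 * 3)) + real d ^ (2 * 3)) =
      (\<Sum>i\<le>3. of_int ([1, - 7, 21, 6] ! i) * real d ^ (2 * i + 1))" (is "?l = ?r") for d
  proof -
    have "?l = 6 * real d ^ 7 + 21 * real d ^ 5 - 7 * real d ^ 3 + real d ^ 1"
      using sum_powers(4)[of d] by (simp add: algebra_simps)
    also have "\<dots> = ?r"
      by (simp add: expand_sums) algebra
    finally show ?thesis .
  qed
  from sigma_gf_convolution_int[OF _ _ this]
  show ?thesis by (simp add: expand_sums binomials) (simp add: algebra_simps)?
qed

lemma sigma_convolution_8: "90 * fps_XD (sigma_gf 7) = 55 * sigma_gf 9 - 3 * sigma_gf 1 + 20 * sigma_gf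
     3 - 42 * sigma_gf 5 + 60 * sigma_gf 7 - 1440 * (sigma_gf 1 * sigma_gf 7) - 10080 * (sigma_gf 3 *
     sigma_gf 5)"
proof -
  have "real 45 * (2 * (\<Sum>a\<in>{1..<d}. real a ^ (2 * 4)) + real d ^ (2 * 4)) =
      (\<Sum>i\<le>4. of_int ([- 3, 20, - 42, 60, 10] ! i) * real d ^ (2 * i + 1))" (is "?l = ?r") for d
  proof -
    have "?l = 10 * real d ^ 9 + 60 * real d ^ 7 - 42 * real d ^ 5 + 20 * real d ^ 3 - 3 * real d ^ 1"
      using sum_powers(5)[of d] by (simp add: algebra_simps)
    also have "\<dots> = ?r"
      by (simp add: expand_sums) algebra
    finally show ?thesis .
  qed
  from sigma_gf_convolution_int[OF _ _ this]
  show ?thesis by (simp add: expand_sums binomials) (simp add: algebra_simps)?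
qed

lemma sigma_convolution_10: "66 * fps_XD (sigma_gf 9) = 39 * sigma_gf 11 + 5 * sigma_gf 1 - 33 *
     sigma_gf 3 + 66 * sigma_gf 5 - 66 * sigma_gf 7 + 55 * sigma_gf 9 - 1320 * (sigma_gf 1 * sigma_gf 9)
     - 15840 * (sigma_gf 3 * sigma_gf 7) - 16632 * (sigma_gf 5 * sigma_gf 5)"
proof -
  have "real 33 * (2 * (\<Sum>a\<in>{1..<d}. real a ^ (2 * 5)) + real d ^ (2 * 5)) =
      (\<Sum>i\<le>5. of_int ([5, - 33, 66, - 66, 55, 6] ! i) * real d ^ (2 * i + 1))" (is "?l = ?r") for d
  proof -
    have "?l = 6 * real d ^ 11 + 55 * real d ^ 9 - 66 * real d ^ 7 + 66 * real d ^ 5 - 33 * real d ^ 3 +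
     5 * real d ^ 1"
      using sum_powers(6)[of d] by (simp add: algebra_simps)
    also have "\<dots> = ?r"
      by (simp add: expand_sums) algebra
    finally show ?thesis .
  qed
  from sigma_gf_convolution_int[OF _ _ this]
  show ?thesis by (simp add: expand_sums binomials) (simp add: algebra_simps)?
qed

lemma sigma_convolution_12: "2730 * fps_XD (sigma_gf 11) = 1575 * sigma_gf 13 - 691 * sigma_gf 1 + 4550
     * sigma_gf 3 - 9009 * sigma_gf 5 + 8580 * sigma_gf 7 - 5005 * sigma_gf 9 + 2730 * sigma_gf 11 -
     65520 * (sigma_gf 1 * sigma_gf 11) - 1201200 * (sigma_gf 3 * sigma_gf 9) - 4324320 * (sigma_gf 5 *
     sigma_gf 7)"
proof -
  \<comment> \<open>The coefficient of \<open>d\<close> is twice the Bernoulli number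
    \<open>B_12 = - 691 / 2730\<close>, which explains 1365 and 691.\<close>
  have "real 1365 * (2 * (\<Sum>a\<in>{1..<d}. real a ^ (2 * 6)) + real d ^ (2 * 6)) =
      (\<Sum>i\<le>6. of_int ([- 691, 4550, - 9009, 8580, - 5005, 2730, 210] ! i) * real d ^ (2 * i + 1))" (is "?l = ?r") for d
  proof -
    have "?l = 210 * real d ^ 13 + 2730 * real d ^ 11 - 5005 * real d ^ 9 + 8580 * real d ^ 7 - 9009 *
     real d ^ 5 + 4550 * real d ^ 3 - 691 * real d ^ 1"
      using sum_powers(7)[of d] by (simp add: algebra_simps)
    also have "\<dots> = ?r"
      by (simp add: expand_sums) algebra
    finally show ?thesis .
  qed
  from sigma_gf_convolution_int[OF _ _ this]
  show ?thesis by (simp add: expand_sums binomials) (simp add: algebra_simps)?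
qed

lemma moment_numeral_mult: "moment j (numeral k * f) = numeral k * moment j f"
  by (induction j arbitrary: f) (simp_all add: moment_0 moment_Suc z_deriv_mult)

lemma moment_crank_cube_0: "moment 0 (crank_gf ^ 3) = partition_gf ^ 3"
  using moment_crank_gf_0 by (simp add: moment_0)

lemma moment_crank_cube_Suc:
  "moment (Suc j) (crank_gf ^ 3) = (\<Sum>i\<le>j. of_nat (j choose i) * moment i (crank_gf ^ 3) *
     (if odd (j - i) then 6 * sigma_gf (j - i) else 0))"
proof -
  have "z_deriv (crank_gf ^ 3) = crank_gf ^ 3 * (3 * (zq_log + qz_log))"
    by (simp add: power3_eq_cube z_deriv_mult z_deriv_crank_gf algebra_simps)
  moreover have "moment i (3 * (zq_log + qz_log)) = (if odd i then 6 * sigma_gf i else 0)" for i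
    by (simp only: moment_numeral_mult moment_log) simp
  ultimately show ?thesis
    by (simp only: moment_Suc moment_mult[of _ "crank_gf ^ 3"])
qed

lemma moment_crank_2: "moment 2 crank_gf = 2 * (sigma_gf 1 * moment 0 crank_gf)"
  using moment_crank_gf_Suc[of 1] by (simp add: expand_sums binomials numeral_2_eq_2)

lemma moment_crank_4: "moment 4 crank_gf = 2 * (sigma_gf 3 * moment 0 crank_gf) + 6 * (sigma_gf 1 *
     moment 2 crank_gf)"
  using moment_crank_gf_Suc[of 3] by (simp add: expand_sums binomials algebra_simps)

lemma moment_crank_6: "moment 6 crank_gf = 2 * (sigma_gf 5 * moment 0 crank_gf) + 20 * (sigma_gf 3 *
     moment 2 crank_gf) + 10 * (sigma_gf 1 * moment 4 crank_gf)"
  using moment_crank_gf_Suc[of 5] by (simp add: expand_sums binomials algebra_simps)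

lemma moment_crank_8: "moment 8 crank_gf = 2 * (sigma_gf 7 * moment 0 crank_gf) + 42 * (sigma_gf 5 *
     moment 2 crank_gf) + 70 * (sigma_gf 3 * moment 4 crank_gf) + 14 * (sigma_gf 1 * moment 6 crank_gf)"
  using moment_crank_gf_Suc[of 7] by (simp add: expand_sums binomials algebra_simps)

lemma moment_crank_10: "moment 10 crank_gf = 2 * (sigma_gf 9 * moment 0 crank_gf) + 72 * (sigma_gf 7 *
     moment 2 crank_gf) + 252 * (sigma_gf 5 * moment 4 crank_gf) + 168 * (sigma_gf 3 * moment 6 crank_gf)
     + 18 * (sigma_gf 1 * moment 8 crank_gf)"
  using moment_crank_gf_Suc[of 9] by (simp add: expand_sums binomials algebra_simps)

lemma moment_crank_12: "moment 12 crank_gf = 2 * (sigma_gf 11 * moment 0 crank_gf) + 110 * (sigma_gf 9 *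
     moment 2 crank_gf) + 660 * (sigma_gf 7 * moment 4 crank_gf) + 924 * (sigma_gf 5 * moment 6 crank_gf)
     + 330 * (sigma_gf 3 * moment 8 crank_gf) + 22 * (sigma_gf 1 * moment 10 crank_gf)"
  using moment_crank_gf_Suc[of 11] by (simp add: expand_sums binomials algebra_simps)

lemma moment_crank_14: "moment 14 crank_gf = 2 * (sigma_gf 13 * moment 0 crank_gf) + 156 * (sigma_gf 11 *
     moment 2 crank_gf) + 1430 * (sigma_gf 9 * moment 4 crank_gf) + 3432 * (sigma_gf 7 * moment 6
     crank_gf) + 2574 * (sigma_gf 5 * moment 8 crank_gf) + 572 * (sigma_gf 3 * moment 10 crank_gf) + 26 *
     (sigma_gf 1 * moment 12 crank_gf)"
  using moment_crank_gf_Suc[of 13] by (simp add: expand_sums binomials algebra_simps)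

lemma moment_cube_2: "moment 2 (crank_gf ^ 3) = 6 * (sigma_gf 1 * moment 0 (crank_gf ^ 3))"
  using moment_crank_cube_Suc[of 1] by (simp add: expand_sums binomials numeral_2_eq_2)

lemma moment_cube_4: "moment 4 (crank_gf ^ 3) = 6 * (sigma_gf 3 * moment 0 (crank_gf ^ 3)) + 18 *
     (sigma_gf 1 * moment 2 (crank_gf ^ 3))"
  using moment_crank_cube_Suc[of 3] by (simp add: expand_sums binomials algebra_simps)

lemma moment_cube_6: "moment 6 (crank_gf ^ 3) = 6 * (sigma_gf 5 * moment 0 (crank_gf ^ 3)) + 60 *
     (sigma_gf 3 * moment 2 (crank_gf ^ 3)) + 30 * (sigma_gf 1 * moment 4 (crank_gf ^ 3))"
  using moment_crank_cube_Suc[of 5] by (simp add: expand_sums binomials algebra_simps)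

lemma moment_cube_8: "moment 8 (crank_gf ^ 3) = 6 * (sigma_gf 7 * moment 0 (crank_gf ^ 3)) + 126 *
     (sigma_gf 5 * moment 2 (crank_gf ^ 3)) + 210 * (sigma_gf 3 * moment 4 (crank_gf ^ 3)) + 42 *
     (sigma_gf 1 * moment 6 (crank_gf ^ 3))"
  using moment_crank_cube_Suc[of 7] by (simp add: expand_sums binomials algebra_simps)

lemma moment_cube_10: "moment 10 (crank_gf ^ 3) = 6 * (sigma_gf 9 * moment 0 (crank_gf ^ 3)) + 216 *
     (sigma_gf 7 * moment 2 (crank_gf ^ 3)) + 756 * (sigma_gf 5 * moment 4 (crank_gf ^ 3)) + 504 *
     (sigma_gf 3 * moment 6 (crank_gf ^ 3)) + 54 * (sigma_gf 1 * moment 8 (crank_gf ^ 3))"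
  using moment_crank_cube_Suc[of 9] by (simp add: expand_sums binomials algebra_simps)

lemma moment_cube_12: "moment 12 (crank_gf ^ 3) = 6 * (sigma_gf 11 * moment 0 (crank_gf ^ 3)) + 330 *
     (sigma_gf 9 * moment 2 (crank_gf ^ 3)) + 1980 * (sigma_gf 7 * moment 4 (crank_gf ^ 3)) + 2772 *
     (sigma_gf 5 * moment 6 (crank_gf ^ 3)) + 990 * (sigma_gf 3 * moment 8 (crank_gf ^ 3)) + 66 *
     (sigma_gf 1 * moment 10 (crank_gf ^ 3))"
  using moment_crank_cube_Suc[of 11] by (simp add: expand_sums binomials algebra_simps)

lemma moment_cube_14: "moment 14 (crank_gf ^ 3) = 6 * (sigma_gf 13 * moment 0 (crank_gf ^ 3)) + 468 *
     (sigma_gf 11 * moment 2 (crank_gf ^ 3)) + 4290 * (sigma_gf 9 * moment 4 (crank_gf ^ 3)) + 10296 *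
     (sigma_gf 7 * moment 6 (crank_gf ^ 3)) + 7722 * (sigma_gf 5 * moment 8 (crank_gf ^ 3)) + 1716 *
     (sigma_gf 3 * moment 10 (crank_gf ^ 3)) + 78 * (sigma_gf 1 * moment 12 (crank_gf ^ 3))"
  using moment_crank_cube_Suc[of 13] by (simp add: expand_sums binomials algebra_simps)

lemma moment_X: "moment j fps_X = (- 1) ^ j * fps_X"
proof (induction j)
  case (Suc j)
  have "moment j (- fps_X) = - moment j fps_X" for j
    using moment_diff[of j 0 fps_X] moment_diff[of j 0 0] by simp
  with Suc show ?case by (simp add: moment_Suc)
qed (simp add: moment_0)

lemma moment_zq: "moment j (z_fps * q_fps) = fps_X"
  by (induction j) (simp_all add: moment_0 moment_Suc z_deriv_mult)

lemma moment_const_mult: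
  assumes "z_deriv f = 0"
  shows "moment j (f * g) = at_1 f * moment j g"
  using assms by (induction j arbitrary: g) (simp_all add: moment_0 moment_Suc z_deriv_mult)

lemma moment_zero [simp]: "moment j 0 = 0"
  using moment_diff[of j 0 0] by simp

text \<open>The differential equation is multiplied by \<open>q / z\<close> to make it symmetric under \<open>z \<mapsto> 1 / z\<close>.\<close>

lemma moment_rank_crank_pde:
  "partition_gf ^ 2 * ((\<Sum>i\<le>j. of_nat (j choose i) * ((- 1) ^ i + 1 - 2 * of_bool (i = 0)) *
       (6 * fps_XD (moment (j - i) rank_gf) + moment (j - i + 2) rank_gf)) +
     (\<Sum>i\<le>j. of_nat (j choose i) * ((- 1) ^ i - 1) * moment (j - i + 1) rank_gf) +
     2 * moment j rank_gf) = 2 * moment j (crank_gf ^ 3)"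
proof -
  define A where "A = 6 * fps_XD rank_gf + z_deriv (z_deriv rank_gf)"
  have A: "moment i A = 6 * fps_XD (moment i rank_gf) + moment (i + 2) rank_gf" for i
    by (simp add: A_def moment_add moment_numeral_mult moment_XD moment_Suc numeral_2_eq_2)
  have q: "moment i (2 * q_fps) = 2 * of_bool (i = 0) * fps_X" for i
    by (cases i) (simp_all add: moment_0 moment_Suc z_deriv_mult moment_numeral_mult moment_const_mult[of 0 _ 0, simplified])
  \<comment> \<open>These are \<open>X (1 - z)^2\<close> and \<open>X (1 - z^2)\<close> with
    \<open>X = q / z\<close>. They are sums of the eigenvectors \<open>q / z\<close>,
    \<open>q\<close>, \<open>z q\<close> of \<open>z_deriv\<close> with eigenvalues -1, 0, 1, so
    their moments are explicit.\<close>
  define U V where "U = fps_X - 2 * q_fps + z_fps * q_fps" and "V = fps_X - z_fps * q_fps"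
  have U: "moment i U = ((- 1) ^ i + 1 - 2 * of_bool (i = 0)) * fps_X" for i
    by (simp only: U_def moment_add moment_diff moment_X moment_zq q) (simp add: algebra_simps)
  have V: "moment i V = ((- 1) ^ i - 1) * fps_X" for i
    by (simp only: V_def moment_diff moment_X moment_zq) (simp add: algebra_simps)
  have "fps_X * rank_op = U * A + V * z_deriv rank_gf + 2 * q_fps * rank_gf"
    by (simp add: rank_op_def A_def U_def V_def q_fps_def) algebra
  moreover have "moment j (2 * q_fps * rank_gf) = 2 * fps_X * moment j rank_gf"
    by (subst moment_const_mult) (simp_all add: z_deriv_mult)
  ultimately have "moment j (fps_X * rank_op) =
      (\<Sum>i\<le>j. of_nat (j choose i) * (((- 1) ^ i + 1 - 2 * of_bool (i = 0)) * fps_X) * moment (j - i) A) +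
      (\<Sum>i\<le>j. of_nat (j choose i) * (((- 1) ^ i - 1) * fps_X) * moment (j - i) (z_deriv rank_gf)) +
      2 * fps_X * moment j rank_gf"
    by (simp only: moment_add moment_mult[of j U A] moment_mult[of j V "z_deriv rank_gf"] U V)
  also have "\<dots> = fps_X * ((\<Sum>i\<le>j. of_nat (j choose i) * ((- 1) ^ i + 1 - 2 * of_bool (i = 0)) * moment (j - i) A) +
      (\<Sum>i\<le>j. of_nat (j choose i) * ((- 1) ^ i - 1) * moment (j - i + 1) rank_gf) + 2 * moment j rank_gf)"
    by (simp add: distrib_left sum_distrib_left moment_Suc mult_ac)
  finally have W: "moment j (fps_X * rank_op) = fps_X * ((\<Sum>i\<le>j. of_nat (j choose i) *
      ((- 1) ^ i + 1 - 2 * of_bool (i = 0)) * moment (j - i) A) +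
      (\<Sum>i\<le>j. of_nat (j choose i) * ((- 1) ^ i - 1) * moment (j - i + 1) rank_gf) + 2 * moment j rank_gf)"
    (is "_ = fps_X * ?T") .
  have "z_deriv (gf_q ^ 2) = 0" "z_deriv (2 * q_fps) = 0"
    by (simp_all add: power2_eq_square z_deriv_mult)
  note const = this[THEN moment_const_mult]
  have "gf_q ^ 2 * (fps_X * rank_op) = 2 * q_fps * crank_gf ^ 3"
    using rank_crank_pde by (simp add: q_fps_def, algebra?)
  then have "moment j (gf_q ^ 2 * (fps_X * rank_op)) = moment j (2 * q_fps * crank_gf ^ 3)"
    by simp
  then have "partition_gf ^ 2 * (fps_X * ?T) = 2 * fps_X * moment j (crank_gf ^ 3)"
    by (simp only: const W at_1_power at_1_gf at_1_mult at_1_numeral at_1_q)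
  then have "fps_X * (partition_gf ^ 2 * ?T) = fps_X * (2 * moment j (crank_gf ^ 3))"
    by (simp only: mult_ac)
  then have "partition_gf ^ 2 * ?T = 2 * moment j (crank_gf ^ 3)"
    by (simp only: mult_left_cancel[OF fps_X_neq_zero])
  then show ?thesis by (simp only: A)
qed

text \<open>In even order, the first sum keeps only even positive \<open>i\<close> and the second
  only odd \<open>i\<close>, each with coefficient 2 up to sign. So only even rank moments occur and
  the equation can be halved.\<close>

lemma moment_pde_4: "partition_gf ^ 2 * (3 * moment 4 rank_gf - 3 * moment 2 rank_gf + 36 * fps_XD
     (moment 2 rank_gf) + 6 * fps_XD (moment 0 rank_gf)) = moment 4 (crank_gf ^ 3)"
  (is "_ * ?W = ?K")
proof -
  have "2 * (partition_gf ^ 2 * ?W) = 2 * ?K"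
    unfolding moment_rank_crank_pde[symmetric] by (simp add: expand_sums binomials numeral_2_eq_2[symmetric], algebra?)
  then show ?thesis by simp
qed

lemma moment_pde_6: "partition_gf ^ 2 * (10 * moment 6 rank_gf - 5 * moment 4 rank_gf - 5 * moment 2
     rank_gf + 90 * fps_XD (moment 4 rank_gf) + 90 * fps_XD (moment 2 rank_gf) + 6 * fps_XD (moment 0
     rank_gf)) = moment 6 (crank_gf ^ 3)"
  (is "_ * ?W = ?K")
proof -
  have "2 * (partition_gf ^ 2 * ?W) = 2 * ?K"
    unfolding moment_rank_crank_pde[symmetric] by (simp add: expand_sums binomials numeral_2_eq_2[symmetric], algebra?)
  then show ?thesis by simp
qed

lemma moment_pde_8: "partition_gf ^ 2 * (21 * moment 8 rank_gf + 14 * moment 6 rank_gf - 28 * moment 4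
     rank_gf - 7 * moment 2 rank_gf + 168 * fps_XD (moment 6 rank_gf) + 420 * fps_XD (moment 4 rank_gf) +
     168 * fps_XD (moment 2 rank_gf) + 6 * fps_XD (moment 0 rank_gf)) = moment 8 (crank_gf ^ 3)"
  (is "_ * ?W = ?K")
proof -
  have "2 * (partition_gf ^ 2 * ?W) = 2 * ?K"
    unfolding moment_rank_crank_pde[symmetric] by (simp add: expand_sums binomials numeral_2_eq_2[symmetric], algebra?)
  then show ?thesis by simp
qed

lemma moment_pde_10: "partition_gf ^ 2 * (36 * moment 10 rank_gf + 90 * moment 8 rank_gf - 42 * moment
     6 rank_gf - 75 * moment 4 rank_gf - 9 * moment 2 rank_gf + 270 * fps_XD (moment 8 rank_gf) + 1260 *
     fps_XD (moment 6 rank_gf) + 1260 * fps_XD (moment 4 rank_gf) + 270 * fps_XD (moment 2 rank_gf) + 6 *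
     fps_XD (moment 0 rank_gf)) = moment 10 (crank_gf ^ 3)"
  (is "_ * ?W = ?K")
proof -
  have "2 * (partition_gf ^ 2 * ?W) = 2 * ?K"
    unfolding moment_rank_crank_pde[symmetric] by (simp add: expand_sums binomials numeral_2_eq_2[symmetric], algebra?)
  then show ?thesis by simp
qed

lemma moment_pde_12: "partition_gf ^ 2 * (55 * moment 12 rank_gf + 275 * moment 10 rank_gf + 132 *
     moment 8 rank_gf - 297 * moment 6 rank_gf - 154 * moment 4 rank_gf - 11 * moment 2 rank_gf + 396 *
     fps_XD (moment 10 rank_gf) + 2970 * fps_XD (moment 8 rank_gf) + 5544 * fps_XD (moment 6 rank_gf) +
     2970 * fps_XD (moment 4 rank_gf) + 396 * fps_XD (moment 2 rank_gf) + 6 * fps_XD (moment 0 rank_gf))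
     = moment 12 (crank_gf ^ 3)"
  (is "_ * ?W = ?K")
proof -
  have "2 * (partition_gf ^ 2 * ?W) = 2 * ?K"
    unfolding moment_rank_crank_pde[symmetric] by (simp add: expand_sums binomials numeral_2_eq_2[symmetric], algebra?)
  then show ?thesis by simp
qed

lemma moment_pde_14: "partition_gf ^ 2 * (78 * moment 14 rank_gf + 637 * moment 12 rank_gf + 1001 *
     moment 10 rank_gf - 429 * moment 8 rank_gf - 1001 * moment 6 rank_gf - 273 * moment 4 rank_gf - 13 *
     moment 2 rank_gf + 546 * fps_XD (moment 12 rank_gf) + 6006 * fps_XD (moment 10 rank_gf) + 18018 *
     fps_XD (moment 8 rank_gf) + 18018 * fps_XD (moment 6 rank_gf) + 6006 * fps_XD (moment 4 rank_gf) +
     546 * fps_XD (moment 2 rank_gf) + 6 * fps_XD (moment 0 rank_gf)) = moment 14 (crank_gf ^ 3)"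
  (is "_ * ?W = ?K")
proof -
  have "2 * (partition_gf ^ 2 * ?W) = 2 * ?K"
    unfolding moment_rank_crank_pde[symmetric] by (simp add: expand_sums binomials numeral_2_eq_2[symmetric], algebra?)
  then show ?thesis by simp
qed

section \<open>Laurent series and conclusion\<close>

lemma fps_to_fls_XD: "fps_to_fls (fps_XD f) = fls_X * fls_deriv (fps_to_fls f)"
  by (simp add: fps_XD_def fls_times_fps_to_fls fls_deriv_fps_to_fls)

text \<open>Power series over the reals are not a field, as \<open>moment_algebra\<close> demands;
  their images in the Laurent series are elements of one, and all assumptions transfer along the
  injective embedding.\<close>

lemma moment_algebra_fls:
  "moment_algebra (\<lambda>f. fls_X * fls_deriv f) (fps_to_fls partition_gf) (\<lambda>j. fps_to_fls (sigma_gf j))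
     (\<lambda>j. fps_to_fls (moment j crank_gf)) (\<lambda>j. fps_to_fls (moment j rank_gf))
     (\<lambda>j. fps_to_fls (moment j (crank_gf ^ 3)))"
proof -
  note to_fls = fps_to_fls_XD[symmetric] fps_to_fls_plus[symmetric] fps_to_fls_minus[symmetric]
    fps_to_fls_uminus[symmetric] fls_times_fps_to_fls[symmetric] fps_to_fls_numeral[symmetric]
    fps_to_fls_power[symmetric] fps_one_to_fls[symmetric] fps_to_fls_eq_iff
  show ?thesis
  proof (unfold_locales, goal_cases)
    case (1 f g) show ?case by (simp add: distrib_left)
  next
    case (2 f g) show ?case by (simp add: algebra_simps)
  next
    case 3 show ?case by (simp add: partition_gf_nonzero)
  next
    case 4 show ?case by (simp only: to_fls fps_XD_partition_gf)
  next
    case 5 show ?case by (simp only: to_fls moment_crank_gf_0)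
  next
    case 6 show ?case by (simp only: to_fls moment_crank_cube_0)
  next
    case 7 show ?case by (simp only: to_fls moment_rank_gf_0)
  next
    case 8 show ?case by (simp only: to_fls sigma_gf_3_square)
  next
    case 9 show ?case by (simp only: to_fls sigma_convolution_2)
  next
    case 10 show ?case by (simp only: to_fls sigma_convolution_4)
  next
    case 11 show ?case by (simp only: to_fls sigma_convolution_6)
  next
    case 12 show ?case by (simp only: to_fls sigma_convolution_8)
  next
    case 13 show ?case by (simp only: to_fls sigma_convolution_10)
  next
    case 14 show ?case by (simp only: to_fls sigma_convolution_12)
  next
    case 15 show ?case by (simp only: to_fls moment_crank_2)
  next
    case 16 show ?case by (simp only: to_fls moment_crank_4)
  next
    case 17 show ?case by (simp only: to_fls moment_crank_6)
  next
    case 18 show ?case by (simp only: to_fls moment_crank_8)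
  next
    case 19 show ?case by (simp only: to_fls moment_crank_10)
  next
    case 20 show ?case by (simp only: to_fls moment_crank_12)
  next
    case 21 show ?case by (simp only: to_fls moment_crank_14)
  next
    case 22 show ?case by (simp only: to_fls moment_cube_2)
  next
    case 23 show ?case by (simp only: to_fls moment_cube_4)
  next
    case 24 show ?case by (simp only: to_fls moment_cube_6)
  next
    case 25 show ?case by (simp only: to_fls moment_cube_8)
  next
    case 26 show ?case by (simp only: to_fls moment_cube_10)
  next
    case 27 show ?case by (simp only: to_fls moment_cube_12)
  next
    case 28 show ?case by (simp only: to_fls moment_cube_14)
  next
    case 29 show ?case by (simp only: to_fls moment_pde_4)
  next
    case 30 show ?case by (simp only: to_fls moment_pde_6)
  next
    case 31 show ?case by (simp only: to_fls moment_pde_8)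
  next
    case 32 show ?case by (simp only: to_fls moment_pde_10)
  next
    case 33 show ?case by (simp only: to_fls moment_pde_12)
  next
    case 34 show ?case by (simp only: to_fls moment_pde_14)
  qed
qed

interpretation fls: moment_algebra "\<lambda>f. fls_X * fls_deriv f" "fps_to_fls partition_gf"
  "\<lambda>j. fps_to_fls (sigma_gf j)" "\<lambda>j. fps_to_fls (moment j crank_gf)"
  "\<lambda>j. fps_to_fls (moment j rank_gf)" "\<lambda>j. fps_to_fls (moment j (crank_gf ^ 3))"
  by (rule moment_algebra_fls)

theorem theorem5p1:
  fixes n :: nat
  shows
    "real_of_int (rank_moment 4 n) =
       2 / 3 * (-3 * real n - 1) * real_of_int (crank_moment 2 n)
       + 8 / 3 * real_of_int (crank_moment 4 n)
       + (-12 * real n + 1) * real_of_int (rank_moment 2 n)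
     \<and>
     real_of_int (rank_moment 6 n) =
       2 / 33 * (324 * real n ^ 2 + 69 * real n - 10) * real_of_int (crank_moment 2 n)
       + 20 / 33 * (-45 * real n + 4) * real_of_int (crank_moment 4 n)
       + 18 / 11 * real_of_int (crank_moment 6 n)
       + (108 * real n ^ 2 - 24 * real n + 1) * real_of_int (rank_moment 2 n)
     \<and>
     real_of_int (rank_moment 8 n) =
       2 / 913 * (-72972 * real n ^ 3 - 1728 * real n ^ 2 + 5667 * real n - 289)
         * real_of_int (crank_moment 2 n)
       + 280 / 913 * (732 * real n ^ 2 - 195 * real n + 8) * real_of_int (crank_moment 4 n)
       + 84 / 913 * (-196 * real n + 15) * real_of_int (crank_moment 6 n)
       + 1248 / 913 * real_of_int (crank_moment 8 n)
       + (-864 * real n ^ 3 + 360 * real n ^ 2 - 36 * real n + 1) * real_of_int (rank_moment 2 n)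
     \<and>
     real_of_int (rank_moment 10 n) =
       2 / 5951847
         * (3588144480 * real n ^ 4 - 805458600 * real n ^ 3 - 398007108 * real n ^ 2
            + 56257647 * real n - 1794592)
         * real_of_int (crank_moment 2 n)
       + 140 / 5951847
         * (-72270360 * real n ^ 3 + 36826920 * real n ^ 2 - 3625245 * real n + 104002)
         * real_of_int (crank_moment 4 n)
       + 210 / 1983949 * (1421544 * real n ^ 2 - 380744 * real n + 13519)
         * real_of_int (crank_moment 6 n)
       + 120 / 1983949 * (-282435 * real n + 18796) * real_of_int (crank_moment 8 n)
       + 2724 / 2173 * real_of_int (crank_moment 10 n)
       + (6480 * real n ^ 4 - 4320 * real n ^ 3 + 756 * real n ^ 2 - 48 * real n + 1)
         * real_of_int (rank_moment 2 n)
     \<and>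
     real_of_int (rank_moment 14 n) =
       1 / 4505033323132497
         * (-655918847016750354240 * real n ^ 6 + 584104439765983424400 * real n ^ 5
            - 88193910587689930464 * real n ^ 4 - 51255985689606317364 * real n ^ 3
            + 12889219681488512844 * real n ^ 2 - 1033571808069319887 * real n
            + 23432656561492057)
         * real_of_int (crank_moment 2 n)
       + 364 / 4505033323132497
         * (2544016408481081520 * real n ^ 5 - 2986029950270749200 * real n ^ 4
            + 1233083592931144500 * real n ^ 3 - 185464100558325420 * real n ^ 2
            + 12124758510318780 * real n - 229618708346923)
         * real_of_int (crank_moment 4 n)
       + 728 / 500559258125833
         * (-12932704022040180 * real n ^ 4 + 11781511098477120 * real n ^ 3
            - 3661921161131415 * real n ^ 2 + 234233352768436 * real n - 7334109150929)
         * real_of_int (crank_moment 6 n)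
       + 364 / 500559258125833
         * (3327634333443960 * real n ^ 3 - 2184561928177200 * real n ^ 2
            + 464283118670595 * real n - 12774042869566)
         * real_of_int (crank_moment 8 n)
       + 2002 / 6030834435251
         * (-758615153688 * real n ^ 2 + 404700708960 * real n - 24122003839)
         * real_of_int (crank_moment 10 n)
       + 25388554464 / 2775349487 * (real n - 1) * real_of_int (crank_moment 12 n)
       + 139497552 / 120667369 * real_of_int (crank_moment 14 n)
       + 1 / 138
         * (-107775360 * real n ^ 6 + 143700480 * real n ^ 5 - 70752528 * real n ^ 4
            + 14978304 * real n ^ 3 - 1456488 * real n ^ 2 + 64320 * real n - 1045)
         * real_of_int (rank_moment 2 n)
       + 91 / 138 * (-36 * real n + 13) * real_of_int (rank_moment 12 n)"
proof -
  \<comment> \<open>Each application of the derivation contributes a factor \<open>n\<close>, so the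
    differential relations become polynomial in \<open>n\<close>.\<close>
  have nth: "fls_nth (fls_X * fls_deriv f) (int n) = real n * fls_nth f (int n)" for f :: "real fls"
    by (simp add: fls_X_times_conv_shift)
  have R: "fls_nth (fps_to_fls (moment j rank_gf)) (int n) = real_of_int (rank_moment j n)"
    and C: "fls_nth (fps_to_fls (moment j crank_gf)) (int n) = real_of_int (crank_moment j n)" for j
    by (simp_all add: moment_rank_gf_nth moment_crank_gf_nth)
  note relations = fls.rank_relation_4 fls.rank_relation_6 fls.rank_relation_8 fls.rank_relation_10
    fls.rank_relation_14
  note rel = relations[THEN arg_cong[where f = "\<lambda>f. fls_nth f (int n)"],
    unfolded mult_minus_left fls_plus_nth fls_minus_nth fls_uminus_nth fls_mult_of_numeral_nth nth R C]
  have scale: "x = y" if "m * x = m * y" "m \<noteq> 0" for m x y :: real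
    using that by simp
  show ?thesis
  proof (intro conjI, goal_cases)
    case 1
    show ?case
    \<comment> \<open>Here and in the other cases the scale is a common multiple of the denominators
      in the claim, the one by which the corresponding \<open>rank_relation\<close> was
      multiplied.\<close>
    proof (rule scale[of 3], unfold rel(1))
    qed (simp_all add: ring_distribs, (simp_all add: power_numeral_reduce)?)
  next
    case 2
    show ?case
    proof (rule scale[of 33], unfold rel(2))
    qed (simp_all add: ring_distribs, (simp_all add: power_numeral_reduce)?)
  next
    case 3
    show ?case
    proof (rule scale[of 913], unfold rel(3))
    qed (simp_all add: ring_distribs, (simp_all add: power_numeral_reduce)?)
  next
    case 4
    show ?case
    proof (rule scale[of 5951847], unfold rel(4))
    qed (simp_all add: ring_distribs, (simp_all add: power_numeral_reduce)?)
  next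
    case 5
    show ?case
    proof (rule scale[of 9010066646264994], unfold rel(5))
    qed (simp_all add: ring_distribs, (simp_all add: power_numeral_reduce)?)
  qed
qed

end
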